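(* Let $a_h,s_h$ be symmetric positive semidefinite bilinear forms on $V_h$, $\tau>0$, $A_h=a_h+\tau s_h$ and $\|v\|_{A_h}^2=A_h(v,v)$, where $A_h(1,v)=0$ for all $v\in V_h$. Assume that for all $v\in V_{h,0}$ the discrete Poincaré estimate $$h^{-c}\|v-\lambda_{\Gamma_h}(v)\|_{\mathcal T_h}^2\lesssim \|v\|_{A_h}^2$$ and the inverse estimate $$\|v\|_{A_h}^2\lesssim h^{-2-c}\|v\|_{\mathcal T_h}^2$$ hold, with hidden constants independent of $h$ and of the position of the manifold in the background mesh. Let $\mathcal A\in\mathbb R^{N\times N}$ be the stiffness matrix defined by $(\mathcal A V,W)_{\mathbb R^N}=A_h(v,w)$ for all $v=\sum_i V_i\phi_i$, $w=\sum_i W_i\phi_i$ in $V_h$. Then the condition number of $\mathcal A$ satisfies $$\kappa(\mathcal A)\lesssim h^{-2},$$ where the hidden constant depends only on the quasi-uniformness parameters of the mesh (and on the constants in the two assumed estimates and in the standing geometric assumptions); in particular it does not depend on how $\Gamma_h$ cuts the background mesh.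
   Context: Manifold: $\Gamma\subset\mathbb R^k$ is a smooth compact $d$-dimensional embedded submanifold without boundary, $c=k-d\ge1$. $\rho(x)=\mathrm{dist}(x,\Gamma)$, $U_\delta(\Gamma)=\{\rho<\delta\}$; $\delta_0>0$ is fixed so small that the closest point projection $p:U_{\delta_0}(\Gamma)\to\Gamma$ is well defined and smooth. $P_\Gamma(q)$ is the orthogonal projection of $\mathbb R^k$ onto $T_q\Gamma$, and $P_\Gamma^e=P_\Gamma\circ p$. Discrete manifold: for $h\in(0,h_0]$, $\mathcal K_h$ is a conforming mesh without boundary of non-degenerate (not necessarily shape-regular) $d$-simplices $K\subset\mathbb R^k$, $\Gamma_h=\bigcup_K K$; $P_{\Gamma_h}$ is the piecewise constant orthogonal projection onto the $d$-dimensional linear space parallel to $K$. Standing assumptions: $\Gamma_h\subset U_{\delta_0}(\Gamma)$, $p:\Gamma_h\to\Gamma$ is a bijection, $\|\rho\|_{L^\infty(\Gamma_h)}\lesssim h^2$, $\|P_\Gamma^e-P_{\Gamma_h}\|_{L^\infty(\Gamma_h)}\lesssim h$. Background mesh: $\widetilde{\mathcal T}_h$ is a quasi-uniform mesh, with mesh parameter $h$, of shape-regular closed $k$-simplices covering a bounded open set containing $U_{\delta_0}(\Gamma)$. Active mesh $\mathcal T_h=\{T\in\widetilde{\mathcal T}_h:T\cap\Gamma_h\ne\emptyset\}$, $N_h=\bigcup_{T\in\mathcal T_h}T$; $\|\cdot\|_{\mathcal T_h}$ is the $L^2(N_h)$ norm. $V_h$ is the space of continuous functions on $N_h$ that are affine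 on each $T\in\mathcal T_h$, with nodal basis $\{\phi_i\}_{i=1}^N$; $\lambda_{\Gamma_h}(v)=|\Gamma_h|^{-1}\int_{\Gamma_h}v$ is the average; $V_{h,0}=\{v\in V_h:\lambda_{\Gamma_h}(v)=0\}$. Condition number: $\ker\mathcal A=\mathrm{span}\{(1,\dots,1)^T\}$ and $\mathcal A$ is regarded as a bijection $\widehat{\mathbb R}^N=\mathbb R^N/\ker\mathcal A\to(\ker\mathcal A)^\perp$ (Euclidean/quotient norm); $\|\mathcal A\|_{\mathbb R^N}=\sup_{V\in\widehat{\mathbb R}^N\setminus 0}\|\mathcal AV\|_{\mathbb R^N}/\|V\|_{\mathbb R^N}$ and $\kappa(\mathcal A)=\|\mathcal A\|_{\mathbb R^N}\|\mathcal A^{-1}\|_{\mathbb R^N}$. $a\lesssim b$ means $a\le Cb$ with $C>0$ independent of $h\in(0,h_0]$, $h_0$ sufficiently small, and of the position of $\Gamma_h$ relative to the mesh. *)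

theory Defs
  imports
    "HOL-Analysis.Analysis"
    "Jordan_Normal_Form.Matrix_Kernel"
begin

section \<open>The manifold\<close>

primrec C_diff_on :: "nat \<Rightarrow> 'a::euclidean_space set \<Rightarrow> ('a \<Rightarrow> 'b::euclidean_space) \<Rightarrow> bool" where
  "C_diff_on 0 S f \<longleftrightarrow> continuous_on S f"
| "C_diff_on (Suc n) S f \<longleftrightarrow>
     (\<forall>x\<in>S. f differentiable (at x)) \<and>
     (\<forall>v. C_diff_on n S (\<lambda>x. frechet_derivative f (at x) v))"

text \<open>Only used for open sets \<open>S\<close>, where it is membership in \<open>C\<^sup>\<infinity>(S)\<close>.\<close>

definition smooth_on :: "'a::euclidean_space set \<Rightarrow> ('a \<Rightarrow> 'b::euclidean_space) \<Rightarrow> bool" where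
  "smooth_on S f \<longleftrightarrow> (\<forall>n. C_diff_on n S f)"

text \<open>
  The intrinsic dimension \<open>d\<close> is carried by a Euclidean space \<open>'d\<close> of parameters
  (\<open>d = DIM('d) \<ge> 1\<close>); the ambient space is \<open>'a\<close> (\<open>k = DIM('a)\<close>). Each point of the manifold has
  a local parametrization that is smooth, an immersion, and a homeomorphism onto a relatively
  open piece of the manifold.
\<close>

definition compact_submanifold :: "'d::euclidean_space itself \<Rightarrow> 'a::euclidean_space set \<Rightarrow> bool" where
  "compact_submanifold TYPE('d) \<Gamma> \<longleftrightarrow>
     compact \<Gamma> \<and> \<Gamma> \<noteq> {} \<and>
     (\<forall>q\<in>\<Gamma>. \<exists>U V (\<phi> :: 'd \<Rightarrow> 'a) \<psi>.
        open U \<and> q \<in> U \<and> open V \<and> smooth_on V \<phi> \<and>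
        (\<forall>x\<in>V. inj (frechet_derivative \<phi> (at x))) \<and>
        homeomorphism V (\<Gamma> \<inter> U) \<phi> \<psi>)"

text \<open>Velocities at \<open>q\<close> of curves in \<open>\<Gamma>\<close> through \<open>q\<close>.\<close>

definition tangent_space :: "'a::euclidean_space set \<Rightarrow> 'a \<Rightarrow> 'a set" where
  "tangent_space \<Gamma> q =
     {v. \<exists>\<gamma> \<epsilon>. 0 < \<epsilon> \<and> \<gamma> ` {-\<epsilon><..<\<epsilon>} \<subseteq> \<Gamma> \<and> \<gamma> 0 = q \<and>
         (\<gamma> has_vector_derivative v) (at (0::real))}"

definition orth_proj :: "'a::euclidean_space set \<Rightarrow> 'a \<Rightarrow> 'a" where
  "orth_proj S x = (THE y. y \<in> S \<and> (\<forall>z\<in>S. inner (x - y) z = 0))"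

definition tube :: "'a::euclidean_space set \<Rightarrow> real \<Rightarrow> 'a set" where
  "tube \<Gamma> \<delta> = {x. infdist x \<Gamma> < \<delta>}"

definition smooth_projection_tube :: "'a::euclidean_space set \<Rightarrow> real \<Rightarrow> bool" where
  "smooth_projection_tube \<Gamma> \<delta> \<longleftrightarrow>
     0 < \<delta> \<and>
     (\<forall>x\<in>tube \<Gamma> \<delta>. \<exists>!q. q \<in> \<Gamma> \<and> dist x q = infdist x \<Gamma>) \<and>
     smooth_on (tube \<Gamma> \<delta>) (closest_point \<Gamma>)"

section \<open>The discrete manifold\<close>

definition direction_space :: "'a::euclidean_space set \<Rightarrow> 'a set" where
  "direction_space K = Real_Vector_Spaces.span {x - y | x y. x \<in> K \<and> y \<in> K}"

text \<open>
  Conforming: \<^const>\<open>triangulation\<close> demands that any two simplices meet in a common face (possibly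
  empty). Without boundary: every \<open>(d - 1)\<close>-dimensional face is shared by exactly two simplices.
\<close>

definition closed_surface_mesh :: "'d::euclidean_space itself \<Rightarrow> 'a::euclidean_space set set \<Rightarrow> bool" where
  "closed_surface_mesh TYPE('d) \<K> \<longleftrightarrow>
     triangulation \<K> \<and>
     (\<forall>K\<in>\<K>. int DIM('d) simplex K) \<and>
     (\<forall>K\<in>\<K>. \<forall>F. F facet_of K \<longrightarrow> card {K'\<in>\<K>. F facet_of K'} = 2)"

text \<open>
  The \<open>L\<^sup>\<infinity>\<close> norms over the discrete manifold are written as pointwise bounds: the distance
  function is continuous, and so is the difference of the projections on each closed simplex.
\<close>

definition discrete_manifold ::
  "'d::euclidean_space itself \<Rightarrow> 'a::euclidean_space set \<Rightarrow> real \<Rightarrow> real \<Rightarrow> real \<Rightarrow> real \<Rightarrow> 'a set set \<Rightarrow> bool"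
where
  "discrete_manifold TYPE('d) \<Gamma> \<delta> C\<^sub>\<rho> C\<^sub>P h \<K> \<longleftrightarrow>
     closed_surface_mesh TYPE('d) \<K> \<and>
     \<Union>\<K> \<subseteq> tube \<Gamma> \<delta> \<and>
     bij_betw (closest_point \<Gamma>) (\<Union>\<K>) \<Gamma> \<and>
     (\<forall>x\<in>\<Union>\<K>. infdist x \<Gamma> \<le> C\<^sub>\<rho> * h\<^sup>2) \<and>
     (\<forall>K\<in>\<K>. \<forall>x\<in>K.
        onorm (\<lambda>w. orth_proj (tangent_space \<Gamma> (closest_point \<Gamma> x)) w
                   - orth_proj (direction_space K) w) \<le> C\<^sub>P * h)"

text \<open>
  The \<open>d\<close>-dimensional surface measure on a \<open>d\<close>-simplex is Lebesgue measure transported by an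
  isometric affine parametrization of its affine hull; the choice of the latter is immaterial.
\<close>

definition flat_param :: "'a::euclidean_space set \<Rightarrow> 'd::euclidean_space \<Rightarrow> 'a" where
  "flat_param K = (SOME F. \<exists>a L. a \<in> K \<and> linear L \<and> (\<forall>x. norm (L x) = norm x) \<and>
                     range L = direction_space K \<and> F = (\<lambda>x. a + L x))"

definition simplex_integral ::
  "'d::euclidean_space itself \<Rightarrow> 'a::euclidean_space set \<Rightarrow> ('a \<Rightarrow> real) \<Rightarrow> real"
where
  "simplex_integral TYPE('d) K v =
     (let F = (flat_param K :: 'd \<Rightarrow> 'a) in LINT x : F -` K | lborel. v (F x))"

definition surface_integral ::
  "'d::euclidean_space itself \<Rightarrow> 'a::euclidean_space set set \<Rightarrow> ('a \<Rightarrow> real) \<Rightarrow> real"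
where
  "surface_integral TYPE('d) \<K> v = (\<Sum>K\<in>\<K>. simplex_integral TYPE('d) K v)"

definition surface_average ::
  "'d::euclidean_space itself \<Rightarrow> 'a::euclidean_space set set \<Rightarrow> ('a \<Rightarrow> real) \<Rightarrow> real"
where
  "surface_average TYPE('d) \<K> v =
     surface_integral TYPE('d) \<K> v / surface_integral TYPE('d) \<K> (\<lambda>_. 1)"

section \<open>The background mesh and the finite element space\<close>

text \<open>
  Quasi-uniformity with constant \<open>c\<^sub>q\<close> and mesh parameter \<open>h\<close>; shape regularity with constant
  \<open>\<sigma>\<close>, in terms of the ratio of the diameter to the radius of an inscribed ball.
\<close>

definition background_mesh ::
  "'a::euclidean_space set \<Rightarrow> real \<Rightarrow> real \<Rightarrow> real \<Rightarrow> real \<Rightarrow> 'a set set \<Rightarrow> bool"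
where
  "background_mesh \<Gamma> \<delta> c\<^sub>q \<sigma> h \<T> \<longleftrightarrow>
     triangulation \<T> \<and>
     (\<forall>T\<in>\<T>. int DIM('a) simplex T) \<and>
     (\<exists>\<Omega>. open \<Omega> \<and> bounded \<Omega> \<and> tube \<Gamma> \<delta> \<subseteq> \<Omega> \<and> \<Omega> \<subseteq> \<Union>\<T>) \<and>
     (\<forall>T\<in>\<T>. h \<le> c\<^sub>q * diameter T \<and> diameter T \<le> c\<^sub>q * h) \<and>
     (\<forall>T\<in>\<T>. \<exists>z r. cball z r \<subseteq> T \<and> diameter T \<le> \<sigma> * r)"

definition active_mesh :: "'a::euclidean_space set set \<Rightarrow> 'a set set \<Rightarrow> 'a set set" where
  "active_mesh \<T> \<K> = {T\<in>\<T>. T \<inter> \<Union>\<K> \<noteq> {}}"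

text \<open>
  Functions on \<open>N\<^sub>h = \<Union>\<T>\<close> are represented by functions on the whole space that vanish off
  \<open>N\<^sub>h\<close>; in particular the constant function 1 on \<open>N\<^sub>h\<close> is the indicator of \<open>N\<^sub>h\<close>.
\<close>

definition P1_space :: "'a::euclidean_space set set \<Rightarrow> ('a \<Rightarrow> real) set" where
  "P1_space \<T> =
     {v. continuous_on (\<Union>\<T>) v \<and>
         (\<forall>T\<in>\<T>. \<exists>g b. \<forall>x\<in>T. v x = inner g x + b) \<and>
         (\<forall>x. x \<notin> \<Union>\<T> \<longrightarrow> v x = 0)}"

definition mesh_nodes :: "'a::euclidean_space set set \<Rightarrow> 'a set" where
  "mesh_nodes \<T> = {x. \<exists>T\<in>\<T>. x extreme_point_of T}"

definition nodal_basis ::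
  "'a::euclidean_space set set \<Rightarrow> nat \<Rightarrow> (nat \<Rightarrow> 'a) \<Rightarrow> (nat \<Rightarrow> 'a \<Rightarrow> real) \<Rightarrow> bool"
where
  "nodal_basis \<T> N x \<phi> \<longleftrightarrow>
     bij_betw x {..<N} (mesh_nodes \<T>) \<and>
     (\<forall>i<N. \<phi> i \<in> P1_space \<T> \<and> (\<forall>j<N. \<phi> i (x j) = (if i = j then 1 else 0)))"

definition L2_norm_mesh :: "'a::euclidean_space set set \<Rightarrow> ('a \<Rightarrow> real) \<Rightarrow> real" where
  "L2_norm_mesh \<T> v = sqrt (LINT x : \<Union>\<T> | lborel. (v x)\<^sup>2)"

definition sym_psd_form :: "('a \<Rightarrow> real) set \<Rightarrow> (('a \<Rightarrow> real) \<Rightarrow> ('a \<Rightarrow> real) \<Rightarrow> real) \<Rightarrow> bool" where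
  "sym_psd_form V a \<longleftrightarrow>
     (\<forall>u\<in>V. \<forall>v\<in>V. \<forall>w\<in>V. a (\<lambda>x. u x + v x) w = a u w + a v w) \<and>
     (\<forall>r. \<forall>v\<in>V. \<forall>w\<in>V. a (\<lambda>x. r * v x) w = r * a v w) \<and>
     (\<forall>v\<in>V. \<forall>w\<in>V. a v w = a w v) \<and>
     (\<forall>v\<in>V. 0 \<le> a v v)"

definition stiffness_matrix ::
  "nat \<Rightarrow> (nat \<Rightarrow> 'a \<Rightarrow> real) \<Rightarrow> (('a \<Rightarrow> real) \<Rightarrow> ('a \<Rightarrow> real) \<Rightarrow> real) \<Rightarrow> real mat \<Rightarrow> bool"
where
  "stiffness_matrix N \<phi> A M \<longleftrightarrow>
     M \<in> carrier_mat N N \<and>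
     (\<forall>V\<in>carrier_vec N. \<forall>W\<in>carrier_vec N.
        scalar_prod (M *\<^sub>v V) W =
        A (\<lambda>y. \<Sum>i<N. vec_index V i * \<phi> i y) (\<lambda>y. \<Sum>i<N. vec_index W i * \<phi> i y))"

section \<open>The condition number\<close>

text \<open>
  A square matrix \<open>M\<close> induces a map from the quotient of \<open>\<real>\<^sup>N\<close> by the kernel of \<open>M\<close>
  (Euclidean quotient norm, elements being cosets of the kernel) to the orthogonal complement
  of the kernel (Euclidean norm); for symmetric \<open>M\<close> this is a bijection.
\<close>

definition euclid_norm :: "real Matrix.vec \<Rightarrow> real" where
  "euclid_norm v = sqrt (scalar_prod v v)"

definition ker_coset :: "real mat \<Rightarrow> real Matrix.vec \<Rightarrow> real Matrix.vec set" where
  "ker_coset M V = {V + Z | Z. Z \<in> mat_kernel M}"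

definition ker_quotient :: "real mat \<Rightarrow> real Matrix.vec set set" where
  "ker_quotient M = ker_coset M ` carrier_vec (dim_col M)"

definition quotient_norm :: "real Matrix.vec set \<Rightarrow> real" where
  "quotient_norm X = (INF V\<in>X. euclid_norm V)"

definition ker_perp :: "real mat \<Rightarrow> real Matrix.vec set" where
  "ker_perp M = {W \<in> carrier_vec (dim_col M). \<forall>Z\<in>mat_kernel M. scalar_prod W Z = 0}"

definition quotient_map :: "real mat \<Rightarrow> real Matrix.vec set \<Rightarrow> real Matrix.vec" where
  "quotient_map M X = the_elem ((\<lambda>V. M *\<^sub>v V) ` X)"

definition op_norm :: "real mat \<Rightarrow> real" where
  "op_norm M =
     (SUP X \<in> ker_quotient M - {mat_kernel M}. euclid_norm (quotient_map M X) / quotient_norm X)"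

definition inv_op_norm :: "real mat \<Rightarrow> real" where
  "inv_op_norm M =
     (SUP W \<in> ker_perp M - {0\<^sub>v (dim_col M)}.
        quotient_norm (inv_into (ker_quotient M) (quotient_map M) W) / euclid_norm W)"

definition condition_number :: "real mat \<Rightarrow> real" where
  "condition_number M = op_norm M * inv_op_norm M"

end

theory Submission
  imports Defs
begin

text \<open>
  On a quasi-uniform mesh the mass matrix is spectrally equivalent to \<open>h\<^sup>k\<close> times the identity. If \<open>v\<close> has
  coefficients \<open>V\<close>, then \<open>A\<^sub>h(v, v) = A\<^sub>h(v\<^sub>0, v\<^sub>0)\<close> for \<open>v\<^sub>0 = v - \<lambda>(v)\<close>; hence the inverse estimate bounds the
  largest eigenvalue of the stiffness matrix by \<open>h\<close> to the power \<open>k - 2 - c\<close>, provided that \<open>V \<mapsto> V - \<lambda>(v)\<close> is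
  bounded in the Euclidean norm, and the Poincare estimate bounds the smallest nonzero eigenvalue from
  below by \<open>h\<close> to the power \<open>k - c\<close>.

  Boundedness of \<open>V \<mapsto> V - \<lambda>(v)\<close> means \<open>N \<Sum>\<^sub>i \<lambda>(\<phi>\<^sub>i)\<^sup>2 \<lesssim> 1\<close>, and it follows from the fact that the discrete
  manifold has area comparable to \<open>r\<^sup>d\<close> in each ball of radius \<open>r \<sim> h\<close> around one of its points, with
  constants that do not depend on \<open>\<Gamma>\<close>. To see the latter, follow the closest point projection by the
  orthogonal projection onto a tangent space. The derivative of the closest point projection at a point of
  \<open>\<Gamma>\<close> is the identity on the tangent space, and each simplex is nearly parallel to the tangent space; so
  for small \<open>h\<close> this map is bi-Lipschitz with constant 2 on each simplex, injective across simplices, and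
  its image contains a ball.
\<close>

text \<open>The assumed estimates speak only about functions of mean zero, while the matrix acts on
  all vectors; so the mean has to be removed with control in the Euclidean norm. The vector of ones
  has squared length \<open>N\<close>, whence the factor \<open>N\<close> in front of the sum of
  squared coefficients of the mean. \<open>N\<close> itself is never estimated: counting the surface
  by balls around the nodes bounds the total area below by a multiple of \<open>N\<close> times the
  area seen in one ball, and \<open>N\<close> cancels. Surface simplices may be arbitrarily thin, so
  no area bound is available simplex by simplex; only areas in balls of radius of order
  \<open>h\<close> are compared. The final constant has to be fixed before \<open>\<Gamma>\<close>.
  Hence whatever depends on \<open>\<Gamma>\<close>, such as the size of the derivative of the
  projection, may enter only through the smallness of \<open>h\<close>, and the charts carry
  absolute Lipschitz constants. Volumes are compared by covering with cubes, so that Lipschitz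
  bounds on compact pieces suffice and no Jacobian appears.\<close>

hide_const (open) VectorSpace.subspace Matrix.orthogonal

section \<open>Lebesgue measure and Lipschitz maps\<close>

text \<open>Volume of a ball whose radius is the diagonal of the unit cube: the price of replacing
  the Lipschitz image of a cube by a ball around the image of one of its points.\<close>

definition lip_const :: "'d::euclidean_space itself \<Rightarrow> real" where
  "lip_const TYPE('d) = unit_ball_vol DIM('d) * sqrt DIM('d) ^ DIM('d)"

lemma lip_const_pos: "0 < lip_const TYPE('d::euclidean_space)"
  by (simp add: lip_const_def)

lemma norm_cube_diagonal:
  fixes u v :: "'d::euclidean_space"
  assumes "\<And>i. i \<in> Basis \<Longrightarrow> inner v i - inner u i = s" "0 \<le> s"
  shows "norm (v - u) = sqrt DIM('d) * s"
proof -
  have "inner (v-u) (v-u) = (\<Sum>i\<in>(Basis::'d set). s * s)"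
    using assms by (subst euclidean_inner) (intro sum.cong, auto simp: inner_diff_left)
  then show ?thesis
    using assms(2) by (simp add: norm_eq_sqrt_inner real_sqrt_mult)
qed

lemma measure_cball_cube:
  fixes u v c :: "'d::euclidean_space"
  assumes "\<And>i. i \<in> Basis \<Longrightarrow> inner v i - inner u i = s" "0 \<le> s" "0 \<le> L"
  shows "measure lebesgue (cball c (L * norm (v - u))) = lip_const TYPE('d) * L ^ DIM('d) * measure lebesgue (cbox u v)"
proof -
  have 1: "norm (v - u) = sqrt DIM('d) * s"
    using assms norm_cube_diagonal by blast
  have le: "\<And>i. i \<in> Basis \<Longrightarrow> inner u i \<le> inner v i" using assms by (metis diff_ge_0_iff_ge)
  have "measure lebesgue (cbox u v) = (\<Prod>i\<in>Basis. inner (v-u) i)"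
    using le by (auto simp: content_cbox_if box_eq_empty inner_diff_left) (metis linorder_not_less)
  also have "\<dots> = s ^ DIM('d)"
    using assms(1) by (simp add: inner_diff_left)
  finally have 2: "measure lebesgue (cbox u v) = s ^ DIM('d)" .
  have "measure lebesgue (cball c (L * norm (v - u))) = unit_ball_vol DIM('d) * (L * norm (v - u)) ^ DIM('d)"
    using assms by (simp add: content_cball)
  then show ?thesis
    by (simp add: 1 2 lip_const_def power_mult_distrib)
qed

text \<open>Cover \<open>S\<close> by nonoverlapping dyadic cubes of little excess measure. Each
  cube contains a point of \<open>S\<close>, and the image of its part of \<open>S\<close> lies in
  the ball around the image of that point. The map is controlled on \<open>S\<close> only, so the
  bound also applies to inverses of charts.\<close>

proposition measure_lipschitz_image_le:
  fixes f :: "'d::euclidean_space \<Rightarrow> 'd"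
  assumes S: "S \<in> lmeasurable" "bounded S" and fS: "f ` S \<in> lmeasurable"
    and L: "0 \<le> L" and lip: "\<And>x y. x \<in> S \<Longrightarrow> y \<in> S \<Longrightarrow> norm (f x - f y) \<le> L * norm (x - y)"
  shows "measure lebesgue (f ` S) \<le> lip_const TYPE('d) * L ^ DIM('d) * measure lebesgue S"
proof (rule field_le_epsilon)
  let ?B = "lip_const TYPE('d) * L ^ DIM('d)"
  fix e :: real assume "e > 0"
  have B0: "0 \<le> ?B" using lip_const_pos[where 'd='d] L by simp
  \<comment> \<open>The excess stays below \<open>e\<close> after multiplication by
    \<open>?B\<close>; the summand 1 covers the case that \<open>?B\<close> is 0.\<close>
  obtain U where U: "open U" "S \<subseteq> U" "U \<in> lmeasurable" "measure lebesgue U < measure lebesgue S + e / (?B + 1)"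
  proof -
    have "0 < e / (?B + 1)" using \<open>e>0\<close> B0 by simp
    then obtain T where T: "open T" "S \<subseteq> T" "T - S \<in> lmeasurable" "emeasure lebesgue (T - S) < ennreal (e / (?B + 1))"
      using sets_lebesgue_outer_open[of S "e / (?B + 1)"] S(1) by (metis fmeasurableD)
    have TS: "T = S \<union> (T - S)" using T by auto
    have Tm: "T \<in> lmeasurable" using S(1) T(3) TS by (metis fmeasurable.Un)
    have "measure lebesgue (T - S) < e / (?B + 1)"
      using T(3,4) \<open>0 < e / (?B + 1)\<close> by (simp add: emeasure_eq_measure2 ennreal_less_iff)
    moreover have "measure lebesgue T \<le> measure lebesgue S + measure lebesgue (T - S)"
      using TS S(1) T(3) by (metis fmeasurableD measure_Un_le)
    ultimately show thesis using that[OF T(1,2) Tm] by linarith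
  qed
  obtain r where r: "r > 0" "S \<subseteq> cbox (- (r *\<^sub>R One)) (r *\<^sub>R One)"
  proof -
    obtain a where "S \<subseteq> cbox (-a) a" using S(2) bounded_subset_cbox_symmetric by blast
    obtain b where b: "b > 0" "\<forall>x\<in>S. norm x \<le> b" using S(2) bounded_pos by blast
    have "S \<subseteq> cbox (- (b *\<^sub>R One)) (b *\<^sub>R One)"
    proof
      fix x assume "x \<in> S"
      then have "\<bar>inner x i\<bar> \<le> b" if "i \<in> Basis" for i
        using b Basis_le_norm[OF that, of x] by force
      then show "x \<in> cbox (- (b *\<^sub>R One)) (b *\<^sub>R One)"
        by (auto simp: mem_box abs_le_iff) (smt (verit, best))
    qed
    then show thesis using that b by blast
  qed
  have bx: "box (- (r *\<^sub>R One)) (r *\<^sub>R One :: 'd) \<noteq> {}"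
    using r by (simp add: box_ne_empty)
  \<comment> \<open>This gauge forces the cubes of \<open>covering_lemma\<close> to stay inside
    \<open>U\<close>.\<close>
  have "\<exists>g. gauge g \<and> (\<forall>x\<in>S. g x \<subseteq> U)"
  proof -
    have "gauge (\<lambda>x. if x \<in> U then U else UNIV)" using U(1) by (auto simp: gauge_def)
    then show ?thesis using U(2) by (intro exI[of _ "\<lambda>x. if x \<in> U then U else UNIV"]) auto
  qed
  then obtain g where g: "gauge g" "\<And>x. x \<in> S \<Longrightarrow> g x \<subseteq> U" by blast
  obtain \<D> where D: "countable \<D>"
    "\<And>K. K \<in> \<D> \<Longrightarrow> interior K \<noteq> {} \<and> (\<exists>c d. K = cbox c d)"
    "pairwise (\<lambda>A B. interior A \<inter> interior B = {}) \<D>"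
    "\<And>K. K \<in> \<D> \<Longrightarrow> \<exists>x \<in> S \<inter> K. K \<subseteq> g x"
    "\<And>u v. cbox u v \<in> \<D> \<Longrightarrow> \<exists>n. \<forall>i \<in> Basis. inner v i - inner u i = (inner (r *\<^sub>R One) i - inner (- (r *\<^sub>R One)) (i::'d)) / 2^n"
    "S \<subseteq> \<Union>\<D>"
    using covering_lemma[OF r(2) bx g(1)] by metis
  have "\<forall>K\<in>\<D>. \<exists>c\<rho>. f ` (S \<inter> K) \<subseteq> cball (fst c\<rho>) (snd c\<rho>) \<and> measure lebesgue (cball (fst c\<rho>) (snd c\<rho>)) = ?B * measure lebesgue K"
  proof
    fix K assume K: "K \<in> \<D>"
    then obtain u v where uv: "K = cbox u v" using D(2) by blast
    obtain n :: nat where n: "\<And>i. i \<in> Basis \<Longrightarrow> inner v i - inner u i = 2 * r / 2^n"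
      using D(5)[of u v] K uv by (auto simp: inner_Basis inner_sum_left)
    obtain x where x: "x \<in> S \<inter> K" using D(4)[OF K] by blast
    have "f ` (S \<inter> K) \<subseteq> cball (f x) (L * norm (v - u))"
    proof clarify
      fix y assume y: "y \<in> S" "y \<in> K"
      have "norm (x - y) \<le> norm (v - u)"
      proof (rule norm_le_componentwise)
        fix b :: 'd assume b: "b \<in> Basis"
        then show "\<bar>inner (x - y) b\<bar> \<le> \<bar>inner (v - u) b\<bar>"
          using x y b unfolding uv by (auto simp: mem_box inner_diff_left dest!: bspec[OF _ b])
      qed
      then show "f y \<in> cball (f x) (L * norm (v - u))"
        using lip[of x y] x y L by (auto simp: dist_norm intro: order_trans mult_left_mono)
    qed
    moreover have "measure lebesgue (cball (f x) (L * norm (v - u))) = ?B * measure lebesgue K"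
      unfolding uv using n r L by (intro measure_cball_cube[of v u "2 * r / 2 ^ n"]) auto
    ultimately show "\<exists>c\<rho>. f ` (S \<inter> K) \<subseteq> cball (fst c\<rho>) (snd c\<rho>) \<and> measure lebesgue (cball (fst c\<rho>) (snd c\<rho>)) = ?B * measure lebesgue K"
      by (intro exI[of _ "(f x, L * norm (v - u))"]) auto
  qed
  then obtain c\<rho> where c\<rho>: "\<And>K. K \<in> \<D> \<Longrightarrow> f ` (S \<inter> K) \<subseteq> cball (fst (c\<rho> K)) (snd (c\<rho> K))"
      "\<And>K. K \<in> \<D> \<Longrightarrow> measure lebesgue (cball (fst (c\<rho> K)) (snd (c\<rho> K))) = ?B * measure lebesgue K"
    by (metis (no_types))
  define Q where "Q K = cball (fst (c\<rho> K)) (snd (c\<rho> K))" for K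
  \<comment> \<open>The balls of finite subfamilies are bounded uniformly; measurability and the
    bound then pass to the countable union.\<close>
  have fin: "measure lebesgue (\<Union>K\<in>\<F>. Q K) \<le> ?B * measure lebesgue U" if F: "\<F> \<subseteq> \<D>" "finite \<F>" for \<F>
  proof -
    have lmK: "K \<in> lmeasurable" if "K \<in> \<F>" for K using D(2) F that by (metis lmeasurable_cbox subset_iff)
    have "measure lebesgue (\<Union>K\<in>\<F>. Q K) \<le> (\<Sum>K\<in>\<F>. measure lebesgue (Q K))"
      using F by (intro measure_UNION_le) (auto simp: Q_def)
    also have "\<dots> = ?B * (\<Sum>K\<in>\<F>. measure lebesgue K)"
      using F c\<rho>(2) by (auto simp: Q_def sum_distrib_left intro!: sum.cong)
    also have "(\<Sum>K\<in>\<F>. measure lebesgue K) = measure lebesgue (\<Union>\<F>)"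
    proof (rule measure_negligible_finite_Union[symmetric])
      show "pairwise (\<lambda>S T. negligible (S \<inter> T)) \<F>"
      proof (rule pairwiseI)
        fix A B assume AB: "A \<in> \<F>" "B \<in> \<F>" "A \<noteq> B"
        then obtain a b c d where eq: "A = cbox a b" "B = cbox c d" using D(2) F by blast
        have "interior A \<inter> interior B = {}" using D(3) AB F by (auto simp: pairwise_def)
        then have "interior (A \<inter> B) = {}" by simp
        then show "negligible (A \<inter> B)"
          unfolding eq using negligible_convex_interior by (metis convex_Int convex_box(1))
      qed
    qed (use F lmK in auto)
    also have "?B * measure lebesgue (\<Union>\<F>) \<le> ?B * measure lebesgue U"
    proof (rule mult_left_mono[OF _ B0], rule measure_mono_fmeasurable)
      show "\<Union>\<F> \<subseteq> U" using F D(4) g(2) by blast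
      show "\<Union>\<F> \<in> sets lebesgue" using F lmK by (meson fmeasurableD sets.finite_Union subsetI)
    qed (rule U)
    finally show ?thesis .
  qed
  have lm: "(\<Union>K\<in>\<D>. Q K) \<in> lmeasurable" 
    by (rule fmeasurable_UN_bound[OF D(1) _ fin]) (auto simp: Q_def)
  have "f ` S \<subseteq> (\<Union>K\<in>\<D>. Q K)"
    using c\<rho>(1) D(6) unfolding Q_def by fastforce
  then have "measure lebesgue (f ` S) \<le> measure lebesgue (\<Union>K\<in>\<D>. Q K)"
    using lm fS by (intro measure_mono_fmeasurable) (auto simp: fmeasurableD)
  also have "\<dots> \<le> ?B * measure lebesgue U"
    by (rule measure_UN_bound[OF D(1) _ fin]) (auto simp: Q_def)
  also have "\<dots> \<le> ?B * (measure lebesgue S + e / (?B + 1))"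
    using U B0 by (intro mult_left_mono) auto
  also have "\<dots> \<le> ?B * measure lebesgue S + e"
    using B0 \<open>e>0\<close> by (auto simp: field_simps)
  finally show "measure lebesgue (f ` S) \<le> ?B * measure lebesgue S + e" .
qed

section \<open>The closest point projection\<close>

lemma orth_proj_unique_exists:
  fixes S :: "'a::euclidean_space set"
  assumes "subspace S"
  shows "\<exists>!y. y \<in> S \<and> (\<forall>z\<in>S. inner (x - y) z = 0)"
proof -
  obtain y z where yz: "y \<in> Real_Vector_Spaces.span S" "\<And>w. w \<in> Real_Vector_Spaces.span S \<Longrightarrow> orthogonal z w" "x = y + z"
    using orthogonal_subspace_decomp_exists[of S x] by blast
  have 1: "y \<in> S" using yz(1) assms by (metis Real_Vector_Spaces.span_eq_iff)
  have 2: "\<forall>w\<in>S. inner (x - y) w = 0" using yz(2,3) by (auto simp: Linear_Algebra.orthogonal_def Real_Vector_Spaces.span_base)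
  show ?thesis
  proof (rule ex1I[of _ y])
    show "y \<in> S \<and> (\<forall>z\<in>S. inner (x - y) z = 0)" using 1 2 by blast
    fix y' assume y': "y' \<in> S \<and> (\<forall>z\<in>S. inner (x - y') z = 0)"
    have d: "y' - y \<in> S" using y' 1 assms by (simp add: subspace_diff)
    have "inner (y' - y) (y' - y) = inner (x - y) (y' - y) - inner (x - y') (y' - y)"
      by (simp add: inner_diff_left)
    also have "\<dots> = 0" using y' 2 d by simp
    finally show "y' = y" by simp
  qed
qed

lemma
  fixes S :: "'a::euclidean_space set"
  assumes "subspace S"
  shows orth_proj_in: "orth_proj S x \<in> S"
    and orth_proj_orthogonal: "z \<in> S \<Longrightarrow> inner (x - orth_proj S x) z = 0"
  using theI'[OF orth_proj_unique_exists[OF assms, of x]] unfolding orth_proj_def by auto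

lemma orth_proj_eqI:
  fixes S :: "'a::euclidean_space set"
  assumes "subspace S" "y \<in> S" "\<And>z. z \<in> S \<Longrightarrow> inner (x - y) z = 0"
  shows "orth_proj S x = y"
  using orth_proj_unique_exists[OF assms(1), of x] assms orth_proj_in[OF assms(1)] orth_proj_orthogonal[OF assms(1)] by blast

lemma orth_proj_id:
  fixes S :: "'a::euclidean_space set"
  assumes "subspace S" "x \<in> S"
  shows "orth_proj S x = x"
  using assms by (intro orth_proj_eqI) auto

lemma linear_orth_proj:
  fixes S :: "'a::euclidean_space set"
  assumes S: "subspace S"
  shows "linear (orth_proj S)"
proof (rule linearI)
  note io = orth_proj_in[OF S] orth_proj_orthogonal[OF S]
  fix x y :: 'a and r :: real
  have "inner (x + y - (orth_proj S x + orth_proj S y)) z = 0" if "z \<in> S" for z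
    using io(2)[OF that, of x] io(2)[OF that, of y] by (simp add: inner_diff_left inner_add_left)
  then show "orth_proj S (x + y) = orth_proj S x + orth_proj S y"
    using io S by (intro orth_proj_eqI) (auto intro: subspace_add)
  have "inner (r *\<^sub>R x - r *\<^sub>R orth_proj S x) z = 0" if "z \<in> S" for z
    using io(2)[OF that, of x] by (simp add: inner_diff_left)
  then show "orth_proj S (r *\<^sub>R x) = r *\<^sub>R orth_proj S x"
    using io S by (intro orth_proj_eqI) (auto intro: subspace_scale)
qed

text \<open>A nonzero vector of \<open>S\<close> killed by the projection onto \<open>T\<close>
  would be moved by its full length, against \<open>\<theta> < 1\<close>. So the projection onto
  \<open>T\<close> is injective on \<open>S\<close>. This transfers the dimension of the simplices
  to the tangent spaces.\<close>

lemma dim_le_if_orth_proj_close: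
  fixes S T :: "'a::euclidean_space set"
  assumes S: "subspace S" and T: "subspace T" and "\<theta> < 1"
    and close: "\<And>w. norm (orth_proj T w - orth_proj S w) \<le> \<theta> * norm w"
  shows "dim S \<le> dim T"
proof -
  have inj: "inj_on (orth_proj T) S"
  proof (rule inj_onI)
    fix x y assume xy: "x \<in> S" "y \<in> S" "orth_proj T x = orth_proj T y"
    then have "x - y \<in> S" using S by (simp add: subspace_diff)
    then have "orth_proj S (x - y) = x - y" using S by (simp add: orth_proj_id)
    moreover have "orth_proj T (x - y) = 0" using xy(3) linear_orth_proj[OF T] by (simp add: Real_Vector_Spaces.linear_diff)
    ultimately have "norm (0 - (x - y)) \<le> \<theta> * norm (x - y)" using close[of "x - y"] by metis
    then have "norm (x - y) \<le> \<theta> * norm (x - y)" by (simp add: norm_minus_commute)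
    then have "(1 - \<theta>) * norm (x - y) \<le> 0" by (simp add: algebra_simps)
    then show "x = y" using \<open>\<theta> < 1\<close> by (simp add: mult_le_0_iff)
  qed
  have "dim S = dim (orth_proj T ` S)"
    using inj S linear_orth_proj[OF T] by (metis dim_image_eq span_eq_iff)
  also have "\<dots> \<le> dim T"
    using orth_proj_in[OF T] by (intro dim_subset) auto
  finally show ?thesis .
qed

lemma dim_eq_if_orth_proj_close:
  fixes S T :: "'a::euclidean_space set"
  assumes "subspace S" "subspace T" "\<theta> < 1"
    and "\<And>w. norm (orth_proj T w - orth_proj S w) \<le> \<theta> * norm w"
  shows "dim S = dim T"
  using dim_le_if_orth_proj_close[of S T \<theta>] dim_le_if_orth_proj_close[of T S \<theta>] assms
  by (metis norm_minus_commute order_antisym)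

lemma infdist_closest_point:
  fixes \<Gamma> :: "'a::euclidean_space set"
  assumes "closed \<Gamma>" "\<Gamma> \<noteq> {}"
  shows "infdist x \<Gamma> = dist x (closest_point \<Gamma> x)"
proof (rule antisym)
  show "infdist x \<Gamma> \<le> dist x (closest_point \<Gamma> x)"
    using assms by (simp add: closest_point_in_set infdist_le)
  obtain y where "y \<in> \<Gamma>" "infdist x \<Gamma> = dist x y" using infdist_attains_inf[OF assms] by blast
  then show "dist x (closest_point \<Gamma> x) \<le> infdist x \<Gamma>"
    using assms by (simp add: closest_point_le)
qed

section \<open>Derivative of the closest point projection and the tangent spaces\<close>

context
  fixes \<Gamma> :: "'a::euclidean_space set" and \<delta> :: real
  assumes \<Gamma>: "compact \<Gamma>" "\<Gamma> \<noteq> {}" and spt: "smooth_projection_tube \<Gamma> \<delta>"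
begin

private abbreviation "p \<equiv> closest_point \<Gamma>"
private abbreviation "D q \<equiv> frechet_derivative (closest_point \<Gamma>) (at q)"

lemma manifold_subset_tube: "\<Gamma> \<subseteq> tube \<Gamma> \<delta>"
  using spt by (auto simp: tube_def smooth_projection_tube_def)

lemma closest_point_has_derivative:
  assumes "x \<in> tube \<Gamma> \<delta>"
  shows "(p has_derivative D x) (at x)"
proof -
  have "C_diff_on 1 (tube \<Gamma> \<delta>) p"
    using spt unfolding smooth_projection_tube_def smooth_on_def by blast
  then show ?thesis using assms by (auto simp: frechet_derivative_works)
qed

lemma linear_closest_point_derivative:
  assumes "x \<in> tube \<Gamma> \<delta>"
  shows "linear (D x)"
  using closest_point_has_derivative[OF assms] has_derivative_linear by blast

lemma continuous_closest_point_derivative: "continuous_on (tube \<Gamma> \<delta>) (\<lambda>x. D x v)"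
proof -
  have "C_diff_on 1 (tube \<Gamma> \<delta>) p"
    using spt unfolding smooth_projection_tube_def smooth_on_def by blast
  then show ?thesis by auto
qed

text \<open>\<open>C_diff_on\<close> gives continuity of the derivative one direction at a time;
  this bound turns finitely many directions into control of the operator.\<close>

lemma norm_linear_le_sum_Basis:
  fixes f :: "'a \<Rightarrow> 'b::real_normed_vector"
  assumes "linear f"
  shows "norm (f w) \<le> (\<Sum>b\<in>Basis. norm (f b)) * norm w"
proof -
  have "f w = f (\<Sum>b\<in>Basis. inner w b *\<^sub>R b)" by (simp add: euclidean_representation)
  also have "\<dots> = (\<Sum>b\<in>Basis. inner w b *\<^sub>R f b)"
    using assms by (simp add: Real_Vector_Spaces.linear_sum Real_Vector_Spaces.linear_scale)
  finally have "norm (f w) \<le> (\<Sum>b\<in>Basis. norm (inner w b *\<^sub>R f b))" by (metis norm_sum)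
  also have "\<dots> \<le> (\<Sum>b\<in>Basis. norm (f b) * norm w)"
  proof (rule sum_mono)
    fix b :: 'a assume "b \<in> Basis"
    then show "norm (inner w b *\<^sub>R f b) \<le> norm (f b) * norm w"
      using mult_right_mono[OF Basis_le_norm[of b w] norm_ge_zero[of "f b"]] by (simp add: mult.commute)
  qed
  finally show ?thesis by (simp add: sum_distrib_right)
qed

text \<open>Compactness of \<open>\<Gamma>\<close>. The bound \<open>M\<close> depends on
  \<open>\<Gamma>\<close> and may therefore be used only to restrict \<open>h\<close>.\<close>

lemma closest_point_derivative_bounded:
  obtains M where "0 < M" "\<And>q w. q \<in> \<Gamma> \<Longrightarrow> norm (D q w) \<le> M * norm w"
proof -
  have "\<exists>B>0. \<forall>q\<in>\<Gamma>. norm (D q b) \<le> B" for b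
  proof -
    have "compact ((\<lambda>x. D x b) ` \<Gamma>)"
      by (intro compact_continuous_image[OF continuous_on_subset[OF continuous_closest_point_derivative manifold_subset_tube]] \<Gamma>)
    then have "bounded ((\<lambda>x. D x b) ` \<Gamma>)" by (rule compact_imp_bounded)
    then show ?thesis unfolding bounded_pos by auto
  qed
  then obtain B where B: "\<And>b. B b > 0" "\<And>b q. q \<in> \<Gamma> \<Longrightarrow> norm (D q b) \<le> B b" by metis
  show thesis
  proof (rule that[of "\<Sum>b\<in>Basis. B b"])
    show "0 < (\<Sum>b\<in>Basis. B b)" using B by (intro sum_pos) auto
    fix q w assume q: "q \<in> \<Gamma>"
    have "norm (D q w) \<le> (\<Sum>b\<in>Basis. norm (D q b)) * norm w"
      using q manifold_subset_tube linear_closest_point_derivative by (intro norm_linear_le_sum_Basis) auto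
    also have "\<dots> \<le> (\<Sum>b\<in>Basis. B b) * norm w"
      using B(2)[OF q] by (intro mult_right_mono sum_mono) auto
    finally show "norm (D q w) \<le> (\<Sum>b\<in>Basis. B b) * norm w" .
  qed
qed

text \<open>Mean value inequality for the projection minus its linearization at \<open>q\<close>.
  Uniform continuity of the derivative on a compact tube makes \<open>\<eta>\<close> independent of
  \<open>q\<close>.\<close>

lemma closest_point_uniformly_linear:
  assumes "0 < \<epsilon>"
  obtains \<eta> where "0 < \<eta>" 
    "\<And>q x y. q \<in> \<Gamma> \<Longrightarrow> x \<in> ball q \<eta> \<Longrightarrow> y \<in> ball q \<eta> \<Longrightarrow>
        norm (p x - p y - D q (x - y)) \<le> \<epsilon> * norm (x - y)"
proof -
  have \<delta>: "\<delta> > 0" using spt by (simp add: smooth_projection_tube_def)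
  \<comment> \<open>The closed half tube is compact and still lies in the open tube where the
    projection is smooth.\<close>
  define Q where "Q = {x. infdist x \<Gamma> \<le> \<delta> / 2}"
  have cQ: "compact Q" unfolding Q_def using \<Gamma> \<delta> by (intro compact_infdist_le) auto
  have Qt: "Q \<subseteq> tube \<Gamma> \<delta>" using \<delta> by (auto simp: Q_def tube_def)
  \<comment> \<open>The operator norm is estimated by a sum over the basis vectors, so each of them
    gets an equal share of \<open>\<epsilon>\<close>.\<close>
  define e where "e = \<epsilon> / DIM('a)"
  have e: "e > 0" using assms by (simp add: e_def)
  have "\<exists>d>0. \<forall>x\<in>Q. \<forall>y\<in>Q. dist y x < d \<longrightarrow> dist (D y b) (D x b) < e" for b
    using compact_uniformly_continuous[OF continuous_on_subset[OF continuous_closest_point_derivative Qt] cQ, of b] e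
    unfolding uniformly_continuous_on_def by blast
  then obtain d where d: "\<And>b. d b > 0" "\<And>b x y. x \<in> Q \<Longrightarrow> y \<in> Q \<Longrightarrow> dist y x < d b \<Longrightarrow> dist (D y b) (D x b) < e"
    by metis
  define \<eta> where "\<eta> = min (\<delta> / 2) (Min (d ` Basis))"
  have \<eta>: "\<eta> > 0" "\<eta> \<le> \<delta> / 2" "\<And>b. b \<in> Basis \<Longrightarrow> \<eta> \<le> d b"
    using \<delta> d(1) by (auto simp: \<eta>_def min_le_iff_disj)
  show thesis
  proof (rule that[OF \<eta>(1)])
    fix q x y assume q: "q \<in> \<Gamma>" and xy: "x \<in> ball q \<eta>" "y \<in> ball q \<eta>"
    have qQ: "q \<in> Q" using q \<delta> by (simp add: Q_def)
    have bQ: "z \<in> Q" if "z \<in> ball q \<eta>" for z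
      using infdist_le[OF q, of z] that \<eta>(2) by (auto simp: Q_def dist_commute)
    have lq: "linear (D q)" using linear_closest_point_derivative qQ Qt by blast
    define g where "g z = p z - D q z" for z
    have "norm (g x - g y) \<le> \<epsilon> * norm (x - y)"
    proof (rule differentiable_bound[OF convex_ball[of q \<eta>]])
      fix z assume z: "z \<in> ball q \<eta>"
      have zt: "z \<in> tube \<Gamma> \<delta>" using bQ[OF z] Qt by blast
      show "(g has_derivative (\<lambda>w. D z w - D q w)) (at z within ball q \<eta>)"
        unfolding g_def
        by (intro has_derivative_diff has_derivative_at_withinI[OF closest_point_has_derivative[OF zt]]
             linear_imp_has_derivative lq)
      have ld: "linear (\<lambda>w. D z w - D q w)"
        using linear_closest_point_derivative[OF zt] lq by (rule Real_Vector_Spaces.linear_compose_sub)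
      show "onorm (\<lambda>w. D z w - D q w) \<le> \<epsilon>"
      proof (rule onorm_le)
        fix w
        have "norm (D z w - D q w) \<le> (\<Sum>b\<in>Basis. norm (D z b - D q b)) * norm w"
          using norm_linear_le_sum_Basis[OF ld, of w] by simp
        also have "\<dots> \<le> (\<Sum>b\<in>(Basis::'a set). e) * norm w"
        proof (intro mult_right_mono sum_mono)
          fix b :: 'a assume b: "b \<in> Basis"
          show "norm (D z b - D q b) \<le> e"
            using d(2)[OF qQ bQ[OF z], of b] z \<eta>(3)[OF b] by (auto simp: dist_norm norm_minus_commute)
        qed auto
        finally show "norm (D z w - D q w) \<le> \<epsilon> * norm w" by (simp add: e_def)
      qed
    qed (use xy in auto)
    then show "norm (p x - p y - D q (x - y)) \<le> \<epsilon> * norm (x - y)"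
      by (simp add: g_def Real_Vector_Spaces.linear_diff[OF lq] algebra_simps)
  qed
qed

text \<open>The projection fixes every curve in \<open>\<Gamma>\<close>; differentiate this identity
  at time 0.\<close>

lemma closest_point_derivative_tangent:
  assumes q: "q \<in> \<Gamma>" and v: "v \<in> tangent_space \<Gamma> q"
  shows "D q v = v"
proof -
  obtain \<gamma> \<epsilon> where g: "0 < \<epsilon>" "\<gamma> ` {-\<epsilon><..<\<epsilon>} \<subseteq> \<Gamma>" "\<gamma> 0 = q" "(\<gamma> has_vector_derivative v) (at (0::real))"
    using v unfolding tangent_space_def by blast
  have "(p has_derivative D q) (at (\<gamma> 0))"
    using closest_point_has_derivative q manifold_subset_tube g(3) by auto
  then have "((\<lambda>t. p (\<gamma> t)) has_derivative (\<lambda>t. D q (t *\<^sub>R v))) (at 0)"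
    using has_derivative_compose[of \<gamma> "\<lambda>t. t *\<^sub>R v" 0 UNIV p "D q"] g(4) unfolding has_vector_derivative_def by simp
  then have "(\<gamma> has_derivative (\<lambda>t. D q (t *\<^sub>R v))) (at 0)"
  proof (rule has_derivative_transform_within_open)
    show "open {-\<epsilon><..<\<epsilon>}" "0 \<in> {-\<epsilon><..<\<epsilon>}" using g(1) by auto
    show "p (\<gamma> t) = \<gamma> t" if "t \<in> {-\<epsilon><..<\<epsilon>}" for t
      using that g(2) by (intro closest_point_self) auto
  qed
  then have "(\<lambda>t. D q (t *\<^sub>R v)) = (\<lambda>t. t *\<^sub>R v)"
    using g(4) has_derivative_unique unfolding has_vector_derivative_def by blast
  then have "D q (1 *\<^sub>R v) = 1 *\<^sub>R v" by meson
  then show ?thesis by simp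
qed

text \<open>The projection of the straight line through \<open>q\<close> in direction
  \<open>u\<close> is a curve in \<open>\<Gamma>\<close> with this velocity. It lies in
  \<open>\<Gamma>\<close> for all times, so the time interval of half-length 1 is an arbitrary
  choice.\<close>

lemma closest_point_derivative_in_tangent:
  assumes q: "q \<in> \<Gamma>"
  shows "D q u \<in> tangent_space \<Gamma> q"
proof -
  have "(p has_derivative D q) (at (q + 0 *\<^sub>R u))"
    using closest_point_has_derivative q manifold_subset_tube by auto
  moreover have "((\<lambda>t. q + t *\<^sub>R u) has_derivative (\<lambda>t. t *\<^sub>R u)) (at 0)"
    by (auto intro!: derivative_eq_intros)
  ultimately have "((\<lambda>t. p (q + t *\<^sub>R u)) has_derivative (\<lambda>t. D q (t *\<^sub>R u))) (at 0)"
    using has_derivative_compose[of "\<lambda>t. q + t *\<^sub>R u" "\<lambda>t. t *\<^sub>R u" 0 UNIV p "D q"] by simp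
  moreover have "D q (t *\<^sub>R u) = t *\<^sub>R D q u" for t
    using linear_closest_point_derivative q manifold_subset_tube Real_Vector_Spaces.linear_scale by blast
  ultimately have "((\<lambda>t. p (q + t *\<^sub>R u)) has_vector_derivative D q u) (at 0)"
    by (simp add: has_vector_derivative_def)
  moreover have "(\<lambda>t. p (q + t *\<^sub>R u)) ` {-1<..<1} \<subseteq> \<Gamma>"
    using \<Gamma> by (auto intro!: closest_point_in_set compact_imp_closed)
  moreover have "p (q + 0 *\<^sub>R u) = q" using q by (simp add: closest_point_self)
  ultimately show ?thesis unfolding tangent_space_def
    by (intro CollectI exI[of _ "\<lambda>t. p (q + t *\<^sub>R u)"] exI[of _ 1]) auto
qed

text \<open>Sets of velocities are not evidently closed under addition; the description as the range
  of a linear map makes the tangent space a subspace.\<close>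

lemma tangent_space_eq_range:
  assumes q: "q \<in> \<Gamma>"
  shows "tangent_space \<Gamma> q = range (D q)"
  using closest_point_derivative_in_tangent[OF q] closest_point_derivative_tangent[OF q] by (metis (no_types) rangeI subsetI subset_antisym image_subsetI)

lemma subspace_tangent_space:
  assumes q: "q \<in> \<Gamma>"
  shows "subspace (tangent_space \<Gamma> q)"
  unfolding tangent_space_eq_range[OF q]
  using linear_closest_point_derivative q manifold_subset_tube by (intro linear_subspace_image) auto

end

section \<open>Local charts of the discrete manifold\<close>

lemma direction_space_eq_span:
  assumes "a \<in> K"
  shows "direction_space K = Real_Vector_Spaces.span ((\<lambda>x. - a + x) ` K)"
  unfolding direction_space_def
proof (rule Real_Vector_Spaces.span_eq[THEN iffD2], intro conjI subsetI)
  fix z assume "z \<in> {x - y |x y. x \<in> K \<and> y \<in> K}"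
  then obtain x y where "x \<in> K" "y \<in> K" "z = (- a + x) - (- a + y)" by force
  then show "z \<in> Real_Vector_Spaces.span ((\<lambda>x. - a + x) ` K)"
    by (metis Real_Vector_Spaces.span_diff Real_Vector_Spaces.span_base imageI)
next
  fix z assume "z \<in> (\<lambda>x. - a + x) ` K"
  then have "z \<in> {x - y |x y. x \<in> K \<and> y \<in> K}" using assms by force
  then show "z \<in> Real_Vector_Spaces.span {x - y |x y. x \<in> K \<and> y \<in> K}" by (rule Real_Vector_Spaces.span_base)
qed

lemma subspace_direction_space: "subspace (direction_space K)"
  unfolding direction_space_def by simp

lemma simplex_nonempty: "n simplex K \<Longrightarrow> 0 \<le> n \<Longrightarrow> K \<noteq> {}"
  by (auto simp: simplex_def)

lemma dim_direction_space:
  fixes K :: "'a::euclidean_space set"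
  assumes "int d simplex K"
  shows "dim (direction_space K) = d"
proof -
  obtain a where a: "a \<in> K" using simplex_nonempty[OF assms] by auto
  have "aff_dim K = int d" using assms by (simp add: aff_dim_simplex)
  moreover have "aff_dim K = int (dim ((\<lambda>x. - a + x) ` K))"
    using a by (intro aff_dim_eq_dim) (simp add: hull_inc)
  ultimately show ?thesis by (simp add: direction_space_eq_span[OF a])
qed

lemma direction_spaceI: "x \<in> K \<Longrightarrow> y \<in> K \<Longrightarrow> x - y \<in> direction_space K"
  unfolding direction_space_def by (intro Real_Vector_Spaces.span_base) blast

text \<open>For an isometric embedding \<open>L\<close>, the adjoint is the orthogonal projection
  onto the range of \<open>L\<close>, read in the coordinates of \<open>'d\<close>.\<close>

lemma
  fixes L :: "'d::euclidean_space \<Rightarrow> 'a::euclidean_space"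
  assumes L: "linear L" "\<And>x. norm (L x) = norm x"
  shows adjoint_isometry_left_inverse: "adjoint L (L w) = w"
    and norm_adjoint_isometry_le: "norm (adjoint L v) \<le> norm v"
proof -
  have "inner (L x) (L y) = inner x y" for x y
    using L by (simp add: dot_norm flip: Real_Vector_Spaces.linear_add)
  then have "inner x (adjoint L (L w)) = inner x w" for x
    using adjoint_works[OF L(1)] by simp
  then show "adjoint L (L w) = w" by (metis vector_eq_ldot)
  have "norm (adjoint L v) * norm (adjoint L v) = inner (L (adjoint L v)) v"
    using adjoint_works[OF L(1), of "adjoint L v" v] by (simp flip: power2_norm_eq_inner power2_eq_square)
  also have "\<dots> \<le> norm (adjoint L v) * norm v"
    using norm_cauchy_schwarz[of "L (adjoint L v)" v] L(2) by simp
  finally show "norm (adjoint L v) \<le> norm v"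
    by (metis mult_le_cancel_left_pos norm_ge_zero order_le_less)
qed

text \<open>\<open>f x\<close> is the coordinate vector of the tangential part of the closest point
  of \<open>x\<close> minus \<open>q\<close>, where \<open>q\<close> is the closest point of
  \<open>x\<^sub>0\<close>. Different simplices are linked only through the bijectivity of the
  closest point projection, hence injectivity globally but Lipschitz bounds simplex by simplex.
  Centring at \<open>q\<close> instead of \<open>x\<^sub>0\<close> costs
  \<open>2 * C\<^sub>\<rho> * h\<^sup>2\<close>.\<close>

proposition discrete_manifold_local_chart:
  fixes \<Gamma> :: "'a::euclidean_space set"
  assumes \<Gamma>: "compact \<Gamma>" "\<Gamma> \<noteq> {}" and spt: "smooth_projection_tube \<Gamma> \<delta>"
    and C: "0 < C\<^sub>\<rho>" "0 < C\<^sub>P"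
  obtains h\<^sub>0 R\<^sub>0 where "0 < h\<^sub>0" "0 < R\<^sub>0"
    "\<And>h \<K> x\<^sub>0. 0 < h \<Longrightarrow> h \<le> h\<^sub>0 \<Longrightarrow> discrete_manifold TYPE('d::euclidean_space) \<Gamma> \<delta> C\<^sub>\<rho> C\<^sub>P h \<K> \<Longrightarrow> x\<^sub>0 \<in> \<Union>\<K> \<Longrightarrow>
      \<exists>f :: 'a \<Rightarrow> 'd.
        (\<forall>K\<in>\<K>. \<forall>x\<in>K \<inter> cball x\<^sub>0 R\<^sub>0. \<forall>y\<in>K \<inter> cball x\<^sub>0 R\<^sub>0.
           norm (x - y) \<le> 2 * norm (f x - f y) \<and> norm (f x - f y) \<le> 2 * norm (x - y)) \<and>
        inj_on f (\<Union>\<K> \<inter> cball x\<^sub>0 R\<^sub>0) \<and>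
        (\<forall>x\<in>\<Union>\<K> \<inter> cball x\<^sub>0 R\<^sub>0. norm (f x) \<le> norm (x - x\<^sub>0) + 2 * C\<^sub>\<rho> * h\<^sup>2) \<and>
        (\<forall>r. 4 * C\<^sub>\<rho> * h\<^sup>2 \<le> r \<and> r \<le> R\<^sub>0 \<longrightarrow> cball 0 (r / 8) \<subseteq> f ` (\<Union>\<K> \<inter> cball x\<^sub>0 r))"
proof -
  let ?p = "closest_point \<Gamma>"
  let ?D = "\<lambda>q. frechet_derivative (closest_point \<Gamma>) (at q)"
  have cl: "closed \<Gamma>" using \<Gamma>(1) by (rule compact_imp_closed)
  have pin: "?p x \<in> \<Gamma>" for x using cl \<Gamma>(2) by (simp add: closest_point_in_set)
  obtain M where M: "0 < M" "\<And>q w. q \<in> \<Gamma> \<Longrightarrow> norm (?D q w) \<le> M * norm w"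
    using closest_point_derivative_bounded[OF \<Gamma> spt] by blast
  have e8: "(0::real) < 1/8" by simp
  obtain \<eta> where \<eta>: "0 < \<eta>" and lin: "\<And>q x y. q \<in> \<Gamma> \<Longrightarrow> x \<in> ball q \<eta> \<Longrightarrow> y \<in> ball q \<eta> \<Longrightarrow>
        norm (?p x - ?p y - ?D q (x - y)) \<le> 1/8 * norm (x - y)"
    using closest_point_uniformly_linear[OF \<Gamma> spt e8] by blast
  have lD: "linear (?D q)" if "q \<in> \<Gamma>" for q
    using linear_closest_point_derivative[OF \<Gamma> spt] manifold_subset_tube[OF \<Gamma> spt] that by blast
  \<comment> \<open>The bound 1 replaces \<open>h\<^sup>2\<close> by \<open>h\<close>; the second
    term makes the tilt of the simplices, amplified by \<open>M + 1\<close>, at most 1/8; the third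
    makes the distance to \<open>\<Gamma>\<close> at most \<open>\<eta> / 8\<close>.\<close>
  define h\<^sub>0 where "h\<^sub>0 = min 1 (min (1 / (8 * (M + 1) * C\<^sub>P)) (\<eta> / (8 * C\<^sub>\<rho>)))"
  show thesis
  proof (rule that[of h\<^sub>0 "\<eta> / 8"])
    show "0 < h\<^sub>0" using C M \<eta> by (simp add: h\<^sub>0_def)
    show "0 < \<eta> / 8" using \<eta> by simp
    fix h \<K> x\<^sub>0
    assume h: "0 < h" "h \<le> h\<^sub>0" and dm: "discrete_manifold TYPE('d) \<Gamma> \<delta> C\<^sub>\<rho> C\<^sub>P h \<K>" and x0: "x\<^sub>0 \<in> \<Union>\<K>"
    have "h \<le> 1 / (8 * (M + 1) * C\<^sub>P)" "h \<le> 1" "h \<le> \<eta> / (8 * C\<^sub>\<rho>)" using h(2) by (auto simp: h\<^sub>0_def)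
    moreover have "0 < 8 * (M + 1) * C\<^sub>P" "0 < 8 * C\<^sub>\<rho>" using C M by auto
    ultimately have h1: "(M + 1) * (C\<^sub>P * h) \<le> 1/8" and h2: "C\<^sub>\<rho> * h \<le> \<eta> / 8" "h \<le> 1"
      by (simp_all add: pos_le_divide_eq mult_ac)
    have h3: "C\<^sub>\<rho> * h\<^sup>2 \<le> \<eta> / 8"
    proof -
      have "C\<^sub>\<rho> * h\<^sup>2 \<le> C\<^sub>\<rho> * h"
        using h2(2) h(1) C by (intro mult_left_mono) (auto simp: power2_eq_square mult_le_one)
      then show ?thesis using h2(1) by linarith
    qed
    have bij: "bij_betw ?p (\<Union>\<K>) \<Gamma>" and \<rho>: "\<And>x. x \<in> \<Union>\<K> \<Longrightarrow> norm (x - ?p x) \<le> C\<^sub>\<rho> * h\<^sup>2"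
      and sim: "\<And>K. K \<in> \<K> \<Longrightarrow> int DIM('d) simplex K"
      and on: "\<And>K x. K \<in> \<K> \<Longrightarrow> x \<in> K \<Longrightarrow> onorm (\<lambda>w. orth_proj (tangent_space \<Gamma> (?p x)) w
                   - orth_proj (direction_space K) w) \<le> C\<^sub>P * h"
      using dm infdist_closest_point[OF cl \<Gamma>(2)] unfolding discrete_manifold_def closed_surface_mesh_def
      by (auto simp: dist_norm)
    have sT: "subspace (tangent_space \<Gamma> q)" if "q \<in> \<Gamma>" for q
      using subspace_tangent_space[OF \<Gamma> spt that] .
    have close: "norm (orth_proj (tangent_space \<Gamma> (?p x)) w - orth_proj (direction_space K) w) \<le> C\<^sub>P * h * norm w"
      if K: "K \<in> \<K>" "x \<in> K" for K x w
    proof -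
      have "bounded_linear (\<lambda>w. orth_proj (tangent_space \<Gamma> (?p x)) w - orth_proj (direction_space K) w)"
        by (intro bounded_linear_sub linear_orth_proj[OF sT[OF pin], THEN linear_conv_bounded_linear[THEN iffD1]]
            linear_orth_proj[OF subspace_direction_space, THEN linear_conv_bounded_linear[THEN iffD1]])
      from onorm[OF this, of w] on[OF K] show ?thesis
        by (meson mult_right_mono norm_ge_zero order_trans)
    qed
    \<comment> \<open>Two errors of 1/8 each: the linearization of the projection at
      \<open>?q\<close>, and the difference between \<open>?D ?q ?w\<close> and \<open>?w\<close>.
      For the latter, the derivative fixes the tangential part \<open>?t\<close>, and
      \<open>?w - ?t\<close> is small because \<open>?w\<close> is a direction of
      \<open>K\<close>.\<close>
    have near: "norm (?p x - ?p y - (x - y)) \<le> 1/4 * norm (x - y)"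
      if K: "K \<in> \<K>" "x \<in> K" "y \<in> K" and xy: "norm (x - y) \<le> \<eta> / 4" for K x y
    proof -
      let ?q = "?p x" let ?w = "x - y"
      let ?t = "orth_proj (tangent_space \<Gamma> ?q) ?w"
      have xU: "x \<in> \<Union>\<K>" using K by blast
      have q: "?q \<in> \<Gamma>" by (rule pin)
      have "norm (x - ?q) \<le> \<eta> / 8" using \<rho>[OF xU] h3 by linarith
      moreover have "norm (y - ?q) \<le> norm (x - y) + norm (x - ?q)" using norm_triangle_ineq4[of "x - ?q" "x - y"] by simp
      ultimately have "x \<in> ball ?q \<eta>" "y \<in> ball ?q \<eta>" using \<eta> xy by (auto simp: dist_norm norm_minus_commute)
      then have 1: "norm (?p x - ?p y - ?D ?q ?w) \<le> 1/8 * norm ?w" using lin[OF q] by blast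
      have "orth_proj (direction_space K) ?w = ?w"
        using K by (intro orth_proj_id subspace_direction_space direction_spaceI)
      then have 2: "norm (?w - ?t) \<le> C\<^sub>P * h * norm ?w" using close[OF K(1,2), of ?w] by (simp add: norm_minus_commute)
      have "?D ?q ?t = ?t"
        using orth_proj_in[OF sT[OF q]] by (rule closest_point_derivative_tangent[OF \<Gamma> spt q])
      then have "?D ?q ?w - ?w = ?D ?q (?w - ?t) - (?w - ?t)"
        by (simp add: Real_Vector_Spaces.linear_diff[OF lD[OF q]])
      also have "norm \<dots> \<le> M * norm (?w - ?t) + norm (?w - ?t)"
        using M(2)[OF q, of "?w - ?t"] norm_triangle_ineq4[of "?D ?q (?w - ?t)" "?w - ?t"] by linarith
      also have "\<dots> = (M + 1) * norm (?w - ?t)" by (simp add: algebra_simps)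
      also have "\<dots> \<le> (M + 1) * (C\<^sub>P * h * norm ?w)" using 2 M by (intro mult_left_mono) auto
      also have "\<dots> = ((M + 1) * (C\<^sub>P * h)) * norm ?w" by simp
      also have "\<dots> \<le> 1/8 * norm ?w" using h1 by (intro mult_right_mono) auto
      finally have "norm (?D ?q ?w - ?w) \<le> 1/8 * norm ?w" .
      then show ?thesis using 1 norm_triangle_ineq[of "?p x - ?p y - ?D ?q ?w" "?D ?q ?w - ?w"]
        unfolding diff_add_cancel add_diff_eq by linarith
    qed
    define q where "q = ?p x\<^sub>0"
    have q: "q \<in> \<Gamma>" unfolding q_def by (rule pin)
    have x0q: "norm (x\<^sub>0 - q) \<le> C\<^sub>\<rho> * h\<^sup>2" using \<rho>[OF x0] by (simp add: q_def)
    obtain K\<^sub>0 where K0: "K\<^sub>0 \<in> \<K>" "x\<^sub>0 \<in> K\<^sub>0" using x0 by blast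
    \<comment> \<open>The tangent space gets its dimension from the simplex through
      \<open>x\<^sub>0\<close>, whose direction space is closer to it than 1.\<close>
    have dT: "dim (tangent_space \<Gamma> q) = DIM('d)"
    proof -
      have "C\<^sub>P * h \<le> (M + 1) * (C\<^sub>P * h)" using M C h mult_right_mono[of 1 "M + 1" "C\<^sub>P * h"] by simp
      then have "C\<^sub>P * h < 1" using h1 by linarith
      then have "dim (direction_space K\<^sub>0) = dim (tangent_space \<Gamma> q)"
        using close[OF K0] sT[OF q] subspace_direction_space unfolding q_def
        by (intro dim_eq_if_orth_proj_close) auto
      then show ?thesis using dim_direction_space[OF sim[OF K0(1)]] by simp
    qed
    obtain L :: "'d \<Rightarrow> 'a" where L: "linear L" "range L = tangent_space \<Gamma> q" "\<And>x. norm (L x) = norm x"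
      using isometry_subspaces[of "UNIV :: 'd set" "tangent_space \<Gamma> q"] sT[OF q] dT by auto
    define G where "G y = adjoint L (y - q)" for y
    have lG: "linear (adjoint L)" using L(1) by (rule adjoint_linear)
    have Gdiff: "G y - G y' = adjoint L (y - y')" for y y'
      by (simp add: G_def flip: Real_Vector_Spaces.linear_diff[OF lG])
    have Gle: "norm (G y - G y') \<le> norm (y - y')" for y y'
      unfolding Gdiff by (rule norm_adjoint_isometry_le[OF L(1,3)])
    \<comment> \<open>Both points are fixed by the projection, so their difference is within 1/8 of
      its image under \<open>?D q\<close>. That image is tangential, where \<open>adjoint L\<close>
      is isometric; two losses of 1/8 leave 3/4.\<close>
    have Gge: "3/4 * norm (y - y') \<le> norm (G y - G y')" if y: "y \<in> \<Gamma>" "y' \<in> \<Gamma>" "y \<in> ball q \<eta>" "y' \<in> ball q \<eta>" for y y'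
    proof -
      let ?u = "y - y'" let ?t = "?D q (y - y')"
      have 1: "norm (?u - ?t) \<le> 1/8 * norm ?u" using lin[OF q y(3,4)] y by (simp add: closest_point_self)
      obtain w where w: "?t = L w" using closest_point_derivative_in_tangent[OF \<Gamma> spt q] L(2) by blast
      then have "norm (adjoint L ?t) = norm ?t" using adjoint_isometry_left_inverse[OF L(1,3)] L(3) by simp
      moreover have "norm (adjoint L (?u - ?t)) \<le> 1/8 * norm ?u"
        using norm_adjoint_isometry_le[OF L(1,3)] 1 order_trans by blast
      moreover have "adjoint L ?u = adjoint L ?t + adjoint L (?u - ?t)"
        by (simp flip: Real_Vector_Spaces.linear_add[OF lG])
      ultimately have "norm (adjoint L ?u) \<ge> norm ?t - 1/8 * norm ?u"
        using norm_diff_ineq[of "adjoint L ?t" "adjoint L (?u - ?t)"] by simp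
      moreover have "norm ?t \<ge> norm ?u - 1/8 * norm ?u"
        using 1 norm_triangle_ineq2[of ?u "?u - ?t"] by simp
      ultimately show ?thesis unfolding Gdiff by linarith
    qed
    have px: "norm (?p x - q) \<le> norm (x - x\<^sub>0) + 2 * C\<^sub>\<rho> * h\<^sup>2" if "x \<in> \<Union>\<K>" for x
      using \<rho>[OF that] x0q norm_triangle_ineq[of "?p x - x" "x - x\<^sub>0"] norm_triangle_ineq[of "?p x - x + (x - x\<^sub>0)" "x\<^sub>0 - q"]
      by (simp add: norm_minus_commute)
    \<comment> \<open>The radius is at most \<open>\<eta> / 8 + 2 * (\<eta> / 8)\<close>, less than
      \<open>\<eta>\<close>.\<close>
    have pb: "?p x \<in> ball q \<eta>" if "x \<in> \<Union>\<K> \<inter> cball x\<^sub>0 (\<eta> / 8)" for x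
      using px[of x] that h3 \<eta> by (auto simp: dist_norm norm_minus_commute)
    define f where "f x = G (?p x)" for x
    show "\<exists>f :: 'a \<Rightarrow> 'd.
        (\<forall>K\<in>\<K>. \<forall>x\<in>K \<inter> cball x\<^sub>0 (\<eta>/8). \<forall>y\<in>K \<inter> cball x\<^sub>0 (\<eta>/8).
           norm (x - y) \<le> 2 * norm (f x - f y) \<and> norm (f x - f y) \<le> 2 * norm (x - y)) \<and>
        inj_on f (\<Union>\<K> \<inter> cball x\<^sub>0 (\<eta>/8)) \<and>
        (\<forall>x\<in>\<Union>\<K> \<inter> cball x\<^sub>0 (\<eta>/8). norm (f x) \<le> norm (x - x\<^sub>0) + 2 * C\<^sub>\<rho> * h\<^sup>2) \<and>
        (\<forall>r. 4 * C\<^sub>\<rho> * h\<^sup>2 \<le> r \<and> r \<le> \<eta>/8 \<longrightarrow> cball 0 (r / 8) \<subseteq> f ` (\<Union>\<K> \<inter> cball x\<^sub>0 r))"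
    proof (intro exI[of _ f] conjI)
      show "\<forall>K\<in>\<K>. \<forall>x\<in>K \<inter> cball x\<^sub>0 (\<eta>/8). \<forall>y\<in>K \<inter> cball x\<^sub>0 (\<eta>/8).
           norm (x - y) \<le> 2 * norm (f x - f y) \<and> norm (f x - f y) \<le> 2 * norm (x - y)"
      proof (intro ballI)
        fix K x y assume K: "K \<in> \<K>" and x: "x \<in> K \<inter> cball x\<^sub>0 (\<eta>/8)" and y: "y \<in> K \<inter> cball x\<^sub>0 (\<eta>/8)"
        have "norm (x - y) \<le> \<eta> / 4"
          using x y norm_triangle_ineq[of "x - x\<^sub>0" "x\<^sub>0 - y"] by (auto simp: dist_norm norm_minus_commute)
        then have n: "norm (?p x - ?p y - (x - y)) \<le> 1/4 * norm (x - y)" using near[OF K] x y by blast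
        have 1: "norm (?p x - ?p y) \<le> 5/4 * norm (x - y)"
          using n norm_triangle_ineq[of "?p x - ?p y - (x - y)" "x - y"] by simp
        have 2: "3/4 * norm (x - y) \<le> norm (?p x - ?p y)"
          using n norm_triangle_ineq4[of "?p x - ?p y" "?p x - ?p y - (x - y)"] by simp
        \<comment> \<open>The factor 3/4 of the projection times the factor 3/4 of \<open>G\<close>
          is 9/16, which exceeds 1/2.\<close>
        have "3/4 * norm (?p x - ?p y) \<le> norm (f x - f y)"
          unfolding f_def using x y K pb by (intro Gge pin) auto
        moreover have "norm (f x - f y) \<le> norm (?p x - ?p y)" unfolding f_def by (rule Gle)
        ultimately show "norm (x - y) \<le> 2 * norm (f x - f y) \<and> norm (f x - f y) \<le> 2 * norm (x - y)"
          using 1 2 norm_ge_zero[of "x - y"] by (intro conjI) linarith+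
      qed
      show "inj_on f (\<Union>\<K> \<inter> cball x\<^sub>0 (\<eta>/8))"
      proof (rule inj_onI)
        fix x y assume x: "x \<in> \<Union>\<K> \<inter> cball x\<^sub>0 (\<eta>/8)" and y: "y \<in> \<Union>\<K> \<inter> cball x\<^sub>0 (\<eta>/8)" and eq: "f x = f y"
        have "3/4 * norm (?p x - ?p y) \<le> norm (f x - f y)"
          unfolding f_def using x y pb by (intro Gge pin) auto
        then have "?p x = ?p y" using eq by simp
        then show "x = y" using bij x y by (auto simp: bij_betw_def inj_on_def)
      qed
      show "\<forall>x\<in>\<Union>\<K> \<inter> cball x\<^sub>0 (\<eta>/8). norm (f x) \<le> norm (x - x\<^sub>0) + 2 * C\<^sub>\<rho> * h\<^sup>2"
      proof
        fix x assume "x \<in> \<Union>\<K> \<inter> cball x\<^sub>0 (\<eta>/8)"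
        then have "norm (?p x - q) \<le> norm (x - x\<^sub>0) + 2 * C\<^sub>\<rho> * h\<^sup>2" using px by blast
        moreover have "norm (f x) \<le> norm (?p x - q)" unfolding f_def G_def by (rule norm_adjoint_isometry_le[OF L(1,3)])
        ultimately show "norm (f x) \<le> norm (x - x\<^sub>0) + 2 * C\<^sub>\<rho> * h\<^sup>2" by linarith
      qed
      show "\<forall>r. 4 * C\<^sub>\<rho> * h\<^sup>2 \<le> r \<and> r \<le> \<eta>/8 \<longrightarrow> cball 0 (r / 8) \<subseteq> f ` (\<Union>\<K> \<inter> cball x\<^sub>0 r)"
      proof (intro allI impI subsetI)
        fix r z assume r: "4 * C\<^sub>\<rho> * h\<^sup>2 \<le> r \<and> r \<le> \<eta>/8" and z: "z \<in> cball (0::'d) (r / 8)"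
        have r0: "0 < r" using r C h by (smt (verit) mult_pos_pos zero_less_power)
        \<comment> \<open>On the tangent plane \<open>H\<close> differs from the identity by a map
          with Lipschitz constant 1/8 that vanishes at 0. Solutions of \<open>H w = z\<close> are
          the fixed points of \<open>z - (H w - w)\<close>, a contraction of the ball of radius
          \<open>r / 4\<close> into itself since r/8 + r/32 is at most r/4.\<close>
        define H where "H w = G (?p (q + L w))" for w
        have DL: "?D q (L w) = L w" for w
          using L(2) by (intro closest_point_derivative_tangent[OF \<Gamma> spt q]) auto
        have qL: "q + L w \<in> ball q \<eta>" if "w \<in> cball 0 (r/4)" for w
          using that r r0 L(3)[of w] \<eta> by (auto simp: dist_norm)
        have pL: "norm (?p (q + L w) - ?p (q + L w') - L (w - w')) \<le> 1/8 * norm (w - w')"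
          if "w \<in> cball 0 (r/4)" "w' \<in> cball 0 (r/4)" for w w'
        proof -
          have "q + L w - (q + L w') = L (w - w')" by (simp add: Real_Vector_Spaces.linear_diff[OF L(1)])
          then show ?thesis using lin[OF q qL[OF that(1)] qL[OF that(2)]] by (simp add: DL L(3))
        qed
        have HH: "norm ((H w - w) - (H w' - w')) \<le> 1/8 * norm (w - w')"
          if "w \<in> cball 0 (r/4)" "w' \<in> cball 0 (r/4)" for w w'
        proof -
          have "(H w - w) - (H w' - w') = adjoint L (?p (q + L w) - ?p (q + L w')) - adjoint L (L (w - w'))"
            unfolding H_def adjoint_isometry_left_inverse[OF L(1,3)] Gdiff[symmetric] by simp
          also have "\<dots> = adjoint L (?p (q + L w) - ?p (q + L w') - L (w - w'))"
            by (simp add: Real_Vector_Spaces.linear_diff[OF lG])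
          finally show ?thesis using pL[OF that] norm_adjoint_isometry_le[OF L(1,3)] by (metis order_trans)
        qed
        have in0: "0 \<in> cball (0::'d) (r/4)" using r0 by simp
        have H0: "H 0 = 0" using q by (simp add: H_def G_def Real_Vector_Spaces.linear_0[OF L(1)] Real_Vector_Spaces.linear_0[OF lG] closest_point_self)
        have "\<exists>!w\<in>cball 0 (r/4). z - (H w - w) = w"
        proof (rule Banach_fix)
          show "complete (cball (0::'d) (r/4))" by (simp add: compact_imp_complete)
          show "cball (0::'d) (r/4) \<noteq> {}" using in0 by blast
          show "(0::real) \<le> 1/8" "(1/8::real) < 1" by auto
          show "(\<lambda>w. z - (H w - w)) ` cball 0 (r/4) \<subseteq> cball 0 (r/4)"
          proof (rule image_subsetI)
            fix w assume w: "w \<in> cball (0::'d) (r/4)"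
            have "norm (H w - w) \<le> 1/8 * norm w" using HH[OF w in0] H0 by simp
            moreover have "norm (z - (H w - w)) \<le> norm z + norm (H w - w)" by (rule norm_triangle_ineq4)
            ultimately show "z - (H w - w) \<in> cball 0 (r/4)" using z w r0 by simp
          qed
          show "dist (z - (H w - w)) (z - (H w' - w')) \<le> 1/8 * dist w w'"
            if "w \<in> cball 0 (r/4)" "w' \<in> cball 0 (r/4)" for w w'
            using HH[OF that] by (simp add: dist_norm norm_minus_commute algebra_simps)
        qed
        then obtain w where w: "w \<in> cball 0 (r/4)" "H w = z" by (auto simp: algebra_simps)
        let ?y = "?p (q + L w)"
        \<comment> \<open>Bijectivity lifts the point of \<open>\<Gamma>\<close> back to the
          discrete manifold. Its distance from \<open>x\<^sub>0\<close> is at most 9r/32 plus two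
          normal offsets, which together are at most r/2.\<close>
        obtain x where x: "x \<in> \<Union>\<K>" "?p x = ?y" using bij pin[of "q + L w"] by (metis bij_betw_def imageE)
        have "norm (?y - q - L w) \<le> 1/8 * norm w"
          using pL[OF w(1) in0] q by (simp add: Real_Vector_Spaces.linear_0[OF L(1)] closest_point_self)
        then have "norm (?y - q) \<le> 9/8 * norm w"
          using norm_triangle_ineq[of "?y - q - L w" "L w"] L(3)[of w] by simp
        moreover have "norm (x - x\<^sub>0) \<le> norm (x - ?y) + norm (?y - q) + norm (q - x\<^sub>0)"
          using norm_triangle_ineq[of "x - ?y" "?y - q"] norm_triangle_ineq[of "x - q" "q - x\<^sub>0"] by simp
        moreover have "norm (x - ?y) \<le> C\<^sub>\<rho> * h\<^sup>2" using \<rho>[OF x(1)] x(2) by simp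
        moreover have "norm (q - x\<^sub>0) \<le> C\<^sub>\<rho> * h\<^sup>2" using x0q by (simp add: norm_minus_commute)
        ultimately have "norm (x - x\<^sub>0) \<le> r" using r w(1) r0 by simp
        then have "x \<in> \<Union>\<K> \<inter> cball x\<^sub>0 r" using x by (simp add: dist_norm norm_minus_commute)
        moreover have "f x = z" using x(2) w(2) by (simp add: f_def H_def)
        ultimately show "z \<in> f ` (\<Union>\<K> \<inter> cball x\<^sub>0 r)" by blast
      qed
    qed
  qed
qed

section \<open>Surface measure of the discrete manifold\<close>

lemma flat_paramE:
  fixes K :: "'a::euclidean_space set"
  assumes "int DIM('d::euclidean_space) simplex K"
  obtains a L where "a \<in> K" "linear L" "\<And>x. norm (L x) = norm x" "range L = direction_space K"
    "(flat_param K :: 'd \<Rightarrow> 'a) = (\<lambda>x. a + L x)"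
proof -
  obtain a where a: "a \<in> K" using simplex_nonempty[OF assms] by auto
  obtain L :: "'d \<Rightarrow> 'a" where L: "linear L" "range L = direction_space K" "\<And>x. norm (L x) = norm x"
    using isometry_subspaces[of "UNIV :: 'd set" "direction_space K"] subspace_direction_space[of K] dim_direction_space[OF assms]
    by auto
  have "\<exists>F :: 'd \<Rightarrow> 'a. \<exists>a L. a \<in> K \<and> linear L \<and> (\<forall>x. norm (L x) = norm x) \<and>
                     range L = direction_space K \<and> F = (\<lambda>x. a + L x)"
    using a L by blast
  from someI_ex[OF this] show thesis using that unfolding flat_param_def by blast
qed

section \<open>Isometric coordinates on one simplex\<close>

context
  fixes K :: "'a::euclidean_space set"
  assumes K: "int DIM('d::euclidean_space) simplex K"
begin

private abbreviation "F \<equiv> (flat_param K :: 'd \<Rightarrow> 'a)"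

lemma dist_flat_param: "norm (F x - F y) = norm (x - y)"
proof -
  obtain a L where "linear L" "\<And>x. norm (L x) = norm x" "F = (\<lambda>x. a + L x)"
    by (rule flat_paramE[OF K]) blast
  then show ?thesis by (simp flip: Real_Vector_Spaces.linear_diff)
qed

lemma subset_range_flat_param: "K \<subseteq> range F"
proof
  fix x assume x: "x \<in> K"
  obtain a L where aL: "a \<in> K" "range L = direction_space K" "F = (\<lambda>x. a + L x)"
    by (rule flat_paramE[OF K]) blast
  have "x - a \<in> range L" using direction_spaceI[OF x aL(1)] aL(2) by simp
  then obtain y where "x - a = L y" by blast
  then have "x = a + L y" by (simp add: algebra_simps)
  then show "x \<in> range F" unfolding aL(3) by blast
qed

lemma continuous_on_flat_param: "continuous_on S F"
  unfolding continuous_on_iff using dist_flat_param by (auto simp: dist_norm)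

lemma compact_vimage_flat_param:
  assumes "compact C"
  shows "compact (F -` C)"
proof -
  have "closed (F -` C)"
    using continuous_closed_vimage[OF compact_imp_closed[OF assms], of F] continuous_on_flat_param[of UNIV]
    by (simp add: continuous_on_eq_continuous_at)
  moreover have "bounded (F -` C)"
  proof -
    obtain B where B: "\<And>x. x \<in> C \<Longrightarrow> norm x \<le> B" using assms compact_imp_bounded bounded_iff by metis
    have "norm x \<le> B + norm (F 0)" if "F x \<in> C" for x
      using B[OF that] dist_flat_param[of x 0] norm_triangle_ineq4[of "F x" "F 0"] by simp
    then show ?thesis unfolding bounded_iff by (intro exI[of _ "B + norm (F 0)"]) auto
  qed
  ultimately show ?thesis by (simp add: compact_eq_bounded_closed)
qed

lemma convex_vimage_flat_param:
  assumes "convex C"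
  shows "convex (F -` C)"
proof -
  obtain a L where aL: "linear L" "F = (\<lambda>x. a + L x)"
    by (rule flat_paramE[OF K]) blast
  have "F -` C = L -` ((+) (- a) ` C)" unfolding aL(2) by (force simp: image_iff algebra_simps)
  then show ?thesis using aL(1) assms by (simp add: convex_linear_vimage convex_translation)
qed

lemma aff_dim_flat_param_image:
  fixes S :: "'d set"
  shows "aff_dim (F ` S) = aff_dim S"
proof -
  obtain a L where aL: "linear L" "F = (\<lambda>x. a + L x)" "\<And>x. norm (L x) = norm x"
    by (rule flat_paramE[OF K]) blast
  have inj: "inj L"
  proof (rule injI)
    fix x y assume "L x = L y"
    then have "L (x - y) = 0" using aL(1) by (simp add: Real_Vector_Spaces.linear_diff)
    then have "norm (x - y) = 0" using aL(3)[of "x - y"] by simp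
    then show "x = y" by simp
  qed
  have "F ` S = (+) a ` (L ` S)" unfolding aL(2) by (simp add: image_image)
  then show ?thesis using aff_dim_injective_linear_image[OF aL(1) inj] by (simp add: aff_dim_translation_eq)
qed

text \<open>A proper face has smaller affine dimension, which the coordinates preserve; its preimage
  is convex with empty interior. This makes the areas of adjacent simplices additive.\<close>

lemma negligible_vimage_proper_face:
  assumes "T face_of K" "T \<noteq> K"
  shows "negligible (F -` T)"
proof -
  have cT: "convex T" using assms(1) by (rule face_of_imp_convex)
  have "interior (F -` T) = {}"
  proof (rule ccontr)
    assume "interior (F -` T) \<noteq> {}"
    then have "aff_dim (F -` T) = int DIM('d)" by (rule aff_dim_nonempty_interior)
    moreover have "F ` (F -` T) = T"
      using subset_range_flat_param face_of_imp_subset[OF assms(1)] by auto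
    ultimately have "aff_dim T = aff_dim K"
      using aff_dim_flat_param_image[of "F -` T"] K by (simp add: aff_dim_simplex)
    moreover have "convex K" using K by (auto simp: simplex_def)
    ultimately show False using face_of_aff_dim_lt[OF _ assms] by simp
  qed
  then show ?thesis using convex_vimage_flat_param[OF cT] negligible_convex_interior by blast
qed

end

lemma compact_simplex: "n simplex K \<Longrightarrow> compact K"
  by (metis simplex compact_convex_hull finite_imp_compact)

lemma convex_simplex: "n simplex K \<Longrightarrow> convex K"
  by (auto simp: simplex_def)

text \<open>If the common face were all of \<open>K\<close>, then \<open>K\<close> would be a proper
  face of \<open>K'\<close> of the same dimension.\<close>

lemma triangulation_Int_neq:
  assumes "triangulation \<K>" "K \<in> \<K>" "K' \<in> \<K>" "K \<noteq> K'" "int n simplex K" "int n simplex K'"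
  shows "K \<inter> K' face_of K" "K \<inter> K' \<noteq> K"
proof -
  have f: "K \<inter> K' face_of K" "K' \<inter> K face_of K'" using assms(1-3) by (auto simp: triangulation_def)
  show "K \<inter> K' face_of K" by fact
  show "K \<inter> K' \<noteq> K"
  proof
    assume eq: "K \<inter> K' = K"
    then have "K \<noteq> K'" "K face_of K'" using f(2) assms(4) by (auto simp: Int_commute)
    then have "aff_dim K < aff_dim K'" using face_of_aff_dim_lt convex_simplex[OF assms(6)] by blast
    then show False using assms(5,6) by (simp add: aff_dim_simplex)
  qed
qed

text \<open>Uses the same coordinates as \<open>simplex_integral\<close>; \<open>UNIV\<close> for
  \<open>S\<close> gives the whole area of the simplex.\<close>

definition simplex_area :: "'d::euclidean_space itself \<Rightarrow> 'a::euclidean_space set \<Rightarrow> 'a set \<Rightarrow> real" where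
  "simplex_area TYPE('d) K S = measure lebesgue ((flat_param K :: 'd \<Rightarrow> 'a) -` (K \<inter> S))"

lemma simplex_area_nonneg: "0 \<le> simplex_area TYPE('d::euclidean_space) K S"
  by (simp add: simplex_area_def)

text \<open>The Lipschitz estimate is applied to \<open>g\<close> on \<open>E\<close> and to its
  inverse on the image.\<close>

lemma measure_bilipschitz_image:
  fixes g :: "'d::euclidean_space \<Rightarrow> 'd"
  assumes E: "compact E"
    and bl: "\<And>x y. x \<in> E \<Longrightarrow> y \<in> E \<Longrightarrow> norm (x - y) \<le> 2 * norm (g x - g y) \<and> norm (g x - g y) \<le> 2 * norm (x - y)"
  shows "compact (g ` E)"
    and "measure lebesgue (g ` E) \<le> lip_const TYPE('d) * 2 ^ DIM('d) * measure lebesgue E"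
    and "measure lebesgue E \<le> lip_const TYPE('d) * 2 ^ DIM('d) * measure lebesgue (g ` E)"
proof -
  have cont: "continuous_on E g"
    by (rule lipschitz_on_continuous_on[of 2]) (auto intro!: lipschitz_onI simp: dist_norm bl)
  show cg: "compact (g ` E)" by (rule compact_continuous_image[OF cont E])
  show "measure lebesgue (g ` E) \<le> lip_const TYPE('d) * 2 ^ DIM('d) * measure lebesgue E"
    using E cg bl by (intro measure_lipschitz_image_le) (auto simp: lmeasurable_compact compact_imp_bounded)
  have inj: "inj_on g E"
  proof (rule inj_onI)
    fix x y assume "x \<in> E" "y \<in> E" "g x = g y"
    then show "x = y" using bl[of x y] by simp
  qed
  let ?k = "inv_into E g"
  have kg: "?k ` (g ` E) = E" using inj by (simp add: image_image)
  have "measure lebesgue (?k ` (g ` E)) \<le> lip_const TYPE('d) * 2 ^ DIM('d) * measure lebesgue (g ` E)"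
  proof (rule measure_lipschitz_image_le)
    show "g ` E \<in> lmeasurable" "bounded (g ` E)" "?k ` g ` E \<in> lmeasurable" 
      using E cg unfolding kg by (auto simp: lmeasurable_compact compact_imp_bounded)
    fix x y assume "x \<in> g ` E" "y \<in> g ` E"
    then show "norm (?k x - ?k y) \<le> 2 * norm (x - y)" using bl inj by auto
  qed simp
  then show "measure lebesgue E \<le> lip_const TYPE('d) * 2 ^ DIM('d) * measure lebesgue (g ` E)" unfolding kg .
qed

section \<open>Areas seen through a chart\<close>

context
  fixes \<K> :: "'a::euclidean_space set set" and f :: "'a \<Rightarrow> 'd::euclidean_space" and S :: "'a set"
  assumes tri: "triangulation \<K>" and sim: "\<And>K. K \<in> \<K> \<Longrightarrow> int DIM('d) simplex K"
    and clS: "closed S"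
    and bl: "\<And>K x y. K \<in> \<K> \<Longrightarrow> x \<in> K \<inter> S \<Longrightarrow> y \<in> K \<inter> S \<Longrightarrow>
      norm (x - y) \<le> 2 * norm (f x - f y) \<and> norm (f x - f y) \<le> 2 * norm (x - y)"
begin

private abbreviation "param K \<equiv> (flat_param K :: 'd \<Rightarrow> 'a)"
private abbreviation "piece K \<equiv> param K -` (K \<inter> S)"

text \<open>The flat coordinates are isometric, so composing them with the chart keeps the Lipschitz
  constant 2.\<close>

private lemma chart_image:
  assumes K: "K \<in> \<K>"
  shows "compact (f ` (K \<inter> S))" "measure lebesgue (f ` (K \<inter> S)) \<le> (lip_const TYPE('d) * 2 ^ DIM('d)) * simplex_area TYPE('d) K S"
    "simplex_area TYPE('d) K S \<le> (lip_const TYPE('d) * 2 ^ DIM('d)) * measure lebesgue (f ` (K \<inter> S))"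
proof -
  have cE: "compact (piece K)"
    using compact_simplex[OF sim[OF K]] clS by (intro compact_vimage_flat_param sim[OF K]) (simp add: compact_Int_closed)
  have FE: "param K ` piece K = K \<inter> S" using subset_range_flat_param[OF sim[OF K]] by auto
  have eq: "(\<lambda>x. f (param K x)) ` piece K = f ` (K \<inter> S)" by (metis FE image_image)
  have "norm (x - y) \<le> 2 * norm (f (param K x) - f (param K y)) \<and> norm (f (param K x) - f (param K y)) \<le> 2 * norm (x - y)"
    if "x \<in> piece K" "y \<in> piece K" for x y
    using bl[OF K, of "param K x" "param K y"] that dist_flat_param[OF sim[OF K], of x y] by simp
  from measure_bilipschitz_image[OF cE, of "\<lambda>x. f (param K x)", OF this]
  show "compact (f ` (K \<inter> S))" "measure lebesgue (f ` (K \<inter> S)) \<le> (lip_const TYPE('d) * 2 ^ DIM('d)) * simplex_area TYPE('d) K S"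
    "simplex_area TYPE('d) K S \<le> (lip_const TYPE('d) * 2 ^ DIM('d)) * measure lebesgue (f ` (K \<inter> S))"
    unfolding eq simplex_area_def by blast+
qed

lemma finite_triangulated: "finite \<K>" using tri by (simp add: triangulation_def)

text \<open>By injectivity the images of two simplices meet only in the image of their common face,
  a null set. Hence the measures of the images add up inside \<open>W\<close>.\<close>

lemma sum_simplex_area_le:
  assumes inj: "inj_on f (\<Union>\<K> \<inter> S)" and W: "f ` (\<Union>\<K> \<inter> S) \<subseteq> W" "W \<in> lmeasurable"
  shows "(\<Sum>K\<in>\<K>. simplex_area TYPE('d) K S) \<le> (lip_const TYPE('d) * 2 ^ DIM('d)) * measure lebesgue W"
proof -
  have B0: "0 \<le> (lip_const TYPE('d) * 2 ^ DIM('d))" using lip_const_pos[where 'd='d] by simp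
  have "(\<Sum>K\<in>\<K>. simplex_area TYPE('d) K S) \<le> (\<Sum>K\<in>\<K>. (lip_const TYPE('d) * 2 ^ DIM('d)) * measure lebesgue (f ` (K \<inter> S)))"
    by (intro sum_mono chart_image)
  also have "\<dots> = (lip_const TYPE('d) * 2 ^ DIM('d)) * (\<Sum>K\<in>\<K>. measure lebesgue (f ` (K \<inter> S)))" by (simp add: sum_distrib_left)
  also have "(\<Sum>K\<in>\<K>. measure lebesgue (f ` (K \<inter> S))) = measure lebesgue (\<Union>K\<in>\<K>. f ` (K \<inter> S))"
  proof (rule measure_negligible_finite_Union_image[symmetric])
    show "finite \<K>" by (rule finite_triangulated)
    show "\<And>K. K \<in> \<K> \<Longrightarrow> f ` (K \<inter> S) \<in> lmeasurable" by (simp add: chart_image lmeasurable_compact)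
    show "pairwise (\<lambda>K K'. negligible (f ` (K \<inter> S) \<inter> f ` (K' \<inter> S))) \<K>"
    proof (rule pairwiseI)
      fix K K' assume KK: "K \<in> \<K>" "K' \<in> \<K>" "K \<noteq> K'"
      let ?Z = "param K -` (K \<inter> K')"
      have "negligible ?Z"
        using triangulation_Int_neq[OF tri KK sim[OF KK(1)] sim[OF KK(2)]]
        by (intro negligible_vimage_proper_face sim[OF KK(1)])
      then have nZ: "negligible (?Z \<inter> piece K)" by (rule negligible_subset) auto
      have "negligible ((\<lambda>x. f (param K x)) ` (?Z \<inter> piece K))"
      proof (rule negligible_locally_Lipschitz_image[OF order_refl nZ])
        fix x assume x: "x \<in> ?Z \<inter> piece K"
        have "norm (f (param K y) - f (param K x)) \<le> 2 * norm (y - x)" if "y \<in> (?Z \<inter> piece K) \<inter> UNIV" for y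
          using bl[OF KK(1), of "param K y" "param K x"] that x dist_flat_param[OF sim[OF KK(1)], of y x] by auto
        then show "\<exists>T Ba. open T \<and> x \<in> T \<and> (\<forall>y\<in>(?Z \<inter> piece K) \<inter> T. norm (f (param K y) - f (param K x)) \<le> Ba * norm (y - x))"
          by (intro exI[of _ UNIV] exI[of _ 2]) auto
      qed
      moreover have "f ` (K \<inter> S) \<inter> f ` (K' \<inter> S) \<subseteq> (\<lambda>x. f (param K x)) ` (?Z \<inter> piece K)"
      proof
        fix z assume "z \<in> f ` (K \<inter> S) \<inter> f ` (K' \<inter> S)"
        then obtain x y where xy: "x \<in> K \<inter> S" "y \<in> K' \<inter> S" "z = f x" "f x = f y" by auto
        then have "x = y" using inj KK by (intro inj_onD[OF inj]) auto
        moreover obtain u where "x = param K u" using subset_range_flat_param[OF sim[OF KK(1)]] xy(1) by auto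
        ultimately show "z \<in> (\<lambda>x. f (param K x)) ` (?Z \<inter> piece K)" using xy by auto
      qed
      ultimately show "negligible (f ` (K \<inter> S) \<inter> f ` (K' \<inter> S))" by (rule negligible_subset)
    qed
  qed
  also have "(lip_const TYPE('d) * 2 ^ DIM('d)) * \<dots> \<le> (lip_const TYPE('d) * 2 ^ DIM('d)) * measure lebesgue W"
  proof (intro mult_left_mono[OF _ B0] measure_mono_fmeasurable W(2))
    show "(\<Union>K\<in>\<K>. f ` (K \<inter> S)) \<subseteq> W" using W(1) by auto
    show "(\<Union>K\<in>\<K>. f ` (K \<inter> S)) \<in> sets lebesgue"
      using finite_triangulated chart_image(1) by (intro sets.finite_UN) (auto simp: lmeasurable_compact fmeasurableD)
  qed
  finally show ?thesis .
qed

text \<open>The images of the simplices cover \<open>W\<close>, and measure is subadditive.\<close>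

lemma sum_simplex_area_ge:
  assumes W: "W \<subseteq> f ` (\<Union>\<K> \<inter> S)" "W \<in> lmeasurable"
  shows "measure lebesgue W \<le> (lip_const TYPE('d) * 2 ^ DIM('d)) * (\<Sum>K\<in>\<K>. simplex_area TYPE('d) K S)"
proof -
  have lm: "f ` (K \<inter> S) \<in> lmeasurable" if "K \<in> \<K>" for K using that by (simp add: chart_image lmeasurable_compact)
  have "measure lebesgue W \<le> measure lebesgue (\<Union>K\<in>\<K>. f ` (K \<inter> S))"
  proof (rule measure_mono_fmeasurable)
    show "W \<subseteq> (\<Union>K\<in>\<K>. f ` (K \<inter> S))" using W(1) by blast
    show "W \<in> sets lebesgue" using W(2) by (rule fmeasurableD)
    show "(\<Union>K\<in>\<K>. f ` (K \<inter> S)) \<in> lmeasurable" using lm by (rule fmeasurable.finite_UN[OF finite_triangulated])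
  qed
  also have "\<dots> \<le> (\<Sum>K\<in>\<K>. measure lebesgue (f ` (K \<inter> S)))"
    using finite_triangulated lm by (intro measure_UNION_le) (auto simp: fmeasurableD)
  also have "\<dots> \<le> (\<Sum>K\<in>\<K>. (lip_const TYPE('d) * 2 ^ DIM('d)) * simplex_area TYPE('d) K S)"
    by (intro sum_mono chart_image)
  finally show ?thesis by (simp add: sum_distrib_left)
qed

end

text \<open>Only \<open>h\<^sub>0\<close> and \<open>R\<^sub>0\<close> depend on
  \<open>\<Gamma>\<close>; the factors depend on the dimension alone. The lower bound on
  \<open>r\<close> absorbs the normal offset: the chart maps the ball of radius \<open>r\<close>
  into the ball of radius \<open>2 * r\<close>, and its image contains the ball of radius
  \<open>r / 8\<close>.\<close>

proposition discrete_manifold_area_bounds: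
  fixes \<Gamma> :: "'a::euclidean_space set"
  assumes \<Gamma>: "compact \<Gamma>" "\<Gamma> \<noteq> {}" and spt: "smooth_projection_tube \<Gamma> \<delta>"
    and C: "0 < C\<^sub>\<rho>" "0 < C\<^sub>P"
  obtains h\<^sub>0 R\<^sub>0 where "0 < h\<^sub>0" "0 < R\<^sub>0"
    "\<And>h \<K> x\<^sub>0 r. 0 < h \<Longrightarrow> h \<le> h\<^sub>0 \<Longrightarrow> discrete_manifold TYPE('d::euclidean_space) \<Gamma> \<delta> C\<^sub>\<rho> C\<^sub>P h \<K> \<Longrightarrow>
      x\<^sub>0 \<in> \<Union>\<K> \<Longrightarrow> 4 * C\<^sub>\<rho> * h\<^sup>2 \<le> r \<Longrightarrow> r \<le> R\<^sub>0 \<Longrightarrow>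
      (\<Sum>K\<in>\<K>. simplex_area TYPE('d) K (cball x\<^sub>0 r)) \<le> lip_const TYPE('d) * 2 ^ DIM('d) * unit_ball_vol DIM('d) * (2 * r) ^ DIM('d) \<and>
      unit_ball_vol DIM('d) * (r / 8) ^ DIM('d) \<le> lip_const TYPE('d) * 2 ^ DIM('d) * (\<Sum>K\<in>\<K>. simplex_area TYPE('d) K (cball x\<^sub>0 r))"
proof -
  obtain h\<^sub>0 R\<^sub>0 where h0: "0 < h\<^sub>0" "0 < R\<^sub>0" and chart:
    "\<And>h \<K> x\<^sub>0. 0 < h \<Longrightarrow> h \<le> h\<^sub>0 \<Longrightarrow> discrete_manifold TYPE('d) \<Gamma> \<delta> C\<^sub>\<rho> C\<^sub>P h \<K> \<Longrightarrow> x\<^sub>0 \<in> \<Union>\<K> \<Longrightarrow>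
      \<exists>f :: 'a \<Rightarrow> 'd.
        (\<forall>K\<in>\<K>. \<forall>x\<in>K \<inter> cball x\<^sub>0 R\<^sub>0. \<forall>y\<in>K \<inter> cball x\<^sub>0 R\<^sub>0.
           norm (x - y) \<le> 2 * norm (f x - f y) \<and> norm (f x - f y) \<le> 2 * norm (x - y)) \<and>
        inj_on f (\<Union>\<K> \<inter> cball x\<^sub>0 R\<^sub>0) \<and>
        (\<forall>x\<in>\<Union>\<K> \<inter> cball x\<^sub>0 R\<^sub>0. norm (f x) \<le> norm (x - x\<^sub>0) + 2 * C\<^sub>\<rho> * h\<^sup>2) \<and>
        (\<forall>r. 4 * C\<^sub>\<rho> * h\<^sup>2 \<le> r \<and> r \<le> R\<^sub>0 \<longrightarrow> cball 0 (r / 8) \<subseteq> f ` (\<Union>\<K> \<inter> cball x\<^sub>0 r))"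
    by (rule discrete_manifold_local_chart[OF assms, where 'd='d]) blast
  show thesis
  proof (rule that[OF h0])
    fix h \<K> x\<^sub>0 r
    assume h: "0 < h" "h \<le> h\<^sub>0" and dm: "discrete_manifold TYPE('d) \<Gamma> \<delta> C\<^sub>\<rho> C\<^sub>P h \<K>" and x0: "x\<^sub>0 \<in> \<Union>\<K>"
      and r: "4 * C\<^sub>\<rho> * h\<^sup>2 \<le> r" "r \<le> R\<^sub>0"
    obtain f :: "'a \<Rightarrow> 'd" where
       f1: "\<And>K x y. K\<in>\<K> \<Longrightarrow> x\<in>K \<inter> cball x\<^sub>0 R\<^sub>0 \<Longrightarrow> y\<in>K \<inter> cball x\<^sub>0 R\<^sub>0 \<Longrightarrow>
           norm (x - y) \<le> 2 * norm (f x - f y) \<and> norm (f x - f y) \<le> 2 * norm (x - y)" and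
       f2: "inj_on f (\<Union>\<K> \<inter> cball x\<^sub>0 R\<^sub>0)" and
       f3: "\<And>x. x\<in>\<Union>\<K> \<inter> cball x\<^sub>0 R\<^sub>0 \<Longrightarrow> norm (f x) \<le> norm (x - x\<^sub>0) + 2 * C\<^sub>\<rho> * h\<^sup>2" and
       f4: "cball 0 (r / 8) \<subseteq> f ` (\<Union>\<K> \<inter> cball x\<^sub>0 r)"
      using chart[OF h dm x0] r by blast
    have r0: "0 < r" using r C h by (smt (verit) mult_pos_pos zero_less_power)
    have sub: "cball x\<^sub>0 r \<subseteq> cball x\<^sub>0 R\<^sub>0" using r by auto
    have tri: "triangulation \<K>" and sim: "\<And>K. K \<in> \<K> \<Longrightarrow> int DIM('d) simplex K"
      using dm unfolding discrete_manifold_def closed_surface_mesh_def by auto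
    have bl: "norm (x - y) \<le> 2 * norm (f x - f y) \<and> norm (f x - f y) \<le> 2 * norm (x - y)"
      if "K \<in> \<K>" "x \<in> K \<inter> cball x\<^sub>0 r" "y \<in> K \<inter> cball x\<^sub>0 r" for K x y
      using f1[OF that(1)] that sub by blast
    note ctx = tri sim closed_cball bl
    have "f ` (\<Union>\<K> \<inter> cball x\<^sub>0 r) \<subseteq> cball 0 (2 * r)"
    proof (rule image_subsetI)
      fix x assume x: "x \<in> \<Union>\<K> \<inter> cball x\<^sub>0 r"
      then have "norm (f x) \<le> norm (x - x\<^sub>0) + 2 * C\<^sub>\<rho> * h\<^sup>2" using f3 sub by blast
      moreover have "norm (x - x\<^sub>0) \<le> r" using x by (simp add: dist_norm norm_minus_commute)
      ultimately show "f x \<in> cball 0 (2 * r)" using r r0 by simp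
    qed
    moreover have "inj_on f (\<Union>\<K> \<inter> cball x\<^sub>0 r)" using f2 sub by (rule_tac inj_on_subset) auto
    ultimately have "(\<Sum>K\<in>\<K>. simplex_area TYPE('d) K (cball x\<^sub>0 r)) \<le> lip_const TYPE('d) * 2 ^ DIM('d) * measure lebesgue (cball (0::'d) (2*r))"
      by (intro sum_simplex_area_le[OF ctx]) auto
    moreover have "measure lebesgue (cball (0::'d) (r/8)) \<le> lip_const TYPE('d) * 2 ^ DIM('d) * (\<Sum>K\<in>\<K>. simplex_area TYPE('d) K (cball x\<^sub>0 r))"
      using f4 by (intro sum_simplex_area_ge[OF ctx]) auto
    ultimately show "(\<Sum>K\<in>\<K>. simplex_area TYPE('d) K (cball x\<^sub>0 r)) \<le> lip_const TYPE('d) * 2 ^ DIM('d) * unit_ball_vol DIM('d) * (2 * r) ^ DIM('d) \<and>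
      unit_ball_vol DIM('d) * (r / 8) ^ DIM('d) \<le> lip_const TYPE('d) * 2 ^ DIM('d) * (\<Sum>K\<in>\<K>. simplex_area TYPE('d) K (cball x\<^sub>0 r))"
      using r0 by (simp add: content_cball mult.assoc)
  qed
qed

section \<open>Piecewise affine functions on quasi-uniform meshes\<close>

lemma finite_extreme_points_simplex:
  assumes "int n simplex T"
  shows "finite {x. x extreme_point_of T}" "card {x. x extreme_point_of T} = n + 1"
    "T = convex hull {x. x extreme_point_of T}"
proof -
  obtain C where C: "finite C" "\<not> affine_dependent C" "int (card C) = int n + 1" "T = convex hull C"
    using assms by (auto simp: simplex)
  have "{x. x extreme_point_of T} = C"
    using extreme_point_of_convex_hull_affine_independent[OF C(2)] C(4) by auto
  then show "finite {x. x extreme_point_of T}" "card {x. x extreme_point_of T} = n + 1"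
    "T = convex hull {x. x extreme_point_of T}" using C by auto
qed

text \<open>Maximum principle: the half-space where the bound holds is convex and contains the
  vertices.\<close>

lemma affine_le_on_simplex:
  fixes T :: "'a::euclidean_space set"
  assumes T: "int n simplex T" and aff: "\<And>x. x \<in> T \<Longrightarrow> v x = inner g x + b"
    and le: "\<And>x. x extreme_point_of T \<Longrightarrow> v x \<le> m" and x: "x \<in> T"
  shows "v x \<le> (m::real)"
proof -
  have "convex {y. inner g y \<le> m - b}" by (rule convex_halfspace_le)
  moreover have "{x. x extreme_point_of T} \<subseteq> {y. inner g y \<le> m - b}"
    using le aff by (force simp: extreme_point_of_def)
  ultimately have "convex hull {x. x extreme_point_of T} \<subseteq> {y. inner g y \<le> m - b}" by (simp add: hull_minimal)
  then have "T \<subseteq> {y. inner g y \<le> m - b}" using finite_extreme_points_simplex(3)[OF T] by simp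
  then have "inner g x \<le> m - b" using x by blast
  then show ?thesis using aff[OF x] by simp
qed

lemma affine_abs_le_on_simplex:
  fixes T :: "'a::euclidean_space set"
  assumes T: "int n simplex T" and aff: "\<And>x. x \<in> T \<Longrightarrow> v x = inner g x + b"
    and le: "\<And>x. x extreme_point_of T \<Longrightarrow> \<bar>v x\<bar> \<le> m" and x: "x \<in> T"
  shows "\<bar>v x\<bar> \<le> (m::real)"
proof -
  have "v x \<le> m" using le by (intro affine_le_on_simplex[OF T aff _ x]) (auto simp: abs_le_iff)
  moreover have "- v x \<le> m"
  proof (rule affine_le_on_simplex[OF T _ _ x, where v="\<lambda>x. - v x" and g="- g" and b="- b"])
    show "- v y = inner (- g) y + - b" if "y \<in> T" for y using aff[OF that] by simp
    show "- v y \<le> m" if "y extreme_point_of T" for y using le[OF that] by (simp add: abs_le_iff)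
  qed
  ultimately show ?thesis by (simp add: abs_le_iff)
qed

lemma integral_const_lmeasurable:
  fixes T :: "'a::euclidean_space set"
  assumes "T \<in> lmeasurable"
  shows "(\<lambda>_. c::real) integrable_on T" "integral T (\<lambda>_. c) = c * measure lebesgue T"
proof -
  show "(\<lambda>_. c::real) integrable_on T" using assms by (rule integrable_on_const)
  have "integral T (\<lambda>_. c * 1) = c * integral T (\<lambda>_. 1)" by (rule integral_mult_right)
  then show "integral T (\<lambda>_. c) = c * measure lebesgue T" using lmeasure_integral[OF assms] by simp
qed

text \<open>Contribution of one simplex to the mass matrix, with constants independent of its shape.
  In the lower bound, shrinking by 1/4 costs a power of 4 in volume, halving the modulus costs 4,
  and the number of vertices gives \<open>n + 1\<close>.\<close>

lemma affine_square_integral_bounds: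
  fixes T :: "'a::euclidean_space set" and v :: "'a \<Rightarrow> real"
  assumes T: "int n simplex T" and aff: "\<And>x. x \<in> T \<Longrightarrow> v x = inner g x + b"
  shows "(\<lambda>x. (v x)\<^sup>2) integrable_on T"
    and "integral T (\<lambda>x. (v x)\<^sup>2) \<le> measure lebesgue T * (\<Sum>x\<in>{x. x extreme_point_of T}. (v x)\<^sup>2)"
    and "measure lebesgue T * (\<Sum>x\<in>{x. x extreme_point_of T}. (v x)\<^sup>2) \<le> 4 ^ (DIM('a) + 1) * (real n + 1) * integral T (\<lambda>x. (v x)\<^sup>2)"
proof -
  let ?X = "{x. x extreme_point_of T}"
  note X = finite_extreme_points_simplex[OF T]
  have cT: "compact T" using T by (rule compact_simplex)
  have lm: "T \<in> lmeasurable" using cT by (rule lmeasurable_compact)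
  have cont: "continuous_on T (\<lambda>x. (v x)\<^sup>2)"
    by (rule continuous_on_eq[of T "\<lambda>x. (inner g x + b)\<^sup>2"]) (auto intro!: continuous_intros simp: aff)
  have si: "set_integrable lborel T (\<lambda>x. (v x)\<^sup>2)"
    unfolding set_integrable_def using borel_integrable_compact[OF cT cont] .
  show int: "(\<lambda>x. (v x)\<^sup>2) integrable_on T" using set_borel_integral_eq_integral(1)[OF si] .
  have ne: "?X \<noteq> {}" using X(2) by (metis Suc_eq_plus1 card.empty nat.simps(3))
  define m where "m = Max ((\<lambda>x. \<bar>v x\<bar>) ` ?X)"
  have m: "\<And>x. x extreme_point_of T \<Longrightarrow> \<bar>v x\<bar> \<le> m" using X(1) by (auto simp: m_def)
  obtain x0 where x0: "x0 extreme_point_of T" "\<bar>v x0\<bar> = m"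
  proof -
    have "m \<in> (\<lambda>x. \<bar>v x\<bar>) ` ?X" unfolding m_def using X(1) ne by (intro Max_in) auto
    then show thesis using that by auto
  qed
  have m0: "0 \<le> m" using x0 by auto
  have vm: "\<bar>v x\<bar> \<le> m" if "x \<in> T" for x using affine_abs_le_on_simplex[OF T aff m that] .
  have vm2: "(v x)\<^sup>2 \<le> m\<^sup>2" if "x \<in> T" for x using vm[OF that] m0 by (simp add: abs_le_square_iff[symmetric])
  have m2: "m\<^sup>2 \<le> (\<Sum>x\<in>?X. (v x)\<^sup>2)"
  proof -
    have "(v x0)\<^sup>2 \<le> (\<Sum>x\<in>?X. (v x)\<^sup>2)" using X(1) x0(1) by (intro member_le_sum) auto
    moreover have "(v x0)\<^sup>2 = m\<^sup>2" using x0(2) by (metis power2_abs)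
    ultimately show ?thesis by simp
  qed
  have "integral T (\<lambda>x. (v x)\<^sup>2) \<le> integral T (\<lambda>_. m\<^sup>2)"
    by (rule integral_le[OF int integral_const_lmeasurable(1)[OF lm] vm2])
  also have "\<dots> = measure lebesgue T * m\<^sup>2" by (simp add: integral_const_lmeasurable[OF lm])
  also have "\<dots> \<le> measure lebesgue T * (\<Sum>x\<in>?X. (v x)\<^sup>2)" using m2 by (intro mult_left_mono) auto
  finally show "integral T (\<lambda>x. (v x)\<^sup>2) \<le> measure lebesgue T * (\<Sum>x\<in>?X. (v x)\<^sup>2)" .
  txt \<open>On the copy of the simplex shrunk by the factor 1/4 towards a vertex where the maximum of
    the modulus is attained, the modulus is at least half of its maximum.\<close>
  define S where "S = (\<lambda>y. (3/4) *\<^sub>R x0 + (1/4) *\<^sub>R y) ` T"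
  have x0T: "x0 \<in> T" using x0(1) by (simp add: extreme_point_of_def)
  have ST: "S \<subseteq> T"
    unfolding S_def using convex_simplex[OF T] x0T by (auto intro!: convexD)
  have mS: "measure lebesgue S = (1/4) ^ DIM('a) * measure lebesgue T"
    unfolding S_def using measure_lebesgue_affine[of "1/4" "(3/4) *\<^sub>R x0" T] by (simp add: add.commute)
  have cS: "compact S" unfolding S_def by (intro compact_continuous_image continuous_intros cT)
  have lS: "S \<in> lmeasurable" using cS by (rule lmeasurable_compact)
  have low: "(m / 2)\<^sup>2 \<le> (v z)\<^sup>2" if z: "z \<in> S" for z
  proof -
    obtain y where y: "y \<in> T" "z = (3/4) *\<^sub>R x0 + (1/4) *\<^sub>R y" using z by (auto simp: S_def)
    have "v z = inner g z + b" using z ST aff by blast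
    also have "\<dots> = 3/4 * v x0 + 1/4 * v y"
      unfolding y(2) aff[OF x0T] aff[OF y(1)] by (simp add: inner_add_right field_simps)
    finally have "m / 2 \<le> \<bar>v z\<bar>" using x0(2) vm[OF y(1)] by linarith
    then show ?thesis using m0 by (metis abs_of_nonneg abs_le_square_iff divide_nonneg_nonneg zero_le_numeral)
  qed
  have intS: "(\<lambda>x. (v x)\<^sup>2) integrable_on S"
  proof -
    have "set_integrable lborel S (\<lambda>x. (v x)\<^sup>2)"
      unfolding set_integrable_def using borel_integrable_compact[OF cS continuous_on_subset[OF cont ST]] .
    then show ?thesis by (rule set_borel_integral_eq_integral(1))
  qed
  have "(m/2)\<^sup>2 * measure lebesgue S = integral S (\<lambda>_. (m/2)\<^sup>2)" by (simp add: integral_const_lmeasurable[OF lS])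
  also have "\<dots> \<le> integral S (\<lambda>x. (v x)\<^sup>2)" by (rule integral_le[OF integral_const_lmeasurable(1)[OF lS] intS low])
  also have "\<dots> \<le> integral T (\<lambda>x. (v x)\<^sup>2)" by (intro integral_subset_le ST intS int) auto
  finally have lower: "measure lebesgue T * m\<^sup>2 \<le> 4 ^ (DIM('a) + 1) * integral T (\<lambda>x. (v x)\<^sup>2)"
    unfolding mS by (simp add: field_simps power_one_over power2_eq_square)
  have "(\<Sum>x\<in>?X. (v x)\<^sup>2) \<le> (\<Sum>x\<in>?X. m\<^sup>2)"
    using vm2 by (intro sum_mono) (auto simp: extreme_point_of_def)
  also have "\<dots> = (real n + 1) * m\<^sup>2" using X(2) by (simp add: algebra_simps)
  finally have "measure lebesgue T * (\<Sum>x\<in>?X. (v x)\<^sup>2) \<le> measure lebesgue T * ((real n + 1) * m\<^sup>2)"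
    by (intro mult_left_mono) auto
  also have "\<dots> = (real n + 1) * (measure lebesgue T * m\<^sup>2)" by simp
  also have "\<dots> \<le> (real n + 1) * (4 ^ (DIM('a) + 1) * integral T (\<lambda>x. (v x)\<^sup>2))"
    using lower by (intro mult_left_mono) auto
  finally show "measure lebesgue T * (\<Sum>x\<in>?X. (v x)\<^sup>2) \<le> 4 ^ (DIM('a) + 1) * (real n + 1) * integral T (\<lambda>x. (v x)\<^sup>2)"
    by (simp add: mult_ac)
qed

lemma negligible_Int_full_simplices:
  fixes T :: "'a::euclidean_space set"
  assumes "triangulation \<T>" "T \<in> \<T>" "T' \<in> \<T>" "T \<noteq> T'" "int DIM('a) simplex T" "int DIM('a) simplex T'"
  shows "negligible (T \<inter> T')"
proof -
  note f = triangulation_Int_neq[OF assms]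
  have "aff_dim (T \<inter> T') < int DIM('a)"
    using face_of_aff_dim_lt[OF convex_simplex[OF assms(5)] f] assms(5) by (simp add: aff_dim_simplex)
  then have "interior (T \<inter> T') = {}" using aff_dim_nonempty_interior[of "T \<inter> T'"] by linarith
  then show ?thesis using f(1) negligible_convex_interior face_of_imp_convex by blast
qed

text \<open>Volume of a ball of radius \<open>c\<^sub>q\<close>, times the largest number of
  simplices that share a node.\<close>

definition mass_upper :: "'a::euclidean_space itself \<Rightarrow> real \<Rightarrow> real \<Rightarrow> real" where
  "mass_upper TYPE('a) c\<^sub>q \<sigma> = unit_ball_vol DIM('a) * c\<^sub>q ^ DIM('a) * (c\<^sub>q * c\<^sub>q * \<sigma>) ^ DIM('a)"

text \<open>Volume of the inscribed ball at \<open>h = 1\<close>, divided by the factor of the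
  vertex sum in \<open>affine_square_integral_bounds\<close>.\<close>

definition mass_lower :: "'a::euclidean_space itself \<Rightarrow> real \<Rightarrow> real \<Rightarrow> real" where
  "mass_lower TYPE('a) c\<^sub>q \<sigma> =
     unit_ball_vol DIM('a) / ((c\<^sub>q * \<sigma>) ^ DIM('a) * (4 ^ (DIM('a) + 1) * (real DIM('a) + 1)))"

text \<open>Collects the properties of a background mesh that pass to every subfamily, in particular
  to the active mesh; covering a domain is not among them.\<close>

locale quasi_uniform_mesh =
  fixes \<T> :: "'a::euclidean_space set set" and c\<^sub>q \<sigma> h :: real
  assumes tri: "triangulation \<T>"
    and sim: "\<And>T. T \<in> \<T> \<Longrightarrow> int DIM('a) simplex T"
    and diam_lower: "\<And>T. T \<in> \<T> \<Longrightarrow> h \<le> c\<^sub>q * diameter T"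
    and diam_upper: "\<And>T. T \<in> \<T> \<Longrightarrow> diameter T \<le> c\<^sub>q * h"
    and inball: "\<And>T. T \<in> \<T> \<Longrightarrow> \<exists>z r. cball z r \<subseteq> T \<and> diameter T \<le> \<sigma> * r"
    and h_pos: "0 < h" and cq_pos: "0 < c\<^sub>q" and \<sigma>_pos: "0 < \<sigma>"
begin

lemma finite_mesh: "finite \<T>" using tri by (simp add: triangulation_def)

lemma lmeasurable_T: "T \<in> \<T> \<Longrightarrow> T \<in> lmeasurable"
  using sim compact_simplex lmeasurable_compact by blast

lemma dist_le_in_T:
  assumes "T \<in> \<T>" "x \<in> T" "y \<in> T"
  shows "dist x y \<le> c\<^sub>q * h"
  using diameter_bounded_bound[of T x y] compact_imp_bounded[OF compact_simplex[OF sim]] diam_upper[OF assms(1)] assms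
  by fastforce

lemma measure_T_le:
  assumes "T \<in> \<T>"
  shows "measure lebesgue T \<le> unit_ball_vol DIM('a) * (c\<^sub>q * h) ^ DIM('a)"
proof -
  obtain x where x: "x \<in> T" using simplex_nonempty[OF sim[OF assms]] by auto
  have "measure lebesgue T \<le> measure lebesgue (cball x (c\<^sub>q * h))"
    using dist_le_in_T[OF assms x] lmeasurable_T[OF assms] by (intro measure_mono_fmeasurable) (auto simp: fmeasurableD)
  also have "\<dots> = unit_ball_vol DIM('a) * (c\<^sub>q * h) ^ DIM('a)" using h_pos cq_pos by (simp add: content_cball)
  finally show ?thesis .
qed

lemma measure_T_ge:
  assumes "T \<in> \<T>"
  shows "unit_ball_vol DIM('a) * (h / (c\<^sub>q * \<sigma>)) ^ DIM('a) \<le> measure lebesgue T"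
proof -
  obtain z r where zr: "cball z r \<subseteq> T" "diameter T \<le> \<sigma> * r" using inball[OF assms] by blast
  have "h \<le> c\<^sub>q * (\<sigma> * r)" using diam_lower[OF assms] zr(2) cq_pos by (meson mult_left_mono less_imp_le order_trans)
  then have r: "h / (c\<^sub>q * \<sigma>) \<le> r" using cq_pos \<sigma>_pos by (simp add: pos_divide_le_eq mult_ac)
  have p: "0 < h / (c\<^sub>q * \<sigma>)" using h_pos cq_pos \<sigma>_pos by simp
  have "unit_ball_vol DIM('a) * (h / (c\<^sub>q * \<sigma>)) ^ DIM('a) \<le> unit_ball_vol DIM('a) * r ^ DIM('a)"
    using r p by (intro mult_left_mono power_mono) auto
  also have "\<dots> = measure lebesgue (cball z r)" using r p by (simp add: content_cball)
  also have "\<dots> \<le> measure lebesgue T"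
    using zr(1) lmeasurable_T[OF assms] by (intro measure_mono_fmeasurable) auto
  finally show ?thesis .
qed

text \<open>Comparison of volumes: the simplices overlap in null sets, each contains a ball of
  radius \<open>h / (c\<^sub>q * \<sigma>)\<close>, and all lie in a ball of radius
  \<open>R\<close>.\<close>

lemma packing:
  assumes S: "\<S> \<subseteq> \<T>" "\<And>T. T \<in> \<S> \<Longrightarrow> T \<subseteq> cball x R" and R: "0 \<le> R"
  shows "card \<S> \<le> (R * c\<^sub>q * \<sigma> / h) ^ DIM('a)"
proof -
  let ?b = "unit_ball_vol DIM('a)" let ?e = "h / (c\<^sub>q * \<sigma>)"
  have p: "0 < ?b * ?e ^ DIM('a)" using h_pos cq_pos \<sigma>_pos by simp
  have fS: "finite \<S>" using S(1) finite_mesh finite_subset by blast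
  have "card \<S> * (?b * ?e ^ DIM('a)) = (\<Sum>T\<in>\<S>. ?b * ?e ^ DIM('a))" by simp
  also have "\<dots> \<le> (\<Sum>T\<in>\<S>. measure lebesgue T)" using S(1) by (intro sum_mono measure_T_ge) auto
  also have "\<dots> = measure lebesgue (\<Union>\<S>)"
    using fS S(1) lmeasurable_T negligible_Int_full_simplices[OF tri] sim
    by (intro measure_negligible_finite_Union[symmetric]) (auto simp: pairwise_def subset_iff)
  also have "\<dots> \<le> measure lebesgue (cball x R)"
    using S fS lmeasurable_T by (intro measure_mono_fmeasurable) (auto intro!: sets.finite_Union simp: fmeasurableD)
  also have "\<dots> = ?b * R ^ DIM('a)" using R by (simp add: content_cball)
  finally have "?b * (card \<S> * ?e ^ DIM('a)) \<le> ?b * R ^ DIM('a)" by (simp add: mult_ac)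
  then have "card \<S> * ?e ^ DIM('a) \<le> R ^ DIM('a)" by (rule mult_left_le_imp_le) simp
  then show ?thesis using h_pos cq_pos \<sigma>_pos by (simp add: field_simps power_divide power_mult_distrib)
qed

lemma mesh_nodes_eq: "mesh_nodes \<T> = (\<Union>T\<in>\<T>. {x. x extreme_point_of T})"
  by (auto simp: mesh_nodes_def)

lemma finite_mesh_nodes: "finite (mesh_nodes \<T>)"
  unfolding mesh_nodes_eq using finite_mesh finite_extreme_points_simplex(1)[OF sim] by blast

text \<open>A simplex with a vertex in the ball lies in the ball enlarged by one mesh diameter,
  where \<open>packing\<close> counts the simplices.\<close>

lemma card_nodes_in_cball:
  assumes R: "0 \<le> R"
  shows "card {z \<in> mesh_nodes \<T>. dist x z \<le> R} \<le> (real DIM('a) + 1) * ((R + c\<^sub>q * h) * c\<^sub>q * \<sigma> / h) ^ DIM('a)"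
proof -
  let ?S = "{T\<in>\<T>. T \<subseteq> cball x (R + c\<^sub>q * h)}"
  have fS: "finite ?S" using finite_mesh by simp
  have "{z \<in> mesh_nodes \<T>. dist x z \<le> R} \<subseteq> (\<Union>T\<in>?S. {x. x extreme_point_of T})"
  proof
    fix z assume z: "z \<in> {z \<in> mesh_nodes \<T>. dist x z \<le> R}"
    then obtain T where T: "T \<in> \<T>" "z extreme_point_of T" by (auto simp: mesh_nodes_def)
    have "T \<subseteq> cball x (R + c\<^sub>q * h)"
    proof
      fix y assume "y \<in> T"
      then have "dist z y \<le> c\<^sub>q * h" using T by (intro dist_le_in_T[OF T(1)]) (auto simp: extreme_point_of_def)
      then show "y \<in> cball x (R + c\<^sub>q * h)" using z dist_triangle[of x y z] by auto
    qed
    then show "z \<in> (\<Union>T\<in>?S. {x. x extreme_point_of T})" using T by blast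
  qed
  then have "card {z \<in> mesh_nodes \<T>. dist x z \<le> R} \<le> card (\<Union>T\<in>?S. {x. x extreme_point_of T})"
    using fS finite_extreme_points_simplex(1)[OF sim] by (intro card_mono) auto
  also have "\<dots> \<le> (\<Sum>T\<in>?S. card {x. x extreme_point_of T})" using fS by (rule card_UN_le)
  also have "\<dots> = (\<Sum>T\<in>?S. DIM('a) + 1)"
    by (intro sum.cong refl finite_extreme_points_simplex(2)) (auto simp: sim)
  also have "\<dots> = card ?S * (DIM('a) + 1)" by simp
  finally have "real (card {z \<in> mesh_nodes \<T>. dist x z \<le> R}) \<le> real (card ?S * (DIM('a) + 1))"
    by (simp only: of_nat_le_iff)
  also have "\<dots> = real (card ?S) * (real DIM('a) + 1)"
    by (simp only: of_nat_mult of_nat_add of_nat_1)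
  also have "real (card ?S) \<le> ((R + c\<^sub>q * h) * c\<^sub>q * \<sigma> / h) ^ DIM('a)"
    using R h_pos cq_pos by (intro packing) auto
  finally show ?thesis by (simp add: mult_ac)
qed

lemma P1_affine:
  assumes "v \<in> P1_space \<T>" "T \<in> \<T>"
  obtains g b where "\<And>x. x \<in> T \<Longrightarrow> v x = inner g x + b"
  using assms unfolding P1_space_def by blast

lemma L2_norm_mesh_sq:
  assumes v: "v \<in> P1_space \<T>"
  shows "(L2_norm_mesh \<T> v)\<^sup>2 = (\<Sum>T\<in>\<T>. integral T (\<lambda>x. (v x)\<^sup>2))"
proof -
  let ?U = "\<Union>\<T>"
  have cU: "compact ?U" using finite_mesh sim compact_simplex by (intro compact_Union) auto
  have "continuous_on ?U (\<lambda>x. (v x)\<^sup>2)" using v by (auto simp: P1_space_def intro!: continuous_intros)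
  from borel_integrable_compact[OF cU this]
  have si: "set_integrable lborel ?U (\<lambda>x. (v x)\<^sup>2)" unfolding set_integrable_def .
  have "((\<lambda>x. (v x)\<^sup>2) has_integral (\<Sum>T\<in>\<T>. integral T (\<lambda>x. (v x)\<^sup>2))) ?U"
  proof (rule has_integral_Union[OF finite_mesh])
    fix T assume T: "T \<in> \<T>"
    obtain g b where "\<And>x. x \<in> T \<Longrightarrow> v x = inner g x + b" using P1_affine[OF v T] by blast
    then show "((\<lambda>x. (v x)\<^sup>2) has_integral integral T (\<lambda>x. (v x)\<^sup>2)) T"
      using affine_square_integral_bounds(1)[OF sim[OF T]] by (intro integrable_integral) blast
  next
    show "pairwise (\<lambda>S S'. negligible (S \<inter> S')) \<T>"
      using negligible_Int_full_simplices[OF tri] sim by (auto simp: pairwise_def)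
  qed
  then have eq: "(LINT x : ?U | lborel. (v x)\<^sup>2) = (\<Sum>T\<in>\<T>. integral T (\<lambda>x. (v x)\<^sup>2))"
    using set_borel_integral_eq_integral(2)[OF si] by (simp add: integral_unique)
  have "0 \<le> (LINT x : ?U | lborel. (v x)\<^sup>2)"
    unfolding set_lebesgue_integral_def by (intro Bochner_Integration.integral_nonneg) (simp add: indicator_def)
  then show ?thesis unfolding L2_norm_mesh_def using eq by simp
qed

text \<open>Double counting: a node occurs once for each simplex at it, so at least once, and by
  \<open>packing\<close> in a ball of radius \<open>c\<^sub>q * h\<close> only boundedly
  often.\<close>

lemma sum_vertices_le_nodes:
  fixes w :: "'a \<Rightarrow> real"
  assumes w: "\<And>x. 0 \<le> w x"
  shows "(\<Sum>T\<in>\<T>. \<Sum>x\<in>{x. x extreme_point_of T}. w x) \<le> (c\<^sub>q * c\<^sub>q * \<sigma>) ^ DIM('a) * (\<Sum>x\<in>mesh_nodes \<T>. w x)"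
    and "(\<Sum>x\<in>mesh_nodes \<T>. w x) \<le> (\<Sum>T\<in>\<T>. \<Sum>x\<in>{x. x extreme_point_of T}. w x)"
proof -
  have "(\<Sum>T\<in>\<T>. \<Sum>x\<in>{x. x extreme_point_of T}. w x) = (\<Sum>T\<in>\<T>. \<Sum>x\<in>{x\<in>mesh_nodes \<T>. x extreme_point_of T}. w x)"
    by (intro sum.cong refl) (auto simp: mesh_nodes_def)
  also have "\<dots> = (\<Sum>x\<in>mesh_nodes \<T>. \<Sum>T\<in>{T\<in>\<T>. x extreme_point_of T}. w x)"
    using finite_mesh finite_mesh_nodes by (rule sum.swap_restrict)
  also have "\<dots> = (\<Sum>x\<in>mesh_nodes \<T>. card {T\<in>\<T>. x extreme_point_of T} * w x)" by simp
  finally have eq: "(\<Sum>T\<in>\<T>. \<Sum>x\<in>{x. x extreme_point_of T}. w x) = (\<Sum>x\<in>mesh_nodes \<T>. card {T\<in>\<T>. x extreme_point_of T} * w x)" .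
  have "card {T\<in>\<T>. x extreme_point_of T} \<le> (c\<^sub>q * c\<^sub>q * \<sigma>) ^ DIM('a)" for x
  proof -
    have "card {T\<in>\<T>. x extreme_point_of T} \<le> (c\<^sub>q * h * c\<^sub>q * \<sigma> / h) ^ DIM('a)"
    proof (rule packing[where x=x])
      fix T assume "T \<in> {T\<in>\<T>. x extreme_point_of T}"
      then show "T \<subseteq> cball x (c\<^sub>q * h)" using dist_le_in_T[of T x] by (auto simp: extreme_point_of_def)
    qed (use h_pos cq_pos in auto)
    then show ?thesis using h_pos by (simp add: field_simps)
  qed
  then show "(\<Sum>T\<in>\<T>. \<Sum>x\<in>{x. x extreme_point_of T}. w x) \<le> (c\<^sub>q * c\<^sub>q * \<sigma>) ^ DIM('a) * (\<Sum>x\<in>mesh_nodes \<T>. w x)"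
    unfolding eq sum_distrib_left using w by (intro sum_mono mult_right_mono) auto
  have "1 * w x \<le> card {T\<in>\<T>. x extreme_point_of T} * w x" if x: "x \<in> mesh_nodes \<T>" for x
  proof -
    have "{T\<in>\<T>. x extreme_point_of T} \<noteq> {}" using x by (auto simp: mesh_nodes_def)
    then have "1 \<le> card {T\<in>\<T>. x extreme_point_of T}" using finite_mesh by (simp add: Suc_le_eq card_gt_0_iff)
    then show ?thesis using w by (intro mult_right_mono) auto
  qed
  then show "(\<Sum>x\<in>mesh_nodes \<T>. w x) \<le> (\<Sum>T\<in>\<T>. \<Sum>x\<in>{x. x extreme_point_of T}. w x)"
    unfolding eq by (intro sum_mono) simp
qed

proposition mass_matrix_upper:
  assumes v: "v \<in> P1_space \<T>"
  shows "(L2_norm_mesh \<T> v)\<^sup>2 \<le> mass_upper TYPE('a) c\<^sub>q \<sigma> * h ^ DIM('a) * (\<Sum>x\<in>mesh_nodes \<T>. (v x)\<^sup>2)"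
proof -
  let ?m = "unit_ball_vol DIM('a) * (c\<^sub>q * h) ^ DIM('a)"
  have m0: "0 \<le> ?m" using h_pos cq_pos by simp
  have "(L2_norm_mesh \<T> v)\<^sup>2 \<le> (\<Sum>T\<in>\<T>. ?m * (\<Sum>x\<in>{x. x extreme_point_of T}. (v x)\<^sup>2))"
    unfolding L2_norm_mesh_sq[OF v]
  proof (rule sum_mono)
    fix T assume T: "T \<in> \<T>"
    obtain g b where gb: "\<And>x. x \<in> T \<Longrightarrow> v x = inner g x + b" using P1_affine[OF v T] by blast
    have "integral T (\<lambda>x. (v x)\<^sup>2) \<le> measure lebesgue T * (\<Sum>x\<in>{x. x extreme_point_of T}. (v x)\<^sup>2)"
      by (rule affine_square_integral_bounds(2)[OF sim[OF T] gb])
    also have "\<dots> \<le> ?m * (\<Sum>x\<in>{x. x extreme_point_of T}. (v x)\<^sup>2)"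
      by (intro mult_right_mono measure_T_le T sum_nonneg) auto
    finally show "integral T (\<lambda>x. (v x)\<^sup>2) \<le> ?m * (\<Sum>x\<in>{x. x extreme_point_of T}. (v x)\<^sup>2)" .
  qed
  also have "\<dots> = ?m * (\<Sum>T\<in>\<T>. \<Sum>x\<in>{x. x extreme_point_of T}. (v x)\<^sup>2)" by (simp add: sum_distrib_left)
  also have "\<dots> \<le> ?m * ((c\<^sub>q * c\<^sub>q * \<sigma>) ^ DIM('a) * (\<Sum>x\<in>mesh_nodes \<T>. (v x)\<^sup>2))"
    by (intro mult_left_mono m0 sum_vertices_le_nodes(1)) auto
  finally show ?thesis by (simp add: mass_upper_def power_mult_distrib mult_ac)
qed

proposition mass_matrix_lower:
  assumes v: "v \<in> P1_space \<T>"
  shows "mass_lower TYPE('a) c\<^sub>q \<sigma> * h ^ DIM('a) * (\<Sum>x\<in>mesh_nodes \<T>. (v x)\<^sup>2) \<le> (L2_norm_mesh \<T> v)\<^sup>2"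
proof -
  let ?m = "unit_ball_vol DIM('a) * (h / (c\<^sub>q * \<sigma>)) ^ DIM('a)" and ?f = "4 ^ (DIM('a) + 1) * (real DIM('a) + 1)"
  have m0: "0 \<le> ?m" using h_pos cq_pos \<sigma>_pos by simp
  have f0: "0 < ?f" by (intro mult_pos_pos) auto
  have "?m * (\<Sum>x\<in>mesh_nodes \<T>. (v x)\<^sup>2) \<le> ?m * (\<Sum>T\<in>\<T>. \<Sum>x\<in>{x. x extreme_point_of T}. (v x)\<^sup>2)"
    by (intro mult_left_mono m0 sum_vertices_le_nodes(2)) auto
  also have "\<dots> = (\<Sum>T\<in>\<T>. ?m * (\<Sum>x\<in>{x. x extreme_point_of T}. (v x)\<^sup>2))" by (simp add: sum_distrib_left)
  also have "\<dots> \<le> (\<Sum>T\<in>\<T>. ?f * integral T (\<lambda>x. (v x)\<^sup>2))"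
  proof (rule sum_mono)
    fix T assume T: "T \<in> \<T>"
    obtain g b where gb: "\<And>x. x \<in> T \<Longrightarrow> v x = inner g x + b" using P1_affine[OF v T] by blast
    have "?m * (\<Sum>x\<in>{x. x extreme_point_of T}. (v x)\<^sup>2) \<le> measure lebesgue T * (\<Sum>x\<in>{x. x extreme_point_of T}. (v x)\<^sup>2)"
      by (intro mult_right_mono measure_T_ge T sum_nonneg) auto
    also have "\<dots> \<le> ?f * integral T (\<lambda>x. (v x)\<^sup>2)"
      using affine_square_integral_bounds(3)[OF sim[OF T] gb] by simp
    finally show "?m * (\<Sum>x\<in>{x. x extreme_point_of T}. (v x)\<^sup>2) \<le> ?f * integral T (\<lambda>x. (v x)\<^sup>2)" .
  qed
  also have "\<dots> = ?f * (L2_norm_mesh \<T> v)\<^sup>2" by (simp add: L2_norm_mesh_sq[OF v] sum_distrib_left)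
  finally have "?m * (\<Sum>x\<in>mesh_nodes \<T>. (v x)\<^sup>2) / ?f \<le> (L2_norm_mesh \<T> v)\<^sup>2"
    using f0 by (simp only: pos_divide_le_eq mult.commute)
  moreover have "mass_lower TYPE('a) c\<^sub>q \<sigma> * h ^ DIM('a) * (\<Sum>x\<in>mesh_nodes \<T>. (v x)\<^sup>2) = ?m * (\<Sum>x\<in>mesh_nodes \<T>. (v x)\<^sup>2) / ?f"
    by (simp add: mass_lower_def power_divide)
  ultimately show ?thesis by simp
qed

end

section \<open>The mean value functional on a cut mesh\<close>

lemma P1_space_add:
  assumes "v \<in> P1_space \<T>" "w \<in> P1_space \<T>"
  shows "(\<lambda>x. v x + w x) \<in> P1_space \<T>"
proof -
  have "\<exists>g b. \<forall>x\<in>T. v x + w x = inner g x + b" if "T \<in> \<T>" for T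
  proof -
    obtain g1 b1 where "\<forall>x\<in>T. v x = inner g1 x + b1"
      using assms(1) \<open>T \<in> \<T>\<close> unfolding P1_space_def by blast
    moreover obtain g2 b2 where "\<forall>x\<in>T. w x = inner g2 x + b2"
      using assms(2) \<open>T \<in> \<T>\<close> unfolding P1_space_def by blast
    ultimately show ?thesis by (intro exI[of _ "g1 + g2"] exI[of _ "b1 + b2"]) (simp add: inner_add_left)
  qed
  then show ?thesis using assms unfolding P1_space_def by (auto intro: continuous_on_add)
qed

lemma P1_space_cmult:
  assumes "v \<in> P1_space \<T>"
  shows "(\<lambda>x. r * v x) \<in> P1_space \<T>"
proof -
  have "\<exists>g b. \<forall>x\<in>T. r * v x = inner g x + b" if "T \<in> \<T>" for T
  proof -
    obtain g1 b1 where "\<forall>x\<in>T. v x = inner g1 x + b1"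
      using assms \<open>T \<in> \<T>\<close> unfolding P1_space_def by blast
    then show ?thesis by (intro exI[of _ "r *\<^sub>R g1"] exI[of _ "r * b1"]) (simp add: distrib_left)
  qed
  then show ?thesis using assms unfolding P1_space_def by (auto intro: continuous_on_mult_left)
qed

lemma P1_space_zero: "(\<lambda>_. 0) \<in> P1_space \<T>"
proof -
  have "\<exists>g b. \<forall>x\<in>T. (0::real) = inner g x + b" for T :: "'a::euclidean_space set"
    by (intro exI[of _ 0]) simp
  then show ?thesis by (auto simp: P1_space_def)
qed

lemma P1_space_sum:
  assumes "\<And>i. i < (N::nat) \<Longrightarrow> \<phi> i \<in> P1_space \<T>"
  shows "(\<lambda>y. \<Sum>i<N. V i * \<phi> i y) \<in> P1_space \<T>"
  using assms
proof (induction N)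
  case 0
  then show ?case by (simp add: P1_space_zero)
next
  case (Suc N)
  have "(\<lambda>y. (\<Sum>i<N. V i * \<phi> i y) + V N * \<phi> N y) \<in> P1_space \<T>"
    using Suc by (intro P1_space_add P1_space_cmult) auto
  then show ?case by simp
qed

lemma P1_space_indicator: "indicat_real (\<Union>\<T>) \<in> P1_space \<T>"
proof -
  have "continuous_on (\<Union>\<T>) (indicat_real (\<Union>\<T>))"
    by (rule continuous_on_eq[of _ "\<lambda>_. 1"]) auto
  moreover have "\<exists>g b. \<forall>x\<in>T. indicat_real (\<Union>\<T>) x = inner g x + b" if "T \<in> \<T>" for T
    using that by (intro exI[of _ 0] exI[of _ 1]) (auto simp: indicator_def)
  ultimately show ?thesis by (auto simp: P1_space_def)
qed

context quasi_uniform_mesh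
begin

lemma P1_abs_le:
  assumes v: "v \<in> P1_space \<T>" and T: "T \<in> \<T>" and le: "\<And>z. z extreme_point_of T \<Longrightarrow> \<bar>v z\<bar> \<le> m" and y: "y \<in> T"
  shows "\<bar>v y\<bar> \<le> m"
proof -
  obtain g b where "\<And>x. x \<in> T \<Longrightarrow> v x = inner g x + b" using P1_affine[OF v T] by blast
  then show ?thesis using le y by (rule affine_abs_le_on_simplex[OF sim[OF T]])
qed

text \<open>On the mesh, \<open>P1_abs_le\<close> with bound 0 applies to the difference; off the
  mesh both functions vanish by convention.\<close>

lemma P1_eqI:
  assumes v: "v \<in> P1_space \<T>" and w: "w \<in> P1_space \<T>" and eq: "\<And>z. z \<in> mesh_nodes \<T> \<Longrightarrow> v z = w z"
  shows "v = w"
proof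
  fix y
  show "v y = w y"
  proof (cases "y \<in> \<Union>\<T>")
    case True
    then obtain T where T: "T \<in> \<T>" "y \<in> T" by blast
    have d: "(\<lambda>x. v x + (-1) * w x) \<in> P1_space \<T>" using v w by (intro P1_space_add P1_space_cmult)
    have "v z = w z" if "z extreme_point_of T" for z using that T(1) by (intro eq) (auto simp: mesh_nodes_def)
    then have "\<bar>v y + (-1) * w y\<bar> \<le> 0"
      by (intro P1_abs_le[OF d T(1) _ T(2)]) simp
    then show ?thesis by simp
  next
    case False
    then show ?thesis using v w by (simp add: P1_space_def)
  qed
qed

end

section \<open>Coefficient vectors and the nodal basis\<close>

locale nodal_mesh = quasi_uniform_mesh \<T> c\<^sub>q \<sigma> h
  for \<T> :: "'a::euclidean_space set set" and c\<^sub>q \<sigma> h :: real +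
  fixes N :: nat and x :: "nat \<Rightarrow> 'a" and \<phi> :: "nat \<Rightarrow> 'a \<Rightarrow> real"
  assumes nodal: "nodal_basis \<T> N x \<phi>"
begin

definition fe :: "(nat \<Rightarrow> real) \<Rightarrow> 'a \<Rightarrow> real" where
  "fe V = (\<lambda>y. \<Sum>i<N. V i * \<phi> i y)"

lemma node_bij: "bij_betw x {..<N} (mesh_nodes \<T>)"
  using nodal by (simp add: nodal_basis_def)

lemma \<phi>_P1: "i < N \<Longrightarrow> \<phi> i \<in> P1_space \<T>"
  using nodal by (simp add: nodal_basis_def)

lemma \<phi>_node: "i < N \<Longrightarrow> j < N \<Longrightarrow> \<phi> i (x j) = (if i = j then 1 else 0)"
  using nodal by (simp add: nodal_basis_def)

lemma fe_P1: "fe V \<in> P1_space \<T>"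
  unfolding fe_def by (rule P1_space_sum) (rule \<phi>_P1)

lemma fe_node: "j < N \<Longrightarrow> fe V (x j) = V j"
  by (simp add: fe_def \<phi>_node if_distrib cong: if_cong)

lemma node_in: "i < N \<Longrightarrow> x i \<in> mesh_nodes \<T>"
  using node_bij by (auto simp: bij_betw_def)

lemma node_cases: "z \<in> mesh_nodes \<T> \<Longrightarrow> \<exists>i<N. z = x i"
  using node_bij by (auto simp: bij_betw_def image_iff)

text \<open>Identifies the constants annihilated by the form with the span of the vector of
  ones.\<close>

lemma fe_ones: "fe (\<lambda>_. 1) = indicat_real (\<Union>\<T>)"
proof (rule P1_eqI[OF fe_P1 P1_space_indicator])
  fix z assume z: "z \<in> mesh_nodes \<T>"
  then obtain i where i: "i < N" "z = x i" using node_cases by blast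
  obtain T where "T \<in> \<T>" "z extreme_point_of T" using z by (auto simp: mesh_nodes_def)
  then have "z \<in> \<Union>\<T>" by (auto simp: extreme_point_of_def)
  then show "fe (\<lambda>_. 1) z = indicat_real (\<Union>\<T>) z" using i by (simp add: fe_node)
qed

lemma sum_nodes: "(\<Sum>z\<in>mesh_nodes \<T>. w z) = (\<Sum>i<N. w (x i))"
  using sum.reindex_bij_betw[OF node_bij, of w] by simp

lemma fe_L2_bounds:
  shows "(L2_norm_mesh \<T> (fe V))\<^sup>2 \<le> mass_upper TYPE('a) c\<^sub>q \<sigma> * h ^ DIM('a) * (\<Sum>i<N. (V i)\<^sup>2)"
    and "mass_lower TYPE('a) c\<^sub>q \<sigma> * h ^ DIM('a) * (\<Sum>i<N. (V i)\<^sup>2) \<le> (L2_norm_mesh \<T> (fe V))\<^sup>2"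
  using mass_matrix_upper[OF fe_P1, of V] mass_matrix_lower[OF fe_P1, of V]
  by (simp_all add: sum_nodes fe_node)

lemma \<phi>_abs_le_1:
  assumes i: "i < N"
  shows "\<bar>\<phi> i y\<bar> \<le> 1"
proof (cases "y \<in> \<Union>\<T>")
  case True
  then obtain T where T: "T \<in> \<T>" "y \<in> T" by blast
  show ?thesis
  proof (rule P1_abs_le[OF \<phi>_P1[OF i] T(1) _ T(2)])
    fix z assume "z extreme_point_of T"
    then obtain j where "j < N" "z = x j" using T(1) node_cases by (auto simp: mesh_nodes_def)
    then show "\<bar>\<phi> i z\<bar> \<le> 1" using i by (simp add: \<phi>_node)
  qed
next
  case False
  then show ?thesis using \<phi>_P1[OF i] by (simp add: P1_space_def)
qed

text \<open>A simplex containing a far point \<open>y\<close> cannot have \<open>x i\<close> as a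
  vertex, so the basis function vanishes at all its vertices.\<close>

lemma \<phi>_support:
  assumes i: "i < N" and y: "y \<notin> cball (x i) (c\<^sub>q * h)"
  shows "\<phi> i y = 0"
proof (cases "y \<in> \<Union>\<T>")
  case True
  then obtain T where T: "T \<in> \<T>" "y \<in> T" by blast
  have "\<bar>\<phi> i y\<bar> \<le> 0"
  proof (rule P1_abs_le[OF \<phi>_P1[OF i] T(1) _ T(2)])
    fix z assume z: "z extreme_point_of T"
    then obtain j where j: "j < N" "z = x j" using T(1) node_cases by (auto simp: mesh_nodes_def)
    have "dist z y \<le> c\<^sub>q * h" using z T by (intro dist_le_in_T[OF T(1)]) (auto simp: extreme_point_of_def)
    then have "i \<noteq> j" using y j by auto
    then show "\<bar>\<phi> i z\<bar> \<le> 0" using i j by (simp add: \<phi>_node)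
  qed
  then show ?thesis by simp
next
  case False
  then show ?thesis using \<phi>_P1[OF i] by (simp add: P1_space_def)
qed

text \<open>With two nodes the span of the vector of ones is a proper subspace, and the suprema in
  the condition number run over nonempty sets.\<close>

lemma card_nodes: "\<T> \<noteq> {} \<Longrightarrow> 2 \<le> N"
proof -
  assume "\<T> \<noteq> {}"
  then obtain T where T: "T \<in> \<T>" by blast
  have "DIM('a) + 1 = card {z. z extreme_point_of T}" using finite_extreme_points_simplex(2)[OF sim[OF T]] by simp
  also have "\<dots> \<le> card (mesh_nodes \<T>)"
    using T finite_mesh_nodes by (intro card_mono) (auto simp: mesh_nodes_def)
  also have "\<dots> = N" using bij_betw_same_card[OF node_bij] by simp
  finally show "2 \<le> N" using DIM_positive[where 'a='a] by linarith
qed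

end

section \<open>Surface integrals of finite element functions\<close>

lemma
  fixes K :: "'a::euclidean_space set" and v :: "'a \<Rightarrow> real"
  assumes K: "int DIM('d::euclidean_space) simplex K" and v: "continuous_on K v"
  shows integrable_on_flat_param: "(\<lambda>u. v (flat_param K u)) integrable_on ((flat_param K :: 'd \<Rightarrow> 'a) -` K)"
    and simplex_integral_eq: "simplex_integral TYPE('d) K v = integral ((flat_param K :: 'd \<Rightarrow> 'a) -` K) (\<lambda>u. v (flat_param K u))"
proof -
  let ?F = "flat_param K :: 'd \<Rightarrow> 'a"
  have c: "compact (?F -` K)" using compact_simplex[OF K] by (rule compact_vimage_flat_param[OF K])
  have "continuous_on (?F -` K) (\<lambda>u. v (?F u))"
    by (rule continuous_on_compose2[OF v continuous_on_flat_param[OF K]]) auto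
  from borel_integrable_compact[OF c this]
  have si: "set_integrable lborel (?F -` K) (\<lambda>u. v (?F u))" unfolding set_integrable_def .
  show "(\<lambda>u. v (?F u)) integrable_on (?F -` K)" using set_borel_integral_eq_integral(1)[OF si] .
  show "simplex_integral TYPE('d) K v = integral (?F -` K) (\<lambda>u. v (?F u))"
    unfolding simplex_integral_def Let_def using set_borel_integral_eq_integral(2)[OF si] .
qed

lemma abs_simplex_integral_le:
  fixes K :: "'a::euclidean_space set" and v :: "'a \<Rightarrow> real"
  assumes K: "int DIM('d::euclidean_space) simplex K" and v: "continuous_on K v"
    and S: "closed S" and le: "\<And>y. \<bar>v y\<bar> \<le> 1" and supp: "\<And>y. y \<notin> S \<Longrightarrow> v y = 0"
  shows "\<bar>simplex_integral TYPE('d) K v\<bar> \<le> simplex_area TYPE('d) K S"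
proof -
  let ?F = "flat_param K :: 'd \<Rightarrow> 'a"
  have c: "compact (?F -` (K \<inter> S))"
    using compact_simplex[OF K] S by (intro compact_vimage_flat_param[OF K]) (simp add: compact_Int_closed)
  have eq: "?F -` (K \<inter> S) \<inter> ?F -` K = ?F -` (K \<inter> S)" by auto
  have lm: "?F -` (K \<inter> S) \<inter> ?F -` K \<in> lmeasurable"
    unfolding eq by (rule lmeasurable_compact[OF c])
  have "norm (integral (?F -` K) (\<lambda>u. v (?F u))) \<le> integral (?F -` K) (indicat_real (?F -` (K \<inter> S)))"
  proof (rule integral_norm_bound_integral)
    show "(\<lambda>u. v (?F u)) integrable_on (?F -` K)" by (rule integrable_on_flat_param[OF K v])
    show "indicat_real (?F -` (K \<inter> S)) integrable_on (?F -` K)" using lm by (simp add: integrable_on_indicator)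
    show "norm (v (?F u)) \<le> indicat_real (?F -` (K \<inter> S)) u" if "u \<in> ?F -` K" for u
      using le[of "?F u"] supp[of "?F u"] that by (auto simp: indicator_def)
  qed
  also have "\<dots> = simplex_area TYPE('d) K S"
    using integral_indicator[OF lm] unfolding eq simplex_area_def .
  finally show ?thesis unfolding simplex_integral_eq[OF K v] by simp
qed

abbreviation surface_area :: "'d::euclidean_space itself \<Rightarrow> 'a::euclidean_space set set \<Rightarrow> 'a set \<Rightarrow> real" where
  "surface_area t \<K> S \<equiv> (\<Sum>K\<in>\<K>. simplex_area t K S)"

locale cut_mesh = nodal_mesh \<T> c\<^sub>q \<sigma> h N x \<phi>
  for \<T> :: "'a::euclidean_space set set" and c\<^sub>q \<sigma> h :: real and N x \<phi> +
  fixes \<K> :: "'a set set" and dty :: "'d::euclidean_space itself"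
  assumes finK: "finite \<K>" and simK: "\<And>K. K \<in> \<K> \<Longrightarrow> int DIM('d) simplex K"
    and K_subset: "\<Union>\<K> \<subseteq> \<Union>\<T>"
begin

lemma P1_continuous_on_K: "v \<in> P1_space \<T> \<Longrightarrow> K \<in> \<K> \<Longrightarrow> continuous_on K v"
  using K_subset by (auto simp: P1_space_def elim!: continuous_on_subset)

lemma surface_integral_fe: "surface_integral TYPE('d) \<K> (fe V) = (\<Sum>i<N. V i * surface_integral TYPE('d) \<K> (\<phi> i))"
proof -
  have "simplex_integral TYPE('d) K (fe V) = (\<Sum>i<N. V i * simplex_integral TYPE('d) K (\<phi> i))" if K: "K \<in> \<K>" for K
  proof -
    let ?F = "flat_param K :: 'd \<Rightarrow> 'a"
    have "simplex_integral TYPE('d) K (fe V) = integral (?F -` K) (\<lambda>u. fe V (?F u))"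
      by (rule simplex_integral_eq[OF simK[OF K] P1_continuous_on_K[OF fe_P1 K]])
    also have "\<dots> = integral (?F -` K) (\<lambda>u. \<Sum>i<N. V i * \<phi> i (?F u))" by (simp add: fe_def)
    also have "\<dots> = (\<Sum>i<N. integral (?F -` K) (\<lambda>u. V i * \<phi> i (?F u)))"
      using integrable_on_flat_param[OF simK[OF K] P1_continuous_on_K[OF \<phi>_P1 K]]
      by (intro integral_sum integrable_on_mult_right) auto
    also have "\<dots> = (\<Sum>i<N. V i * simplex_integral TYPE('d) K (\<phi> i))"
      by (intro sum.cong refl) (simp add: simplex_integral_eq[OF simK[OF K] P1_continuous_on_K[OF \<phi>_P1 K]])
    finally show ?thesis .
  qed
  then show ?thesis unfolding surface_integral_def
    by (simp add: sum_distrib_left) (rule sum.swap)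
qed

lemma surface_integral_one: "surface_integral TYPE('d) \<K> (\<lambda>_. 1) = surface_area TYPE('d) \<K> UNIV"
proof -
  have "simplex_integral TYPE('d) K (\<lambda>_. 1) = simplex_area TYPE('d) K UNIV" if K: "K \<in> \<K>" for K
    using compact_vimage_flat_param[OF simK[OF K] compact_simplex[OF simK[OF K]]]
    by (simp add: simplex_integral_eq[OF simK[OF K]] simplex_area_def integral_const_lmeasurable(2)[OF lmeasurable_compact])
  then show ?thesis by (simp add: surface_integral_def)
qed

lemma surface_integral_indicator: "surface_integral TYPE('d) \<K> (fe (\<lambda>_. 1)) = surface_area TYPE('d) \<K> UNIV"
proof -
  have "simplex_integral TYPE('d) K (fe (\<lambda>_. 1)) = simplex_integral TYPE('d) K (\<lambda>_. 1)" if K: "K \<in> \<K>" for K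
  proof -
    have "integral ((flat_param K :: 'd \<Rightarrow> 'a) -` K) (\<lambda>u. fe (\<lambda>_. 1) (flat_param K u)) = integral ((flat_param K :: 'd \<Rightarrow> 'a) -` K) (\<lambda>u. 1)"
    proof (rule integral_cong)
      fix u assume "u \<in> (flat_param K :: 'd \<Rightarrow> 'a) -` K"
      then have "(flat_param K :: 'd \<Rightarrow> 'a) u \<in> \<Union>\<T>" using K K_subset by blast
      then show "fe (\<lambda>_. 1) (flat_param K u :: 'a) = 1" by (simp add: fe_ones)
    qed
    then show ?thesis
      by (simp add: simplex_integral_eq[OF simK[OF K]] P1_continuous_on_K[OF fe_P1 K])
  qed
  then show ?thesis unfolding surface_integral_one[symmetric] by (simp add: surface_integral_def)
qed

lemma abs_surface_integral_basis_le:
  assumes i: "i < N"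
  shows "\<bar>surface_integral TYPE('d) \<K> (\<phi> i)\<bar> \<le> surface_area TYPE('d) \<K> (cball (x i) (c\<^sub>q * h))"
proof -
  have "\<bar>surface_integral TYPE('d) \<K> (\<phi> i)\<bar> \<le> (\<Sum>K\<in>\<K>. \<bar>simplex_integral TYPE('d) K (\<phi> i)\<bar>)"
    unfolding surface_integral_def by (rule sum_abs)
  also have "\<dots> \<le> surface_area TYPE('d) \<K> (cball (x i) (c\<^sub>q * h))"
    using i by (intro sum_mono abs_simplex_integral_le simK P1_continuous_on_K \<phi>_P1 \<phi>_abs_le_1 \<phi>_support) auto
  finally show ?thesis .
qed

text \<open>Integrate over the surface the number of balls that contain a point; by
  \<open>card_nodes_in_cball\<close> it never exceeds \<open>?m\<close>.\<close>

lemma sum_area_cball_le: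
  assumes R: "0 \<le> R"
  shows "(\<Sum>i<N. surface_area TYPE('d) \<K> (cball (x i) R)) \<le> (real DIM('a) + 1) * ((R + c\<^sub>q * h) * c\<^sub>q * \<sigma> / h) ^ DIM('a) * surface_area TYPE('d) \<K> UNIV"
proof -
  let ?m = "(real DIM('a) + 1) * ((R + c\<^sub>q * h) * c\<^sub>q * \<sigma> / h) ^ DIM('a)"
  have "(\<Sum>i<N. simplex_area TYPE('d) K (cball (x i) R)) \<le> ?m * simplex_area TYPE('d) K UNIV" if K: "K \<in> \<K>" for K
  proof -
    let ?F = "flat_param K :: 'd \<Rightarrow> 'a"
    let ?E = "\<lambda>i. ?F -` (K \<inter> cball (x i) R)"
    have cE: "compact (?E i)" for i
      using compact_simplex[OF simK[OF K]] by (intro compact_vimage_flat_param[OF simK[OF K]]) (simp add: compact_Int_closed)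
    have eq: "?E i \<inter> ?F -` K = ?E i" for i by auto
    have lm: "?E i \<inter> ?F -` K \<in> lmeasurable" for i unfolding eq by (rule lmeasurable_compact[OF cE])
    have lF: "?F -` K \<in> lmeasurable"
      by (intro lmeasurable_compact compact_vimage_flat_param[OF simK[OF K]] compact_simplex[OF simK[OF K]])
    have "(\<Sum>i<N. simplex_area TYPE('d) K (cball (x i) R)) = (\<Sum>i<N. integral (?F -` K) (indicat_real (?E i)))"
      using integral_indicator[OF lm] unfolding eq simplex_area_def by simp
    also have "\<dots> = integral (?F -` K) (\<lambda>u. \<Sum>i<N. indicat_real (?E i) u)"
      using lm by (intro integral_sum[symmetric]) (auto simp: integrable_on_indicator)
    also have "\<dots> \<le> integral (?F -` K) (\<lambda>u. ?m)"
    proof (rule integral_le)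
      show "(\<lambda>u. \<Sum>i<N. indicat_real (?E i) u) integrable_on (?F -` K)"
        using lm by (intro integrable_sum) (auto simp: integrable_on_indicator)
      show "(\<lambda>u. ?m) integrable_on (?F -` K)" by (rule integral_const_lmeasurable(1)[OF lF])
      fix u assume u: "u \<in> ?F -` K"
      have "(\<Sum>i<N. indicat_real (?E i) u) = (\<Sum>i<N. (if dist (?F u) (x i) \<le> R then 1 else 0))"
        using u by (intro sum.cong) (auto simp: indicator_def dist_commute)
      also have "\<dots> = (\<Sum>z\<in>mesh_nodes \<T>. (if dist (?F u) z \<le> R then 1 else 0))"
        by (simp only: sum_nodes)
      also have "\<dots> = card {z \<in> mesh_nodes \<T>. dist (?F u) z \<le> R}"
        using finite_mesh_nodes by (simp add: sum.If_cases Int_def)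
      also have "\<dots> \<le> ?m" by (rule card_nodes_in_cball[OF R])
      finally show "(\<Sum>i<N. indicat_real (?E i) u) \<le> ?m" .
    qed
    also have "\<dots> = ?m * simplex_area TYPE('d) K UNIV"
      unfolding integral_const_lmeasurable(2)[OF lF] by (simp add: simplex_area_def)
    finally show ?thesis .
  qed
  then have "(\<Sum>K\<in>\<K>. \<Sum>i<N. simplex_area TYPE('d) K (cball (x i) R)) \<le> (\<Sum>K\<in>\<K>. ?m * simplex_area TYPE('d) K UNIV)"
    by (rule sum_mono)
  then show ?thesis by (subst sum.swap) (simp add: sum_distrib_left)
qed

text \<open>The mean value functional has coefficients of size \<open>1/N\<close>: each basis function sees a piece of
  the surface of area at most \<open>a\<close>, while the total area is at least \<open>N * b / m\<close> because the
  neighbourhoods of the nodes cover the surface at most \<open>m\<close> times.\<close>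

proposition surface_average_sq_le:
  assumes a: "\<And>i. i < N \<Longrightarrow> surface_area TYPE('d) \<K> (cball (x i) (c\<^sub>q * h)) \<le> a"
    and b: "0 < b" "\<And>i. i < N \<Longrightarrow> b \<le> surface_area TYPE('d) \<K> (cball (x i) (2 * c\<^sub>q * h))"
    and N: "0 < N"
    and m_def: "m = (real DIM('a) + 1) * (3 * c\<^sub>q * c\<^sub>q * \<sigma>) ^ DIM('a)"
  shows "0 < surface_area TYPE('d) \<K> UNIV"
    and "N * (surface_average TYPE('d) \<K> (fe V))\<^sup>2 \<le> (m * a / b)\<^sup>2 * (\<Sum>i<N. (V i)\<^sup>2)"
proof -
  let ?A = "surface_area TYPE('d) \<K> UNIV"
  have m0: "0 < m" unfolding m_def using cq_pos \<sigma>_pos by (intro mult_pos_pos zero_less_power) auto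
  have "N * b = (\<Sum>i<N. b)" by simp
  also have "\<dots> \<le> (\<Sum>i<N. surface_area TYPE('d) \<K> (cball (x i) (2 * c\<^sub>q * h)))" using b by (intro sum_mono) auto
  also have "\<dots> \<le> (real DIM('a) + 1) * ((2 * c\<^sub>q * h + c\<^sub>q * h) * c\<^sub>q * \<sigma> / h) ^ DIM('a) * ?A"
    using cq_pos h_pos by (intro sum_area_cball_le) auto
  \<comment> \<open>The factor 3 in \<open>m\<close> is the radius 2 of the balls plus one mesh
    diameter from counting nodes.\<close>
  also have "(2 * c\<^sub>q * h + c\<^sub>q * h) * c\<^sub>q * \<sigma> / h = 3 * c\<^sub>q * c\<^sub>q * \<sigma>" using h_pos by (simp add: field_simps)
  finally have NbA: "N * b \<le> m * ?A" by (simp add: m_def)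
  have Nb: "0 < N * b" using N b by simp
  then have "0 < m * ?A" using NbA by linarith
  then show A: "0 < ?A" using m0 by (simp add: zero_less_mult_iff)
  let ?l = "\<lambda>i. surface_integral TYPE('d) \<K> (\<phi> i)"
  have a0: "0 \<le> a" using a[of 0] N simplex_area_nonneg by (meson order_trans sum_nonneg)
  have "(\<Sum>i<N. V i * ?l i)\<^sup>2 \<le> (\<Sum>i<N. (V i)\<^sup>2) * (\<Sum>i<N. (?l i)\<^sup>2)" by (rule Cauchy_Schwarz_ineq_sum)
  also have "\<dots> \<le> (\<Sum>i<N. (V i)\<^sup>2) * (\<Sum>i<N. a\<^sup>2)"
  proof (intro mult_left_mono sum_mono sum_nonneg)
    fix i assume "i \<in> {..<N}"
    then have "\<bar>?l i\<bar> \<le> a" using abs_surface_integral_basis_le[of i] a[of i] by simp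
    then show "(?l i)\<^sup>2 \<le> a\<^sup>2" using a0 by (simp add: abs_le_square_iff[symmetric])
  qed auto
  finally have 1: "(surface_integral TYPE('d) \<K> (fe V))\<^sup>2 \<le> (\<Sum>i<N. (V i)\<^sup>2) * (N * a\<^sup>2)" by (simp add: surface_integral_fe)
  have "N * (surface_average TYPE('d) \<K> (fe V))\<^sup>2 = N * (surface_integral TYPE('d) \<K> (fe V))\<^sup>2 / ?A\<^sup>2"
    by (simp add: surface_average_def surface_integral_one power_divide)
  also have "\<dots> \<le> N * ((\<Sum>i<N. (V i)\<^sup>2) * (N * a\<^sup>2)) / ?A\<^sup>2"
    using 1 by (intro divide_right_mono mult_left_mono) auto
  also have "\<dots> = (N * a / ?A)\<^sup>2 * (\<Sum>i<N. (V i)\<^sup>2)" by (simp add: power2_eq_square field_simps)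
  also have "\<dots> \<le> (m * a / b)\<^sup>2 * (\<Sum>i<N. (V i)\<^sup>2)"
  proof (intro mult_right_mono power_mono sum_nonneg)
    have "N / ?A \<le> m / b" using NbA A b by (simp add: field_simps)
    then have "a * (N / ?A) \<le> a * (m / b)" using a0 by (rule mult_left_mono)
    then show "N * a / ?A \<le> m * a / b" by (simp add: mult_ac)
    show "0 \<le> N * a / ?A" using a0 A by simp
  qed auto
  finally show "N * (surface_average TYPE('d) \<K> (fe V))\<^sup>2 \<le> (m * a / b)\<^sup>2 * (\<Sum>i<N. (V i)\<^sup>2)" .
qed

end

section \<open>Condition numbers of positive semidefinite matrices\<close>

lemma scalar_prod_self_nonneg: "0 \<le> scalar_prod v (v :: real Matrix.vec)"
  by (simp add: scalar_prod_def sum_nonneg)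

lemma scalar_prod_self_eq_0:
  fixes v :: "real Matrix.vec"
  assumes "v \<in> carrier_vec n" "scalar_prod v v = 0"
  shows "v = 0\<^sub>v n"
proof -
  have "(\<Sum>i\<in>{0..<dim_vec v}. vec_index v i * vec_index v i) = 0" using assms(2) by (simp add: scalar_prod_def)
  then have "\<forall>i\<in>{0..<dim_vec v}. vec_index v i * vec_index v i = 0"
    by (subst (asm) sum_nonneg_eq_0_iff) auto
  then show ?thesis using assms(1) by (intro eq_vecI) auto
qed

lemma euclid_norm_sq: "(euclid_norm v)\<^sup>2 = scalar_prod v v"
  by (simp add: euclid_norm_def scalar_prod_self_nonneg)

lemma euclid_norm_nonneg: "0 \<le> euclid_norm v"
  by (simp add: euclid_norm_def scalar_prod_self_nonneg)

text \<open>The polynomial argument behind Cauchy-Schwarz for semidefinite forms, where the leading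
  coefficient may vanish. That \<open>r\<close> is not negative is part of what has to be
  derived.\<close>

lemma discriminant_le_if_nonneg:
  fixes p q r :: real
  assumes "\<And>t. 0 \<le> p + 2 * t * q + t\<^sup>2 * r"
  shows "q\<^sup>2 \<le> p * r"
proof (cases "r = 0")
  case True
  have "q = 0"
  proof (rule ccontr)
    assume "q \<noteq> 0"
    then have "p + 2 * (- (p + 1) / (2 * q)) * q = -1" by (simp add: field_simps)
    then show False using assms[of "- (p + 1) / (2 * q)"] True by simp
  qed
  then show ?thesis using True by simp
next
  case False
  have "0 \<le> r"
  proof (rule ccontr)
    assume "\<not> 0 \<le> r"
    \<comment> \<open>Chosen so that \<open>t\<close> is at least 1 and the quadratic term outweighs
      the constant and the linear one.\<close>
    define t where "t = (\<bar>p\<bar> + 2 * \<bar>q\<bar> + 1) / \<bar>r\<bar> + 1"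
    have t: "1 \<le> t" "\<bar>p\<bar> + 2 * \<bar>q\<bar> + 1 \<le> t * \<bar>r\<bar>" using False by (auto simp: t_def field_simps)
    have "t * (\<bar>p\<bar> + 2 * \<bar>q\<bar> + 1) \<le> t * (t * \<bar>r\<bar>)" using t by (intro mult_left_mono) auto
    moreover have "t\<^sup>2 * r = - (t * (t * \<bar>r\<bar>))" using \<open>\<not> 0 \<le> r\<close> by (simp add: power2_eq_square)
    moreover have "\<bar>p\<bar> \<le> t * \<bar>p\<bar>" using t(1) mult_right_mono[of 1 t "\<bar>p\<bar>"] by simp
    moreover have "t * q \<le> t * \<bar>q\<bar>" using t(1) by (intro mult_left_mono) auto
    moreover have "t * (\<bar>p\<bar> + 2 * \<bar>q\<bar> + 1) = t * \<bar>p\<bar> + 2 * (t * \<bar>q\<bar>) + t" by (simp add: algebra_simps)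
    moreover have "2 * t * q = 2 * (t * q)" by simp
    ultimately have "p + 2 * t * q + t\<^sup>2 * r < 0" using t(1) by linarith
    then show False using assms[of t] by simp
  qed
  then have r: "0 < r" using False by simp
  have "0 \<le> p + 2 * (- q / r) * q + (- q / r)\<^sup>2 * r" by (rule assms)
  also have "\<dots> = p - q\<^sup>2 / r" using r by (simp add: field_simps power2_eq_square)
  finally show ?thesis using r by (simp add: field_simps)
qed

locale psd_matrix =
  fixes N :: nat and M :: "real mat"
  assumes M: "M \<in> carrier_mat N N"
    and sym: "\<And>V W. V \<in> carrier_vec N \<Longrightarrow> W \<in> carrier_vec N \<Longrightarrow> scalar_prod (M *\<^sub>v V) W = scalar_prod (M *\<^sub>v W) V"
    and psd: "\<And>V. V \<in> carrier_vec N \<Longrightarrow> 0 \<le> scalar_prod (M *\<^sub>v V) V"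
begin

lemma MV: "V \<in> carrier_vec N \<Longrightarrow> M *\<^sub>v V \<in> carrier_vec N"
  using M by simp

lemma cauchy_schwarz_form:
  assumes V: "V \<in> carrier_vec N" and W: "W \<in> carrier_vec N"
  shows "(scalar_prod (M *\<^sub>v V) W)\<^sup>2 \<le> scalar_prod (M *\<^sub>v V) V * scalar_prod (M *\<^sub>v W) W"
proof (rule discriminant_le_if_nonneg)
  fix t :: real
  have tW: "t \<cdot>\<^sub>v W \<in> carrier_vec N" using W by simp
  have "scalar_prod (M *\<^sub>v (V + t \<cdot>\<^sub>v W)) (V + t \<cdot>\<^sub>v W)
      = scalar_prod (M *\<^sub>v V) V + 2 * t * scalar_prod (M *\<^sub>v V) W + t\<^sup>2 * scalar_prod (M *\<^sub>v W) W"
    using V W tW MV[OF V] MV[OF W] M sym[OF V W]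
    by (simp add: mult_add_distrib_mat_vec[OF M] mult_mat_vec[OF M] add_scalar_prod_distrib[of _ N]
        scalar_prod_add_distrib[of _ N] power2_eq_square algebra_simps)
  then show "0 \<le> scalar_prod (M *\<^sub>v V) V + 2 * t * scalar_prod (M *\<^sub>v V) W + t\<^sup>2 * scalar_prod (M *\<^sub>v W) W"
    using psd[of "V + t \<cdot>\<^sub>v W"] V W by simp
qed

text \<open>Avoids eigenvalues: Cauchy-Schwarz for the form with second argument
  \<open>M *\<^sub>v V\<close> bounds the fourth power of the norm of this vector by
  \<open>a\<^sup>2\<close> times its square times the square of the norm of
  \<open>V\<close>.\<close>

lemma euclid_norm_mult_le:
  assumes a: "0 \<le> a" and upper: "\<And>V. V \<in> carrier_vec N \<Longrightarrow> scalar_prod (M *\<^sub>v V) V \<le> a * scalar_prod V V"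
    and V: "V \<in> carrier_vec N"
  shows "euclid_norm (M *\<^sub>v V) \<le> a * euclid_norm V"
proof -
  let ?w = "M *\<^sub>v V"
  have "(scalar_prod ?w ?w)\<^sup>2 \<le> scalar_prod ?w V * scalar_prod (M *\<^sub>v ?w) ?w"
    by (rule cauchy_schwarz_form[OF V MV[OF V]])
  also have "\<dots> \<le> (a * scalar_prod V V) * (a * scalar_prod ?w ?w)"
    using upper[OF V] upper[OF MV[OF V]] psd[OF MV[OF V]] a scalar_prod_self_nonneg
    by (intro mult_mono) auto
  finally have "scalar_prod ?w ?w * scalar_prod ?w ?w \<le> (a\<^sup>2 * scalar_prod V V) * scalar_prod ?w ?w"
    by (simp add: power2_eq_square mult_ac)
  then have "scalar_prod ?w ?w \<le> a\<^sup>2 * scalar_prod V V"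
    using scalar_prod_self_nonneg[of ?w] scalar_prod_self_nonneg[of V] a
    by (metis mult_le_cancel_right_pos mult_nonneg_nonneg order_le_less zero_le_power2)
  then have "(euclid_norm ?w)\<^sup>2 \<le> (a * euclid_norm V)\<^sup>2" by (simp add: euclid_norm_sq power_mult_distrib)
  then show ?thesis by (rule power2_le_imp_le) (simp add: a euclid_norm_nonneg)
qed

end

lemma quotient_norm_nonneg: "X \<noteq> {} \<Longrightarrow> 0 \<le> quotient_norm X"
  unfolding quotient_norm_def by (intro cINF_greatest euclid_norm_nonneg)

lemma quotient_norm_le: "V \<in> X \<Longrightarrow> quotient_norm X \<le> euclid_norm V"
  unfolding quotient_norm_def by (intro cINF_lower bdd_belowI2[where m=0] euclid_norm_nonneg)

text \<open>The instance of \<open>cauchy_schwarz_form\<close> for the identity matrix.\<close>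

lemma euclid_cauchy_schwarz:
  assumes "V \<in> carrier_vec N" "W \<in> carrier_vec N"
  shows "scalar_prod V W \<le> euclid_norm V * euclid_norm W"
proof -
  interpret I: psd_matrix N "1\<^sub>m N"
    using comm_scalar_prod[of _ N] by unfold_locales (auto simp: scalar_prod_self_nonneg)
  have "(scalar_prod V W)\<^sup>2 \<le> (euclid_norm V * euclid_norm W)\<^sup>2"
    using I.cauchy_schwarz_form[OF assms] assms by (simp add: euclid_norm_sq power_mult_distrib)
  then show ?thesis using euclid_norm_nonneg by (metis mult_nonneg_nonneg power2_le_imp_le)
qed

lemma invertible_surj:
  fixes P :: "real mat"
  assumes P: "P \<in> carrier_mat N N" and inj: "\<And>V. V \<in> carrier_vec N \<Longrightarrow> P *\<^sub>v V = 0\<^sub>v N \<Longrightarrow> V = 0\<^sub>v N"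
    and W: "W \<in> carrier_vec N"
  obtains V where "V \<in> carrier_vec N" "P *\<^sub>v V = W"
proof -
  have "det P \<noteq> 0" using det_0_iff_vec_prod_zero[OF P] inj by blast
  then have "P \<in> Units (ring_mat TYPE(real) N ())" by (rule det_non_zero_imp_unit[OF P])
  then obtain Q where Q: "Q \<in> carrier_mat N N" "P * Q = 1\<^sub>m N"
    unfolding Units_def ring_mat_def by auto
  have "P *\<^sub>v (Q *\<^sub>v W) = W" using P Q W by (metis assoc_mult_mat_vec one_mult_mat_vec)
  then show thesis using that Q W by (metis mult_mat_vec_carrier)
qed

definition ones :: "nat \<Rightarrow> real Matrix.vec" where
  "ones N = Matrix.vec N (\<lambda>_. 1)"

lemma ones_carrier [simp]: "ones N \<in> carrier_vec N"
  by (simp add: ones_def)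

lemma add_zero_smult_ones: "w \<in> carrier_vec N \<Longrightarrow> w + 0 \<cdot>\<^sub>v ones N = w"
  by (intro eq_vecI) (auto simp: ones_def)

text \<open>The lower bound forces the kernel to be the span of the vector of ones. The norm of the
  matrix is bounded on every representative of a coset, hence on the infimum. For the inverse, the
  representative \<open>V - s \<cdot>\<^sub>v ones N\<close> from \<open>lower\<close> is tested
  against the right-hand side, which is orthogonal to the ones.\<close>

proposition (in psd_matrix) condition_number_le:
  assumes N: "2 \<le> N" and ones: "M *\<^sub>v ones N = 0\<^sub>v N" and a: "0 < a" and b: "0 < b"
    and upper: "\<And>V. V \<in> carrier_vec N \<Longrightarrow> scalar_prod (M *\<^sub>v V) V \<le> a * scalar_prod V V"
    and lower: "\<And>V. V \<in> carrier_vec N \<Longrightarrow>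
      \<exists>s. scalar_prod (V - s \<cdot>\<^sub>v ones N) (V - s \<cdot>\<^sub>v ones N) \<le> b * scalar_prod (M *\<^sub>v V) V"
  shows "condition_number M \<le> a * b"
proof -
  have dc: "dim_col M = N" using M by simp
  have u: "ones N \<in> carrier_vec N" by simp
  have uu: "scalar_prod (ones N) (ones N) = N" by (simp add: ones_def scalar_prod_def)
  have kerI: "s \<cdot>\<^sub>v ones N \<in> mat_kernel M" for s
    using M ones by (auto simp: mat_kernel_def mult_mat_vec[OF M u])
  have Mu: "scalar_prod (M *\<^sub>v V) (ones N) = 0" if "V \<in> carrier_vec N" for V
    using sym[OF that u] ones that by simp
  have shift: "V - s \<cdot>\<^sub>v ones N = V + (- s) \<cdot>\<^sub>v ones N" if "V \<in> carrier_vec N" for V s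
    using that by (intro eq_vecI) (auto simp: ones_def)
  have kerE: "\<exists>s. V = s \<cdot>\<^sub>v ones N" if V: "V \<in> carrier_vec N" "M *\<^sub>v V = 0\<^sub>v N" for V
  proof -
    obtain s where s: "scalar_prod (V - s \<cdot>\<^sub>v ones N) (V - s \<cdot>\<^sub>v ones N) \<le> b * scalar_prod (M *\<^sub>v V) V"
      using lower[OF V(1)] by blast
    have "scalar_prod (M *\<^sub>v V) V = 0" using V by simp
    then have "scalar_prod (V - s \<cdot>\<^sub>v ones N) (V - s \<cdot>\<^sub>v ones N) = 0"
      using s scalar_prod_self_nonneg by (metis antisym mult_zero_right)
    then have "V - s \<cdot>\<^sub>v ones N = 0\<^sub>v N" using V by (intro scalar_prod_self_eq_0) auto
    then have "vec_index (V - s \<cdot>\<^sub>v ones N) i = 0" if "i < N" for i using that by simp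
    then have "V = s \<cdot>\<^sub>v ones N" using V(1) by (intro eq_vecI) (auto simp: ones_def)
    then show ?thesis by blast
  qed
  have coset_carrier: "X \<in> ker_quotient M \<Longrightarrow> X \<subseteq> carrier_vec N" for X
    using M by (auto simp: ker_quotient_def ker_coset_def mat_kernel_def)
  have zero_ker: "0\<^sub>v N \<in> mat_kernel M" using M by (auto simp: mat_kernel_def)
  have coset_self: "V \<in> ker_coset M V" if "V \<in> carrier_vec N" for V
    unfolding ker_coset_def using zero_ker that by (auto intro!: exI[of _ "0\<^sub>v N"])
  have qm: "quotient_map M X = M *\<^sub>v V" if X: "X \<in> ker_quotient M" and V: "V \<in> X" for X V
  proof -
    obtain V0 where V0: "V0 \<in> carrier_vec N" "X = ker_coset M V0" using X dc by (auto simp: ker_quotient_def)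
    have "M *\<^sub>v V' = M *\<^sub>v V0" if V': "V' \<in> X" for V'
    proof -
      obtain Z where Z: "Z \<in> carrier_vec N" "M *\<^sub>v Z = 0\<^sub>v N" "V' = V0 + Z"
        using V' V0 M by (auto simp: ker_coset_def mat_kernel_def)
      then show ?thesis using V0(1) M by (simp add: mult_add_distrib_mat_vec[OF M])
    qed
    then have "(\<lambda>V. M *\<^sub>v V) ` X = {M *\<^sub>v V}" using V by auto
    then show ?thesis by (simp add: quotient_map_def)
  qed
  have ne: "X \<noteq> {}" if "X \<in> ker_quotient M" for X
    using that coset_self dc by (auto simp: ker_quotient_def)
  have op: "op_norm M \<le> a"
    unfolding op_norm_def
  proof (rule cSUP_least)
    \<comment> \<open>A unit vector is no multiple of the ones because \<open>N\<close> is at least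
      2, so there is a nontrivial coset.\<close>
    let ?e = "unit_vec N 0 :: real Matrix.vec"
    have e: "?e \<in> carrier_vec N" by simp
    have "?e \<notin> mat_kernel M"
    proof
      assume "?e \<in> mat_kernel M"
      then obtain s where s: "?e = s \<cdot>\<^sub>v ones N" using kerE[OF e] M by (auto simp: mat_kernel_def)
      have "vec_index ?e 0 = s" "vec_index ?e 1 = s" using N by (subst s, simp add: ones_def)+
      then show False using N by simp
    qed
    then have "ker_coset M ?e \<noteq> mat_kernel M" using coset_self[OF e] by blast
    moreover have "ker_coset M ?e \<in> ker_quotient M" using e dc unfolding ker_quotient_def by (intro imageI) simp
    ultimately show "ker_quotient M - {mat_kernel M} \<noteq> {}" by blast
    fix X assume "X \<in> ker_quotient M - {mat_kernel M}"
    then have X: "X \<in> ker_quotient M" by simp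
    have "euclid_norm (quotient_map M X) / a \<le> quotient_norm X"
      unfolding quotient_norm_def
    proof (rule cINF_greatest[OF ne[OF X]])
      fix V assume V: "V \<in> X"
      then have "V \<in> carrier_vec N" using coset_carrier[OF X] by blast
      then have "euclid_norm (M *\<^sub>v V) \<le> a * euclid_norm V" using a upper by (intro euclid_norm_mult_le) auto
      then show "euclid_norm (quotient_map M X) / a \<le> euclid_norm V"
        using qm[OF X V] a by (simp add: field_simps)
    qed
    then have "euclid_norm (quotient_map M X) \<le> a * quotient_norm X" using a by (simp add: field_simps)
    \<comment> \<open>If the quotient norm is 0, the quotient is 0 by the convention for
      division.\<close>
    then show "euclid_norm (quotient_map M X) / quotient_norm X \<le> a"
      using quotient_norm_nonneg[OF ne[OF X]] a
      by (cases "quotient_norm X = 0") (auto simp: pos_divide_le_eq)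
  qed
  have inv_le: "quotient_norm (inv_into (ker_quotient M) (quotient_map M) W) / euclid_norm W \<le> b"
    and inv_ge: "0 \<le> quotient_norm (inv_into (ker_quotient M) (quotient_map M) W) / euclid_norm W"
    if "W \<in> ker_perp M - {0\<^sub>v (dim_col M)}" for W
  proof -
    have W: "W \<in> carrier_vec N" "W \<noteq> 0\<^sub>v N" "\<And>Z. Z \<in> mat_kernel M \<Longrightarrow> scalar_prod W Z = 0"
      using that dc by (auto simp: ker_perp_def)
    have Wu: "scalar_prod W (ones N) = 0" using W(3)[OF kerI[of 1]] W(1) by simp
    \<comment> \<open>The all-ones matrix acts as a multiple of the projection onto the kernel. So
      \<open>M + J\<close> is injective, hence surjective; for \<open>W\<close> orthogonal to the
      ones a solution is too, whence \<open>J\<close> annihilates it and it solves the equation for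
      \<open>M\<close>.\<close>
    define J :: "real mat" where "J = Matrix.mat N N (\<lambda>_. 1)"
    have J: "J \<in> carrier_mat N N" by (simp add: J_def)
    have JV: "J *\<^sub>v V = scalar_prod V (ones N) \<cdot>\<^sub>v ones N" if "V \<in> carrier_vec N" for V
      using that by (intro eq_vecI) (auto simp: J_def ones_def scalar_prod_def)
    have PV: "(M + J) *\<^sub>v V = M *\<^sub>v V + scalar_prod V (ones N) \<cdot>\<^sub>v ones N" if "V \<in> carrier_vec N" for V
      using that by (simp add: add_mult_distrib_mat_vec[OF M J] JV)
    have mean: "scalar_prod V (ones N) = 0" 
      if V: "V \<in> carrier_vec N" and "scalar_prod ((M + J) *\<^sub>v V) (ones N) = 0" for V
    proof -
      have "scalar_prod ((M + J) *\<^sub>v V) (ones N) = scalar_prod V (ones N) * N"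
        using V MV[OF V] Mu[OF V] uu by (simp add: PV add_scalar_prod_distrib[of _ N])
      then show ?thesis using that N by simp
    qed
    have "\<exists>V\<in>carrier_vec N. (M + J) *\<^sub>v V = W"
    proof (rule invertible_surj[of "M + J" N W])
      show "M + J \<in> carrier_mat N N" "W \<in> carrier_vec N" using M J W by auto
      fix V :: "real Matrix.vec" assume V: "V \<in> carrier_vec N" and z: "(M + J) *\<^sub>v V = 0\<^sub>v N"
      have m: "scalar_prod V (ones N) = 0" by (rule mean[OF V]) (simp add: z)
      have "M *\<^sub>v V = 0\<^sub>v N"
        using PV[OF V] z m add_zero_smult_ones[OF MV[OF V]] by simp
      then obtain s where s: "V = s \<cdot>\<^sub>v ones N" using kerE[OF V] by blast
      then have "s * N = 0" using m uu by simp
      then have "s = 0" using N by simp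
      then show "V = 0\<^sub>v N" using s by (intro eq_vecI) (auto simp: ones_def)
    qed blast
    then obtain V where V: "V \<in> carrier_vec N" "(M + J) *\<^sub>v V = W" by blast
    have "scalar_prod V (ones N) = 0" using mean[OF V(1)] V(2) Wu by simp
    then have MVW: "M *\<^sub>v V = W"
      using PV[OF V(1)] V(2) add_zero_smult_ones[OF MV[OF V(1)]] by simp
    have cV: "ker_coset M V \<in> ker_quotient M" using V dc unfolding ker_quotient_def by (intro imageI) simp
    \<comment> \<open>Without this, \<open>inv_into\<close> would be an unspecified value rather
      than a preimage of \<open>W\<close>.\<close>
    have "W \<in> quotient_map M ` ker_quotient M"
      using qm[OF cV coset_self[OF V(1)]] MVW cV by (metis imageI)
    define X where "X = inv_into (ker_quotient M) (quotient_map M) W"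
    have X: "X \<in> ker_quotient M" "quotient_map M X = W"
      using \<open>W \<in> quotient_map M ` ker_quotient M\<close> unfolding X_def by (simp_all add: inv_into_into f_inv_into_f)
    obtain V1 where V1: "V1 \<in> carrier_vec N" "X = ker_coset M V1" using X(1) dc by (auto simp: ker_quotient_def)
    have MV1: "M *\<^sub>v V1 = W" using qm[OF X(1), of V1] X(2) V1 coset_self by simp
    obtain s where s: "scalar_prod (V1 - s \<cdot>\<^sub>v ones N) (V1 - s \<cdot>\<^sub>v ones N) \<le> b * scalar_prod (M *\<^sub>v V1) V1"
      using lower[OF V1(1)] by blast
    let ?V0 = "V1 - s \<cdot>\<^sub>v ones N"
    have V0: "?V0 \<in> carrier_vec N" using V1(1) by simp
    have "?V0 \<in> X" unfolding V1(2) shift[OF V1(1)] ker_coset_def using kerI by blast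
    then have q: "quotient_norm X \<le> euclid_norm ?V0" by (rule quotient_norm_le)
    \<comment> \<open>\<open>W\<close> is orthogonal to the ones, so the shift is invisible;
      Cauchy-Schwarz and cancelling one factor then bound \<open>?V0\<close>.\<close>
    have "scalar_prod W V1 = scalar_prod W ?V0"
      using W(1) V1(1) Wu by (simp add: scalar_prod_minus_distrib[of _ N])
    then have "(euclid_norm ?V0)\<^sup>2 \<le> b * scalar_prod W ?V0" using s MV1 by (simp add: euclid_norm_sq)
    also have "\<dots> \<le> b * (euclid_norm W * euclid_norm ?V0)"
      using euclid_cauchy_schwarz[OF W(1) V0] b by (intro mult_left_mono) auto
    finally have "euclid_norm ?V0 * euclid_norm ?V0 \<le> (b * euclid_norm W) * euclid_norm ?V0"
      by (simp add: power2_eq_square)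
    then have "euclid_norm ?V0 \<le> b * euclid_norm W"
      using b euclid_norm_nonneg[of ?V0] euclid_norm_nonneg[of W]
      by (metis mult_le_cancel_right_pos mult_nonneg_nonneg order_le_less)
    then have "quotient_norm X \<le> b * euclid_norm W" using q by linarith
    moreover have "0 < euclid_norm W"
      using W scalar_prod_self_eq_0[OF W(1)] scalar_prod_self_nonneg[of W] by (auto simp: euclid_norm_def order_le_less)
    ultimately show "quotient_norm (inv_into (ker_quotient M) (quotient_map M) W) / euclid_norm W \<le> b"
      by (simp add: X_def pos_divide_le_eq)
    show "0 \<le> quotient_norm (inv_into (ker_quotient M) (quotient_map M) W) / euclid_norm W"
      using quotient_norm_nonneg[OF ne[OF X(1)]] euclid_norm_nonneg[of W] by (simp add: X_def)
  qed
  let ?S = "ker_perp M - {0\<^sub>v (dim_col M)}"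
  have Sne: "?S \<noteq> {}"
  proof -
    \<comment> \<open>A nonzero vector whose entries sum to 0 lies in the orthogonal complement of
      the kernel.\<close>
    let ?w = "unit_vec N 0 - unit_vec N 1 :: real Matrix.vec"
    have "?w \<in> carrier_vec N" by simp
    moreover have "?w \<noteq> 0\<^sub>v N"
    proof
      assume "?w = 0\<^sub>v N"
      then have "vec_index ?w 0 = 0" using N by simp
      then show False using N by simp
    qed
    moreover have "scalar_prod ?w Z = 0" if Z: "Z \<in> mat_kernel M" for Z
    proof -
      obtain s where s: "Z = s \<cdot>\<^sub>v ones N" using kerE[of Z] Z M by (auto simp: mat_kernel_def)
      have "scalar_prod ?w (ones N) = 0"
        using N by (simp add: minus_scalar_prod_distrib[of _ N] scalar_prod_left_unit ones_def)
      moreover have "scalar_prod ?w (s \<cdot>\<^sub>v ones N) = s * scalar_prod ?w (ones N)"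
        by (rule scalar_prod_smult_distrib[of _ N]) auto
      ultimately show ?thesis unfolding s by simp
    qed
    ultimately have "?w \<in> ?S" unfolding ker_perp_def dc by blast
    then show ?thesis by blast
  qed
  have invb: "inv_op_norm M \<le> b" unfolding inv_op_norm_def by (rule cSUP_least[OF Sne inv_le])
  \<comment> \<open>The bound on \<open>op_norm M\<close> is multiplied by this factor, so its sign
    matters.\<close>
  have inv0: "0 \<le> inv_op_norm M"
  proof -
    obtain W where W: "W \<in> ?S" using Sne by blast
    have "quotient_norm (inv_into (ker_quotient M) (quotient_map M) W) / euclid_norm W \<le> inv_op_norm M"
      unfolding inv_op_norm_def by (rule cSUP_upper[OF W]) (rule bdd_aboveI2[OF inv_le])
    then show ?thesis using inv_ge[OF W] by linarith
  qed
  have "condition_number M \<le> a * inv_op_norm M"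
    unfolding condition_number_def by (intro mult_right_mono op inv0)
  also have "\<dots> \<le> a * b" using a invb by (intro mult_left_mono) auto
  finally show ?thesis .
qed

section \<open>The stiffness matrix\<close>

lemma sym_psd_form_add_scale:
  assumes "sym_psd_form V a" "sym_psd_form V s" "0 < \<tau>"
  shows "sym_psd_form V (\<lambda>v w. a v w + \<tau> * s v w)"
  using assms unfolding sym_psd_form_def by (simp add: algebra_simps)

lemma scalar_prod_self:
  fixes V :: "real Matrix.vec"
  assumes "V \<in> carrier_vec N"
  shows "scalar_prod V V = (\<Sum>i<N. (vec_index V i)\<^sup>2)"
  using assms by (simp add: scalar_prod_def power2_eq_square lessThan_atLeast0)

text \<open>Source of the factor \<open>2 + 2 * \<Lambda>\<^sup>2\<close>: removing the mean
  \<open>r\<close> changes the squared norm by a bounded factor once \<open>N * r\<^sup>2\<close> is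
  controlled.\<close>

lemma sum_diff_sq_le:
  fixes V :: "nat \<Rightarrow> real"
  shows "(\<Sum>i<N. (V i - r)\<^sup>2) \<le> 2 * (\<Sum>i<N. (V i)\<^sup>2) + 2 * (N * r\<^sup>2)"
proof -
  have "(V i - r)\<^sup>2 \<le> 2 * (V i)\<^sup>2 + 2 * r\<^sup>2" for i
    using zero_le_power2[of "V i + r"] by (simp add: power2_eq_square algebra_simps)
  then have "(\<Sum>i<N. (V i - r)\<^sup>2) \<le> (\<Sum>i<N. 2 * (V i)\<^sup>2 + 2 * r\<^sup>2)" by (rule sum_mono)
  then show ?thesis by (simp add: sum.distrib sum_distrib_left)
qed

lemma mass_upper_pos: "0 < c\<^sub>q \<Longrightarrow> 0 < \<sigma> \<Longrightarrow> 0 < mass_upper TYPE('a::euclidean_space) c\<^sub>q \<sigma>"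
  unfolding mass_upper_def by (intro mult_pos_pos zero_less_power) auto

lemma mass_lower_pos: "0 < c\<^sub>q \<Longrightarrow> 0 < \<sigma> \<Longrightarrow> 0 < mass_lower TYPE('a::euclidean_space) c\<^sub>q \<sigma>"
  unfolding mass_lower_def by (intro mult_pos_pos zero_less_power divide_pos_pos) auto

lemma simplex_area_mono:
  assumes K: "int DIM('d::euclidean_space) simplex K" and S: "closed S" "closed S'" "S \<subseteq> S'"
  shows "simplex_area TYPE('d) K S \<le> simplex_area TYPE('d) K S'"
proof -
  have "compact ((flat_param K :: 'd \<Rightarrow> _) -` (K \<inter> C))" if "closed C" for C
    using compact_simplex[OF K] that by (intro compact_vimage_flat_param[OF K]) (simp add: compact_Int_closed)
  then show ?thesis unfolding simplex_area_def
    using S by (intro measure_mono_fmeasurable) (auto simp: lmeasurable_compact fmeasurableD)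
qed

lemma (in nodal_mesh) fe_cong: "(\<And>i. i < N \<Longrightarrow> V i = W i) \<Longrightarrow> fe V = fe W"
  by (simp add: fe_def)

text \<open>The powers \<open>h ^ DIM('a)\<close> from the mass matrix and the powers with exponent
  \<open>- int c\<close> cancel between the two eigenvalue bounds; only the exponent -2 of the
  inverse estimate remains.\<close>

proposition (in cut_mesh) condition_number_stiffness_le:
  assumes N: "2 \<le> N" and area: "0 < surface_area TYPE('d) \<K> UNIV"
    and avg: "\<And>V. N * (surface_average TYPE('d) \<K> (fe V))\<^sup>2 \<le> \<Lambda>\<^sup>2 * (\<Sum>i<N. (V i)\<^sup>2)"
    and form: "sym_psd_form (P1_space \<T>) A"
    and const: "\<And>v. v \<in> P1_space \<T> \<Longrightarrow> A (indicat_real (\<Union>\<T>)) v = 0"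
    and poincare: "\<And>v. v \<in> P1_space \<T> \<Longrightarrow> surface_average TYPE('d) \<K> v = 0 \<Longrightarrow>
          h powi (- int c) * (L2_norm_mesh \<T> v)\<^sup>2 \<le> C\<^sub>1 * A v v"
    and inverse: "\<And>v. v \<in> P1_space \<T> \<Longrightarrow> surface_average TYPE('d) \<K> v = 0 \<Longrightarrow>
          A v v \<le> C\<^sub>2 * h powi (- 2 - int c) * (L2_norm_mesh \<T> v)\<^sup>2"
    and stiff: "stiffness_matrix N \<phi> A M"
    and C: "0 < C\<^sub>1" "0 < C\<^sub>2"
  shows "condition_number M \<le>
    C\<^sub>1 * C\<^sub>2 * (mass_upper TYPE('a) c\<^sub>q \<sigma> / mass_lower TYPE('a) c\<^sub>q \<sigma>) * (2 + 2 * \<Lambda>\<^sup>2) * h powi (- 2)"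
proof -
  let ?mu = "mass_upper TYPE('a) c\<^sub>q \<sigma>" and ?ml = "mass_lower TYPE('a) c\<^sub>q \<sigma>"
  have mu: "0 < ?mu" and ml: "0 < ?ml" using mass_upper_pos mass_lower_pos cq_pos \<sigma>_pos by blast+
  let ?f = "\<lambda>V. fe (vec_index V)"
  let ?avg = "\<lambda>V. surface_average TYPE('d) \<K> (fe V)"
  have M: "M \<in> carrier_mat N N" and MA: "\<And>V W. V \<in> carrier_vec N \<Longrightarrow> W \<in> carrier_vec N \<Longrightarrow>
      scalar_prod (M *\<^sub>v V) W = A (?f V) (?f W)"
    using stiff unfolding stiffness_matrix_def fe_def by auto
  have Asym: "A (fe V) (fe W) = A (fe W) (fe V)" and Apos: "0 \<le> A (fe V) (fe V)" for V W
    using form fe_P1 unfolding sym_psd_form_def by blast+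
  have Aadd: "A (\<lambda>x. u x + v x) w = A u w + A v w" and Asc: "A (\<lambda>x. r * v x) w = r * A v w"
    if "u \<in> P1_space \<T>" "v \<in> P1_space \<T>" "w \<in> P1_space \<T>" for u v w r
    using form that unfolding sym_psd_form_def by blast+
  interpret psd_matrix N M
    by unfold_locales (use M MA Asym Apos in auto)
  have fe_shift: "fe (\<lambda>i. V i - r) = (\<lambda>y. fe V y + (- r) * fe (\<lambda>_. 1) y)" for V r
    by (simp add: fe_def left_diff_distrib sum_subtractf sum_distrib_left sum_negf)
  \<comment> \<open>A shift of the coefficients adds a multiple of the constant function, which the
    form annihilates; symmetry treats the second argument.\<close>
  have A_shift: "A (fe (\<lambda>i. V i - r)) (fe W) = A (fe V) (fe W)" for V W r
    unfolding fe_shift Aadd[OF fe_P1 P1_space_cmult[OF fe_P1] fe_P1] Asc[OF fe_P1 fe_P1 fe_P1]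
    unfolding fe_ones using const[OF fe_P1] by simp
  have A_shift2: "A (fe (\<lambda>i. V i - r)) (fe (\<lambda>i. V i - r)) = A (fe V) (fe V)" for V r
    by (metis A_shift Asym)
  have avg0: "surface_average TYPE('d) \<K> (fe (\<lambda>i. V i - ?avg V)) = 0" for V
  proof -
    have "surface_integral TYPE('d) \<K> (fe (\<lambda>i. V i - r)) = surface_integral TYPE('d) \<K> (fe V) - r * surface_area TYPE('d) \<K> UNIV" for r
      using surface_integral_fe[of "\<lambda>i. V i - r"] surface_integral_fe[of V] surface_integral_fe[of "\<lambda>_. 1"] surface_integral_indicator
      by (simp add: left_diff_distrib sum_subtractf sum_distrib_left)
    then show ?thesis using area by (simp add: surface_average_def surface_integral_one)
  qed
  \<comment> \<open>\<open>a\<close> combines the inverse estimate, the upper mass bound and the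
    cost of removing the mean; \<open>b\<close> inverts the product of the Poincare and lower mass
    bounds.\<close>
  define a where "a = C\<^sub>2 * h powi (- 2 - int c) * (?mu * h ^ DIM('a) * (2 + 2 * \<Lambda>\<^sup>2))"
  define b where "b = C\<^sub>1 / (h powi (- int c) * (?ml * h ^ DIM('a)))"
  have hp: "0 < h powi k" for k using h_pos by simp
  have L0: "0 < 2 + 2 * \<Lambda>\<^sup>2" by (simp add: add_pos_nonneg)
  have ab: "0 < a" "0 < b" using hp C mu ml h_pos L0 by (auto simp: a_def b_def)
  have "condition_number M \<le> a * b"
  proof (rule condition_number_le[OF N _ ab])
    have "scalar_prod (M *\<^sub>v ones N) W = 0" if W: "W \<in> carrier_vec N" for W
    proof -
      have "?f (ones N) = fe (\<lambda>_. 1)" by (rule fe_cong) (simp add: ones_def)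
      then show ?thesis using MA[OF ones_carrier W] const[OF fe_P1] by (simp add: fe_ones)
    qed
    then show "M *\<^sub>v ones N = 0\<^sub>v N"
      using M by (intro scalar_prod_self_eq_0) auto
    fix V :: "real Matrix.vec" assume V: "V \<in> carrier_vec N"
    let ?r = "?avg (vec_index V)"
    let ?v0 = "fe (\<lambda>i. vec_index V i - ?r)"
    have S: "(\<Sum>i<N. (vec_index V i - ?r)\<^sup>2) \<le> (2 + 2 * \<Lambda>\<^sup>2) * scalar_prod V V"
      using sum_diff_sq_le[where N=N and V="vec_index V" and r="?r"] avg[of "vec_index V"] scalar_prod_self[OF V]
      by (simp add: distrib_right)
    have "scalar_prod (M *\<^sub>v V) V = A ?v0 ?v0" using MA[OF V V] by (simp add: A_shift2)
    also have "\<dots> \<le> C\<^sub>2 * h powi (- 2 - int c) * (L2_norm_mesh \<T> ?v0)\<^sup>2" by (rule inverse[OF fe_P1 avg0])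
    also have "\<dots> \<le> C\<^sub>2 * h powi (- 2 - int c) * (?mu * h ^ DIM('a) * (\<Sum>i<N. (vec_index V i - ?r)\<^sup>2))"
      using C hp by (intro mult_left_mono fe_L2_bounds) (auto intro: less_imp_le)
    also have "\<dots> \<le> C\<^sub>2 * h powi (- 2 - int c) * (?mu * h ^ DIM('a) * ((2 + 2 * \<Lambda>\<^sup>2) * scalar_prod V V))"
      using C hp mu h_pos S by (intro mult_left_mono) (auto intro: less_imp_le)
    finally show "scalar_prod (M *\<^sub>v V) V \<le> a * scalar_prod V V" by (simp add: a_def mult_ac)
    have "h powi (- int c) * (?ml * h ^ DIM('a)) * (\<Sum>i<N. (vec_index V i - ?r)\<^sup>2)
        = h powi (- int c) * (?ml * h ^ DIM('a) * (\<Sum>i<N. (vec_index V i - ?r)\<^sup>2))" by simp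
    also have "\<dots> \<le> h powi (- int c) * (L2_norm_mesh \<T> ?v0)\<^sup>2"
      using hp by (intro mult_left_mono fe_L2_bounds) (auto intro: less_imp_le)
    also have "\<dots> \<le> C\<^sub>1 * A ?v0 ?v0" by (rule poincare[OF fe_P1 avg0])
    also have "\<dots> = C\<^sub>1 * scalar_prod (M *\<^sub>v V) V" using MA[OF V V] by (simp add: A_shift2)
    finally have "(\<Sum>i<N. (vec_index V i - ?r)\<^sup>2) \<le> b * scalar_prod (M *\<^sub>v V) V"
      unfolding b_def using hp ml h_pos by (simp add: pos_le_divide_eq mult_ac)
    \<comment> \<open>The shift \<open>s\<close> required by \<open>condition_number_le\<close> is
      the surface average.\<close>
    moreover have "scalar_prod (V - ?r \<cdot>\<^sub>v ones N) (V - ?r \<cdot>\<^sub>v ones N) = (\<Sum>i<N. (vec_index V i - ?r)\<^sup>2)"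
      using V by (subst scalar_prod_self[of _ N]) (auto simp: ones_def)
    ultimately show "\<exists>s. scalar_prod (V - s \<cdot>\<^sub>v ones N) (V - s \<cdot>\<^sub>v ones N) \<le> b * scalar_prod (M *\<^sub>v V) V" by metis
  qed
  also have "a * b = C\<^sub>1 * C\<^sub>2 * (?mu / ?ml) * (2 + 2 * \<Lambda>\<^sup>2) * (h powi (- 2 - int c) / h powi (- int c))"
  proof -
    have "C\<^sub>2 * p * (u * k * L) * (C\<^sub>1 / (q * (l * k))) = C\<^sub>1 * C\<^sub>2 * (u / l) * L * (p / q)" 
      if "0 < k" "0 < q" "0 < l" for p q k u l L :: real
      using that by (simp add: field_simps)
    then show ?thesis unfolding a_def b_def using zero_less_power[OF h_pos] hp ml by blast
  qed
  also have "h powi (- 2 - int c) / h powi (- int c) = h powi (- 2)"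
    using h_pos by (simp flip: power_int_diff)
  finally show ?thesis .
qed

text \<open>\<open>C\<close> is quantified before \<open>\<Gamma>\<close> and
  \<open>\<delta>\<^sub>0\<close>, while \<open>h\<^sub>0\<close> may depend on them. This expresses
  that the constant knows neither the manifold nor the way it cuts the mesh.\<close>

theorem theorem5p2:
  fixes c\<^sub>q \<sigma> C\<^sub>\<rho> C\<^sub>P C\<^sub>1 C\<^sub>2 :: real
  assumes "0 < c\<^sub>q" "0 < \<sigma>" "0 < C\<^sub>\<rho>" "0 < C\<^sub>P" "0 < C\<^sub>1" "0 < C\<^sub>2"
    and "DIM('d::euclidean_space) < DIM('a::euclidean_space)"
    and "c = DIM('a) - DIM('d)"
  shows "\<exists>C>0. \<forall>(\<Gamma> :: 'a set) \<delta>\<^sub>0.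
    compact_submanifold TYPE('d) \<Gamma> \<and> smooth_projection_tube \<Gamma> \<delta>\<^sub>0 \<longrightarrow>
    (\<exists>h\<^sub>0>0. \<forall>h \<K> \<T>' \<T>.
      0 < h \<and> h \<le> h\<^sub>0 \<and>
      discrete_manifold TYPE('d) \<Gamma> \<delta>\<^sub>0 C\<^sub>\<rho> C\<^sub>P h \<K> \<and>
      background_mesh \<Gamma> \<delta>\<^sub>0 c\<^sub>q \<sigma> h \<T>' \<and> \<T> = active_mesh \<T>' \<K> \<longrightarrow>
      (\<forall>N x \<phi> a s \<tau> A M.
        nodal_basis \<T> N x \<phi> \<and>
        sym_psd_form (P1_space \<T>) a \<and> sym_psd_form (P1_space \<T>) s \<and> 0 < \<tau> \<and>
        A = (\<lambda>v w. a v w + \<tau> * s v w) \<and>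
        (\<forall>v\<in>P1_space \<T>. A (indicat_real (\<Union>\<T>)) v = 0) \<and>
        (\<forall>v\<in>P1_space \<T>. surface_average TYPE('d) \<K> v = 0 \<longrightarrow>
          h powi (- int c) *
            (L2_norm_mesh \<T> (\<lambda>y. v y - surface_average TYPE('d) \<K> v))\<^sup>2 \<le> C\<^sub>1 * A v v) \<and>
        (\<forall>v\<in>P1_space \<T>. surface_average TYPE('d) \<K> v = 0 \<longrightarrow>
          A v v \<le> C\<^sub>2 * h powi (- 2 - int c) * (L2_norm_mesh \<T> v)\<^sup>2) \<and>
        stiffness_matrix N \<phi> A M \<longrightarrow>
        condition_number M \<le> C * h powi (- 2)))"
proof -
  let ?d = "DIM('d)"
  define B where "B = lip_const TYPE('d) * 2 ^ ?d"
  define m where "m = (real DIM('a) + 1) * (3 * c\<^sub>q * c\<^sub>q * \<sigma>) ^ DIM('a)"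
  \<comment> \<open>The area bounds above and below contribute one factor \<open>B\<close> each; 32
    is the ratio of the radii \<open>4 * c\<^sub>q * h\<close> and \<open>c\<^sub>q * h / 8\<close>
    in them, and \<open>m\<close> counts overlaps.\<close>
  define \<Lambda> where "\<Lambda> = m * (B\<^sup>2 * 32 ^ ?d)"
  define C where "C = C\<^sub>1 * C\<^sub>2 * (mass_upper TYPE('a) c\<^sub>q \<sigma> / mass_lower TYPE('a) c\<^sub>q \<sigma>) * (2 + 2 * \<Lambda>\<^sup>2)"
  have B: "0 < B" using lip_const_pos[where 'd='d] by (simp add: B_def)
  have L: "0 < 2 + 2 * \<Lambda>\<^sup>2" by (simp add: add_pos_nonneg)
  have "0 < C" unfolding C_def by (intro mult_pos_pos divide_pos_pos mass_upper_pos mass_lower_pos assms L)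
  moreover
  {
    fix \<Gamma> :: "'a set" and \<delta>\<^sub>0
    assume "compact_submanifold TYPE('d) \<Gamma>" and spt: "smooth_projection_tube \<Gamma> \<delta>\<^sub>0"
    then have \<Gamma>: "compact \<Gamma>" "\<Gamma> \<noteq> {}" by (auto simp: compact_submanifold_def)
    obtain h\<^sub>1 R\<^sub>1 where hR: "0 < h\<^sub>1" "0 < R\<^sub>1" and bounds:
      "\<And>h \<K> x\<^sub>0 r. 0 < h \<Longrightarrow> h \<le> h\<^sub>1 \<Longrightarrow> discrete_manifold TYPE('d) \<Gamma> \<delta>\<^sub>0 C\<^sub>\<rho> C\<^sub>P h \<K> \<Longrightarrow>
        x\<^sub>0 \<in> \<Union>\<K> \<Longrightarrow> 4 * C\<^sub>\<rho> * h\<^sup>2 \<le> r \<Longrightarrow> r \<le> R\<^sub>1 \<Longrightarrow>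
        surface_area TYPE('d) \<K> (cball x\<^sub>0 r) \<le> B * unit_ball_vol ?d * (2 * r) ^ ?d \<and>
        unit_ball_vol ?d * (r / 8) ^ ?d \<le> B * surface_area TYPE('d) \<K> (cball x\<^sub>0 r)"
      unfolding B_def by (rule discrete_manifold_area_bounds[OF \<Gamma> spt assms(3,4), where 'd='d]) blast
    \<comment> \<open>Makes the radii \<open>c\<^sub>q * h\<close> and
      \<open>2 * (c\<^sub>q * h)\<close> admissible in the area bounds: the second term yields
      \<open>4 * C\<^sub>\<rho> * h\<^sup>2 \<le> c\<^sub>q * h\<close>, the third keeps them below
      \<open>R\<^sub>1\<close>.\<close>
    define h\<^sub>0 where "h\<^sub>0 = min h\<^sub>1 (min (c\<^sub>q / (4 * C\<^sub>\<rho>)) (R\<^sub>1 / (2 * c\<^sub>q)))"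
    have "0 < h\<^sub>0" using hR assms by (simp add: h\<^sub>0_def)
    moreover
    {
      fix h \<K> \<T>' \<T> N x \<phi> a s \<tau> A M
      assume h: "0 < h" "h \<le> h\<^sub>0" and dm: "discrete_manifold TYPE('d) \<Gamma> \<delta>\<^sub>0 C\<^sub>\<rho> C\<^sub>P h \<K>"
        and bm: "background_mesh \<Gamma> \<delta>\<^sub>0 c\<^sub>q \<sigma> h \<T>'" and act: "\<T> = active_mesh \<T>' \<K>"
        and nb: "nodal_basis \<T> N x \<phi>"
        and forms: "sym_psd_form (P1_space \<T>) a" "sym_psd_form (P1_space \<T>) s" "0 < \<tau>"
        and A: "A = (\<lambda>v w. a v w + \<tau> * s v w)"
        and const: "\<forall>v\<in>P1_space \<T>. A (indicat_real (\<Union>\<T>)) v = 0"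
        and poincare: "\<forall>v\<in>P1_space \<T>. surface_average TYPE('d) \<K> v = 0 \<longrightarrow>
          h powi (- int c) * (L2_norm_mesh \<T> (\<lambda>y. v y - surface_average TYPE('d) \<K> v))\<^sup>2 \<le> C\<^sub>1 * A v v"
        and inverse: "\<forall>v\<in>P1_space \<T>. surface_average TYPE('d) \<K> v = 0 \<longrightarrow>
          A v v \<le> C\<^sub>2 * h powi (- 2 - int c) * (L2_norm_mesh \<T> v)\<^sup>2"
        and stiff: "stiffness_matrix N \<phi> A M"
      have h_le: "h \<le> h\<^sub>1" and "h \<le> c\<^sub>q / (4 * C\<^sub>\<rho>)" "h \<le> R\<^sub>1 / (2 * c\<^sub>q)" using h(2) by (auto simp: h\<^sub>0_def)
      then have h_c: "4 * C\<^sub>\<rho> * h \<le> c\<^sub>q" and h_R: "2 * (c\<^sub>q * h) \<le> R\<^sub>1"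
        using assms by (auto simp: pos_le_divide_eq mult_ac)
      have h_c2: "4 * C\<^sub>\<rho> * h\<^sup>2 \<le> c\<^sub>q * h"
        using mult_right_mono[OF h_c, of h] h by (simp add: power2_eq_square mult_ac)
      have tri: "triangulation \<K>" and simK: "\<And>K. K \<in> \<K> \<Longrightarrow> int DIM('d) simplex K"
        and Ktube: "\<Union>\<K> \<subseteq> tube \<Gamma> \<delta>\<^sub>0" and bij: "bij_betw (closest_point \<Gamma>) (\<Union>\<K>) \<Gamma>"
        using dm unfolding discrete_manifold_def closed_surface_mesh_def by auto
      have sub: "\<T> \<subseteq> \<T>'" by (auto simp: act active_mesh_def)
      have KT: "\<Union>\<K> \<subseteq> \<Union>\<T>"
      proof
        fix y assume y: "y \<in> \<Union>\<K>"
        obtain \<Omega> where "tube \<Gamma> \<delta>\<^sub>0 \<subseteq> \<Omega>" "\<Omega> \<subseteq> \<Union>\<T>'" using bm unfolding background_mesh_def by blast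
        then obtain T where "T \<in> \<T>'" "y \<in> T" using y Ktube by blast
        then show "y \<in> \<Union>\<T>" using y unfolding act active_mesh_def by blast
      qed
      interpret cut_mesh \<T> c\<^sub>q \<sigma> h N x \<phi> \<K> "TYPE('d)"
      proof unfold_locales
        have "triangulation \<T>'" using bm by (simp add: background_mesh_def)
        then show "triangulation \<T>" using sub unfolding triangulation_def by (meson finite_subset subsetD)
        show "finite \<K>" using tri by (simp add: triangulation_def)
      qed (use bm sub h assms nb simK KT in \<open>auto simp: background_mesh_def subset_iff\<close>)
      have "\<Union>\<K> \<noteq> {}" using bij \<Gamma>(2) by (auto simp: bij_betw_def)
      then have N: "2 \<le> N" using KT by (intro card_nodes) auto
      \<comment> \<open>Active simplices meet the surface. Balls around nodes can thus be compared
        with balls around surface points, for which the area bounds hold.\<close>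
      have node_near: "\<exists>x\<^sub>0\<in>\<Union>\<K>. dist (x i) x\<^sub>0 \<le> c\<^sub>q * h" if i: "i < N" for i
      proof -
        obtain T where T: "T \<in> \<T>" "x i extreme_point_of T" using node_in[OF i] by (auto simp: mesh_nodes_def)
        then obtain x\<^sub>0 where "x\<^sub>0 \<in> T" "x\<^sub>0 \<in> \<Union>\<K>" unfolding act active_mesh_def by blast
        moreover have "x i \<in> T" using T(2) by (simp add: extreme_point_of_def)
        ultimately show ?thesis using dist_le_in_T[OF T(1)] by blast
      qed
      \<comment> \<open>The ball of radius \<open>c\<^sub>q * h\<close> around a node lies in the
        ball of twice that radius around the nearby surface point, and vice versa. So
        \<open>\<alpha>\<close> uses the larger radius and \<open>\<beta>\<close> the smaller
        one.\<close>
      define \<alpha> where "\<alpha> = B * unit_ball_vol ?d * (2 * (2 * (c\<^sub>q * h))) ^ ?d"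
      define \<beta> where "\<beta> = unit_ball_vol ?d * (c\<^sub>q * h / 8) ^ ?d / B"
      have \<alpha>: "surface_area TYPE('d) \<K> (cball (x i) (c\<^sub>q * h)) \<le> \<alpha>" if i: "i < N" for i
      proof -
        obtain x\<^sub>0 where x0: "x\<^sub>0 \<in> \<Union>\<K>" "dist (x i) x\<^sub>0 \<le> c\<^sub>q * h" using node_near[OF i] by blast
        have "cball (x i) (c\<^sub>q * h) \<subseteq> cball x\<^sub>0 (2 * (c\<^sub>q * h))"
        proof
          fix y assume "y \<in> cball (x i) (c\<^sub>q * h)"
          then show "y \<in> cball x\<^sub>0 (2 * (c\<^sub>q * h))" using x0(2) dist_triangle3[of x\<^sub>0 y "x i"] by simp
        qed
        then have "surface_area TYPE('d) \<K> (cball (x i) (c\<^sub>q * h)) \<le> surface_area TYPE('d) \<K> (cball x\<^sub>0 (2 * (c\<^sub>q * h)))"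
          by (intro sum_mono simplex_area_mono simK) auto
        moreover have "4 * C\<^sub>\<rho> * h\<^sup>2 \<le> 2 * (c\<^sub>q * h)" using h_c2 mult_pos_pos[OF cq_pos h_pos] by linarith
        ultimately show ?thesis using bounds[OF h(1) h_le dm x0(1) _ h_R] unfolding \<alpha>_def by linarith
      qed
      have \<beta>: "\<beta> \<le> surface_area TYPE('d) \<K> (cball (x i) (2 * c\<^sub>q * h))" if i: "i < N" for i
      proof -
        obtain x\<^sub>0 where x0: "x\<^sub>0 \<in> \<Union>\<K>" "dist (x i) x\<^sub>0 \<le> c\<^sub>q * h" using node_near[OF i] by blast
        have "cball x\<^sub>0 (c\<^sub>q * h) \<subseteq> cball (x i) (2 * c\<^sub>q * h)"
        proof
          fix y assume "y \<in> cball x\<^sub>0 (c\<^sub>q * h)"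
          then show "y \<in> cball (x i) (2 * c\<^sub>q * h)" using x0(2) dist_triangle[of "x i" y x\<^sub>0] by simp
        qed
        then have "surface_area TYPE('d) \<K> (cball x\<^sub>0 (c\<^sub>q * h)) \<le> surface_area TYPE('d) \<K> (cball (x i) (2 * c\<^sub>q * h))"
          by (intro sum_mono simplex_area_mono simK) auto
        moreover have "c\<^sub>q * h \<le> R\<^sub>1" using h_R mult_pos_pos[OF cq_pos h_pos] by linarith
        then have "unit_ball_vol ?d * (c\<^sub>q * h / 8) ^ ?d \<le> B * surface_area TYPE('d) \<K> (cball x\<^sub>0 (c\<^sub>q * h))"
          using bounds[OF h(1) h_le dm x0(1) h_c2] by blast
        then have "\<beta> \<le> surface_area TYPE('d) \<K> (cball x\<^sub>0 (c\<^sub>q * h))"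
          unfolding \<beta>_def using B by (simp add: pos_divide_le_eq mult.commute)
        ultimately show ?thesis by linarith
      qed
      have \<beta>0: "0 < \<beta>" unfolding \<beta>_def using B cq_pos h_pos by simp
      have "\<alpha> / \<beta> = B\<^sup>2 * ((2 * (2 * (c\<^sub>q * h))) / (c\<^sub>q * h / 8)) ^ ?d"
      proof -
        have "B * u * p / (u * q / B) = B\<^sup>2 * (p / q)" if "0 < u" for u p q :: real
          using that by (simp add: power2_eq_square)
        moreover have "0 < unit_ball_vol (real ?d)" by simp
        ultimately show ?thesis
          unfolding \<alpha>_def \<beta>_def power_divide[of "2 * (2 * (c\<^sub>q * h))" "c\<^sub>q * h / 8"] by blast
      qed
      also have "(2 * (2 * (c\<^sub>q * h))) / (c\<^sub>q * h / 8) = 32" using cq_pos h_pos by simp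
      finally have "m * \<alpha> / \<beta> = \<Lambda>" by (simp add: \<Lambda>_def flip: times_divide_eq_right)
      moreover have "0 < N" using N by simp
      ultimately have area: "0 < surface_area TYPE('d) \<K> UNIV" and avg: "\<And>V. N * (surface_average TYPE('d) \<K> (fe V))\<^sup>2 \<le> \<Lambda>\<^sup>2 * (\<Sum>i<N. (V i)\<^sup>2)"
        using surface_average_sq_le[OF \<alpha> \<beta>0 \<beta> _ m_def] by auto
      have "sym_psd_form (P1_space \<T>) A" unfolding A by (rule sym_psd_form_add_scale[OF forms])
      from condition_number_stiffness_le[OF N area avg this _ _ _ stiff assms(5,6), of c]
      have "condition_number M \<le> C * h powi (- 2)"
        unfolding C_def using const poincare inverse by simp
    }
    ultimately have "\<exists>h\<^sub>0>0. \<forall>h \<K> \<T>' \<T>.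
      0 < h \<and> h \<le> h\<^sub>0 \<and>
      discrete_manifold TYPE('d) \<Gamma> \<delta>\<^sub>0 C\<^sub>\<rho> C\<^sub>P h \<K> \<and>
      background_mesh \<Gamma> \<delta>\<^sub>0 c\<^sub>q \<sigma> h \<T>' \<and> \<T> = active_mesh \<T>' \<K> \<longrightarrow>
      (\<forall>N x \<phi> a s \<tau> A M.
        nodal_basis \<T> N x \<phi> \<and>
        sym_psd_form (P1_space \<T>) a \<and> sym_psd_form (P1_space \<T>) s \<and> 0 < \<tau> \<and>
        A = (\<lambda>v w. a v w + \<tau> * s v w) \<and>
        (\<forall>v\<in>P1_space \<T>. A (indicat_real (\<Union>\<T>)) v = 0) \<and>
        (\<forall>v\<in>P1_space \<T>. surface_average TYPE('d) \<K> v = 0 \<longrightarrow>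
          h powi (- int c) *
            (L2_norm_mesh \<T> (\<lambda>y. v y - surface_average TYPE('d) \<K> v))\<^sup>2 \<le> C\<^sub>1 * A v v) \<and>
        (\<forall>v\<in>P1_space \<T>. surface_average TYPE('d) \<K> v = 0 \<longrightarrow>
          A v v \<le> C\<^sub>2 * h powi (- 2 - int c) * (L2_norm_mesh \<T> v)\<^sup>2) \<and>
        stiffness_matrix N \<phi> A M \<longrightarrow>
        condition_number M \<le> C * h powi (- 2))"
      by (intro exI[of _ h\<^sub>0]) blast
  }
  ultimately show ?thesis by (intro exI[of _ C]) blast
qed

end
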